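(* For every integer $k\ge 1$, \begin{equation*} \sum_{r,s,n \geq 0} \eta_k(r,s,n)d^re^sq^n = \begin{cases} 0& \text{if $k$ is odd}, \\ \mathcal{N}_{2v}(d,e;q) & \text{if $k = 2v$}. \end{cases} \end{equation*}
   Context: An overpartition of $n$ is a partition of $n$ in which the first occurrence of a number may be overlined; an overpartition pair $(\lambda,\mu)$ of $n$ is a pair of overpartitions whose parts sum to $n$. Parts of $(\lambda,\mu)$ are ordered by $\overline{k}_{\lambda} > k_{\lambda} > \overline{k}_{\mu} > k_{\mu}$ (subscript indicating the overpartition containing the part). Writing $\ell(\cdot)$ for the largest part, $n(\cdot)$ for the number of parts, and $\overline{n}(\cdot)$ for the number of overlined parts, the rank of $(\lambda,\mu)$ is $\ell((\lambda,\mu)) - n(\lambda) - \overline{n}(\mu) - \chi((\lambda,\mu))$, where $\chi((\lambda,\mu))=1$ if the largest part of $(\lambda,\mu)$ is non-overlined and in $\mu$, and $0$ otherwise. Let $N(r,s,m,n)$ be the number of overpartition pairs of $n$ with rank $m$ such that $r$ is the number of overlined parts in $\lambda$ plus the number of non-overlined parts in $\mu$, and $s$ is the number of parts in $\mu$. Define the $k$th symmetrized rank moment $\eta_k(r,s,n) := \sum_{m \in \mathbb{Z}} \binom{m + \lfloor \frac{k-1}{2} \rfloor}{k} N(r,s,m,n)$. With $(a_1,\dots,a_j)_\infty=\prod_{k\ge0}(1-a_1q^k)\cdots(1-a_jq^k)$ and $(a_1,\dots,a_j)_n=(a_1,\dots,a_j)_\infty/(a_1q^n,\dots,a_jq^n)_\infty$,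 define for $v\ge1$ \begin{equation*} \mathcal{N}_{2v}(d,e;q) := \frac{(-dq,-eq)_{\infty}}{(q,deq)_{\infty}}\sum_{n \in \mathbb{Z} \setminus \{0\}} \frac{(-1)^{n-1}q^{\binom{n+1}{2} + vn}(de)^n\left(-1/d,-1/e\right)_n}{(1-q^n)^{2v} \left(-dq,-eq\right)_n}. \end{equation*} *)

theory Defs
  imports
    "HOL-Analysis.Analysis"
    "HOL-Computational_Algebra.Computational_Algebra"
    "HOL-Library.Multiset"
begin

text \<open>
  An overpartition is a multiset of pairs of a positive integer and a flag telling whether this
  occurrence is overlined. Only the first occurrence of a number may be overlined, so every
  number has at most one overlined occurrence.
\<close>

type_synonym overpart = "(nat \<times> bool) multiset"

definition is_overpartition :: "overpart \<Rightarrow> bool" where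
  "is_overpartition p \<longleftrightarrow> (\<forall>(k, b) \<in># p. k > 0) \<and> (\<forall>k. count p (k, True) \<le> 1)"

definition weight :: "overpart \<Rightarrow> nat" where
  "weight p = (\<Sum>(k, b) \<in># p. k)"

definition num_overlined :: "overpart \<Rightarrow> nat" where
  "num_overlined p = size (filter_mset (\<lambda>(k, b). b) p)"

definition num_nonoverlined :: "overpart \<Rightarrow> nat" where
  "num_nonoverlined p = size (filter_mset (\<lambda>(k, b). \<not> b) p)"

definition overpartition_pairs :: "nat \<Rightarrow> (overpart \<times> overpart) set" where
  "overpartition_pairs n =
     {(l, m). is_overpartition l \<and> is_overpartition m \<and> weight l + weight m = n}"

text \<open>
  Parts of a pair \<open>(\<lambda>, \<mu>)\<close>. The order is lexicographic, with \<open>False < True\<close> on the flags, which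
  for parts of equal size \<open>k\<close> reads: overlined in \<open>\<lambda>\<close>, then non-overlined in \<open>\<lambda>\<close>, then overlined
  in \<open>\<mu>\<close>, then non-overlined in \<open>\<mu>\<close>, from largest to smallest.
\<close>

datatype pair_part = Part (part_size: nat) (in_lambda: bool) (overlined: bool)

lemma pair_part_eq_iff:
  "x = y \<longleftrightarrow>
     part_size x = part_size y \<and> in_lambda x = in_lambda y \<and> overlined x = overlined y"
  by (cases x; cases y) auto

instantiation pair_part :: linorder
begin

definition less_pair_part :: "pair_part \<Rightarrow> pair_part \<Rightarrow> bool" where
  "x < y \<longleftrightarrow>
     part_size x < part_size y \<or>
     part_size x = part_size y \<and>
       (in_lambda x < in_lambda y \<or> in_lambda x = in_lambda y \<and> overlined x < overlined y)"

definition less_eq_pair_part :: "pair_part \<Rightarrow> pair_part \<Rightarrow> bool" where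
  "x \<le> y \<longleftrightarrow> x < y \<or> x = (y :: pair_part)"

instance
  by intro_classes
    (auto simp: less_eq_pair_part_def less_pair_part_def pair_part_eq_iff)

end

fun pair_parts :: "overpart \<times> overpart \<Rightarrow> pair_part set" where
  "pair_parts (l, m) = (\<lambda>(k, b). Part k True b) ` set_mset l \<union> (\<lambda>(k, b). Part k False b) ` set_mset m"

text \<open>The empty pair, the only pair of \<open>0\<close>, has no largest part; it gets \<open>largest = 0\<close> and
  \<open>chi = 0\<close>, hence rank \<open>0\<close>.\<close>

definition largest :: "overpart \<times> overpart \<Rightarrow> nat" where
  "largest P = (if pair_parts P = {} then 0 else part_size (Max (pair_parts P)))"

definition chi :: "overpart \<times> overpart \<Rightarrow> nat" where
  "chi P =
     (if pair_parts P \<noteq> {} \<and>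
         \<not> overlined (Max (pair_parts P)) \<and> \<not> in_lambda (Max (pair_parts P)) then 1 else 0)"

fun rank_pair :: "overpart \<times> overpart \<Rightarrow> int" where
  "rank_pair (l, m) =
     int (largest (l, m)) - int (size l) - int (num_overlined m) - int (chi (l, m))"

definition rank_count :: "nat \<Rightarrow> nat \<Rightarrow> int \<Rightarrow> nat \<Rightarrow> nat" where
  "rank_count r s m n =
     card {(la, mu). (la, mu) \<in> overpartition_pairs n \<and> rank_pair (la, mu) = m \<and>
                     num_overlined la + num_nonoverlined mu = r \<and> size mu = s}"

text \<open>Binomial coefficient with arbitrary integer upper argument. The library operator \<open>gchoose\<close>
  is by now syntactically restricted to fields; the lemma shows the two agree.\<close>

definition int_binomial :: "int \<Rightarrow> nat \<Rightarrow> int" where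
  "int_binomial a k = (\<Prod>i = 0..<k. a - int i) div fact k"

lemma of_int_int_binomial: "of_int (int_binomial a k) = (of_int a :: rat) gchoose k"
  using of_int_gbinomial[of a k, where 'a = rat] gbinomial_prod_rev[of a k]
  by (simp add: int_binomial_def)

text \<open>The sum over \<open>m\<close> has finite support; \<open>div\<close> rounds down.\<close>

definition eta :: "nat \<Rightarrow> nat \<Rightarrow> nat \<Rightarrow> nat \<Rightarrow> int" where
  "eta k r s n =
     (\<Sum>\<^sub>\<infinity>m::int. int_binomial (m + (int k - 1) div 2) k * int (rank_count r s m n))"

text \<open>
  The generating functions are read formally. They live in the field \<open>\<rat>(d, e)((q))\<close> of Laurent
  series in \<open>q\<close>, where also \<open>1/d\<close>, \<open>1/e\<close> and negative powers of \<open>q\<close> make sense; infinite sums and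
  products are limits in its \<open>q\<close>-adic metric. The fraction field of the ring of integer
  polynomials in \<open>d\<close> and \<open>e\<close> is \<open>\<rat>(d, e)\<close>.
\<close>

type_synonym ratfun = "int poly poly fract"

definition ind_d :: "ratfun fls" where
  "ind_d = fls_const (to_fract [:[:0, 1:]:])"

definition ind_e :: "ratfun fls" where
  "ind_e = fls_const (to_fract [:0, 1:])"

abbreviation qq :: "'a::field fls" where
  "qq \<equiv> fls_X"

definition qpoch_inf :: "'a::field fls \<Rightarrow> 'a fls" where
  "qpoch_inf a = (\<Prod>k. 1 - a * qq ^ k)"

definition qpoch :: "'a::field fls \<Rightarrow> int \<Rightarrow> 'a fls" where
  "qpoch a n = qpoch_inf a / qpoch_inf (a * qq powi n)"

text \<open>\<open>N_even v d e\<close> is the series with index \<open>2v\<close>.\<close>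

definition N_even :: "nat \<Rightarrow> 'a::field fls \<Rightarrow> 'a fls \<Rightarrow> 'a fls" where
  "N_even v d e =
     (qpoch_inf (- d * qq) * qpoch_inf (- e * qq)) / (qpoch_inf qq * qpoch_inf (d * e * qq)) *
     (\<Sum>\<^sub>\<infinity>n \<in> UNIV - {0::int}.
        ((- 1) powi (n - 1) * qq powi (int_binomial (n + 1) 2 + int v * n) * (d * e) powi n *
          (qpoch (- 1 / d) n * qpoch (- 1 / e) n)) /
        ((1 - qq powi n) ^ (2 * v) * (qpoch (- d * qq) n * qpoch (- e * qq) n)))"

end

theory Submission
  imports Defs
begin

text \<open>
  Write \<open>z y = 1\<close> and \<open>q\<close> for \<open>qq\<close>. Splitting the pairs by their largest part expresses the rank
  generating function as a sum over the size of that part. A telescoping recurrence turns this sum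
  into the basic hypergeometric series \<open>\<Sum>\<^sub>n (-1/d, -1/e)\<^sub>n (d e q)\<^sup>n / (z q, y q)\<^sub>n\<close>. Its
  denominators form a Bailey pair with a free parameter \<open>z\<close>, so the Bailey lemma (that is, the
  q-Gauss sum) gives the product \<open>(-dq, -eq)\<^sub>\<infinity> / (q, deq)\<^sub>\<infinity>\<close> times a series whose dependence on
  \<open>z\<close> sits in the factors \<open>(1 - z)(1 - y)(1 + x) / ((1 - z x)(1 - y x))\<close> with \<open>x = q\<^sup>n\<close>. The
  coefficient of \<open>z\<^sup>m\<close> for \<open>m \<noteq> 0\<close> in this factor is \<open>- x\<^bsup>|m|-1\<^esup> (1 - x)\<close>. Hence ranks
  \<open>m\<close> and \<open>-m\<close> are equidistributed, which kills the odd symmetrized moments, and the even ones follow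
  from a binomial series in \<open>x\<close>. The terms with index \<open>n\<close> and \<open>-n\<close> of the bilateral series
  correspond to the two summands of its numerator \<open>x\<^bsup>v-1\<^esup> (1 + x)\<close>.

  The variable \<open>z\<close> is never formal: it ranges over the nonzero elements of the coefficient field,
  which is infinite, so a Laurent polynomial identity in \<open>z\<close> can be compared coefficientwise.
\<close>

text \<open>Convergence is always a matter of order in \<open>q\<close>: once the n-th term of a
  series has order at least n, evaluating, interchanging and reindexing sums reduces to finite sums
  in each coefficient. The hypergeometric identities are then proved by antidifferences, where a
  term is multiplied by a simple factor such as \<open>1 - q^n\<close> and a rational identity in
  \<open>q^n\<close> remains.

  The rank is not additive over the parts, because it contains the largest part. The subtracted
  counts are additive; marked by \<open>y\<close>, they give pairs with bounded parts a product as
  generating function.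

  The two variables of the problem are arbitrary nonzero constants for most of the proof. That they
  differ from -1 matters once the bilateral series is folded: \<open>qpoch\<close> is a quotient of
  infinite products, and at -1 a denominator can vanish.\<close>

unbundle fps_syntax

subsection \<open>The q-adic topology on Laurent series\<close>

text \<open>Zero satisfies the bound for every \<open>n\<close>, which a condition on
  \<open>fls_subdegree\<close> would not give; sums thus need no case distinction.\<close>

definition fls_ge :: "int \<Rightarrow> 'a::zero fls \<Rightarrow> bool" where
  "fls_ge n x \<longleftrightarrow> (\<forall>m<n. x $$ m = 0)"

lemma fls_geD: "fls_ge n x \<Longrightarrow> m < n \<Longrightarrow> x $$ m = 0"
  by (simp add: fls_ge_def)

lemma fls_ge_mono: "fls_ge n x \<Longrightarrow> m \<le> n \<Longrightarrow> fls_ge m x"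
  by (auto simp: fls_ge_def)

lemma fls_ge_iff_subdegree: "fls_ge n x \<longleftrightarrow> x = 0 \<or> n \<le> fls_subdegree x"
  by (auto simp: fls_ge_def intro: fls_subdegree_geI)

lemma fls_ge_subdegree: "fls_ge (fls_subdegree x) x"
  by (simp add: fls_ge_iff_subdegree)

lemma fls_ge_0 [simp]: "fls_ge n 0"
  by (simp add: fls_ge_def)

lemma fls_ge_add: "fls_ge n x \<Longrightarrow> fls_ge n y \<Longrightarrow> fls_ge n (x + y)"
  by (simp add: fls_ge_def)

lemma fls_ge_uminus: "fls_ge n x \<Longrightarrow> fls_ge n (- x :: 'a::group_add fls)"
  by (simp add: fls_ge_def)

lemma fls_ge_diff: "fls_ge n x \<Longrightarrow> fls_ge n y \<Longrightarrow> fls_ge n (x - y :: 'a::group_add fls)"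
  by (simp add: fls_ge_def)

lemma fls_ge_sum: "(\<And>i. i \<in> A \<Longrightarrow> fls_ge n (f i)) \<Longrightarrow> fls_ge n (sum f A)"
  by (induction A rule: infinite_finite_induct) (auto intro: fls_ge_add)

lemma fls_ge_mult:
  fixes x y :: "'a::semiring_no_zero_divisors fls"
  assumes "fls_ge m x" "fls_ge n y"
  shows "fls_ge (m + n) (x * y)"
  using assms by (cases "x = 0 \<or> y = 0") (auto simp: fls_ge_iff_subdegree)

lemma fls_ge_mult':
  fixes x y :: "'a::semiring_no_zero_divisors fls"
  assumes "fls_ge m x" "fls_ge n y" "k \<le> m + n"
  shows "fls_ge k (x * y)"
  using fls_ge_mono fls_ge_mult assms by blast

lemma fls_ge_const [simp]: "fls_ge 0 (fls_const c)"
  by (simp add: fls_ge_def)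

lemma fls_ge_one [simp]: "fls_ge 0 (1 :: 'a::{zero,one} fls)"
  by (simp add: fls_ge_def)

lemma fls_ge_minus_one_power [simp]: "fls_ge 0 ((- 1) ^ n :: 'a::field fls)"
  by (cases "even n") (auto intro: fls_ge_uminus)

lemma fls_ge_X_power: "k \<le> int n \<Longrightarrow> fls_ge k (qq ^ n)"
  by (auto simp: fls_ge_def fls_X_power_conv_shift_1)

lemma fls_ge_power: "fls_ge k x \<Longrightarrow> fls_ge (int n * k) (x ^ n)" for x :: "'a::field fls"
  by (induction n) (auto simp: algebra_simps intro!: fls_ge_mult')

lemma fls_ge_prod0: "(\<And>i. i \<in> A \<Longrightarrow> fls_ge 0 (f i)) \<Longrightarrow> fls_ge 0 (prod f A)"
  for f :: "_ \<Rightarrow> 'a::field fls"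
  by (induction A rule: infinite_finite_induct) (auto intro: fls_ge_mult'[of 0 _ 0])

text \<open>Principal units. They are nonzero and closed under products and inverses, and dividing
  by one of them preserves an order bound.\<close>

definition fls_one_unit :: "'a::field fls \<Rightarrow> bool" where
  "fls_one_unit x \<longleftrightarrow> fls_ge 1 (x - 1)"

lemma fls_one_unit_ge: "fls_one_unit x \<Longrightarrow> fls_ge 0 x"
  using fls_ge_add[OF fls_ge_mono[of 1 "x - 1" 0] fls_ge_one] by (auto simp: fls_one_unit_def)

lemma fls_one_unit_nz: "fls_one_unit x \<Longrightarrow> x \<noteq> 0"
  by (auto simp: fls_one_unit_def fls_ge_def dest: spec[of _ 0])

lemma fls_one_unit_one [simp]: "fls_one_unit 1"
  by (simp add: fls_one_unit_def)

lemma fls_one_unit_mult: "fls_one_unit x \<Longrightarrow> fls_one_unit y \<Longrightarrow> fls_one_unit (x * y)"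
proof -
  assume a: "fls_one_unit x" "fls_one_unit y"
  have "fls_ge 1 ((x - 1) * y + (y - 1))"
    using a fls_one_unit_ge[OF a(2)]
    by (intro fls_ge_add fls_ge_mult'[of 1 _ 0]) (auto simp: fls_one_unit_def)
  thus ?thesis by (simp add: fls_one_unit_def algebra_simps)
qed

lemma fls_one_unit_prod: "(\<And>i. i \<in> A \<Longrightarrow> fls_one_unit (f i)) \<Longrightarrow> fls_one_unit (prod f A)"
  by (induction A rule: infinite_finite_induct) (auto intro: fls_one_unit_mult)

lemma fls_one_unit_power: "fls_one_unit x \<Longrightarrow> fls_one_unit (x ^ n)"
  by (induction n) (auto intro: fls_one_unit_mult)

lemma fls_ge_inverse:
  assumes "fls_one_unit x" shows "fls_ge 0 (inverse x)"
proof -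
  have "x $$ 0 = 1" using assms by (auto simp: fls_one_unit_def fls_ge_def dest: spec[of _ 0])
  hence "fls_subdegree x = 0"
    using fls_one_unit_ge[OF assms] by (intro fls_subdegree_eqI) (auto simp: fls_ge_def)
  thus ?thesis by (simp add: fls_ge_iff_subdegree fls_inverse_subdegree)
qed

lemma fls_one_unit_inverse: "fls_one_unit x \<Longrightarrow> fls_one_unit (inverse x)"
proof -
  assume a: "fls_one_unit x"
  have "fls_ge 1 (- ((x - 1) * inverse x))"
    using a fls_ge_inverse[OF a]
    by (intro fls_ge_uminus fls_ge_mult'[of 1 _ 0]) (auto simp: fls_one_unit_def)
  moreover have "- ((x - 1) * inverse x) = inverse x - 1"
    using fls_one_unit_nz[OF a] by (simp add: algebra_simps)
  ultimately show ?thesis by (simp add: fls_one_unit_def)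
qed

lemma fls_one_unit_divide: "fls_one_unit x \<Longrightarrow> fls_one_unit y \<Longrightarrow> fls_one_unit (x / y)"
  by (simp add: divide_inverse fls_one_unit_mult fls_one_unit_inverse)

lemma fls_ge_divide: "fls_ge k x \<Longrightarrow> fls_one_unit y \<Longrightarrow> fls_ge k (x / y)"
  unfolding divide_inverse by (rule fls_ge_mult'[where n = 0]) (auto intro: fls_ge_inverse)

lemma fls_one_unit_minus: "fls_ge 1 x \<Longrightarrow> fls_one_unit (1 - x)"
  using fls_ge_uminus by (auto simp: fls_one_unit_def)

text \<open>The distance of distinct series is 2 to the power of minus the order of their
  difference, so the strict inequality costs one unit of order. Negative orders give distances above
  1.\<close>

lemma dist_fls_less_iff:
  fixes x y :: "'a::group_add fls"
  shows "dist x y < inverse (2 ^ N) \<longleftrightarrow> fls_ge (int N + 1) (x - y)"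
proof (cases "x = y")
  case False
  show ?thesis
  proof (cases "fls_subdegree (x - y) \<ge> 0")
    case True
    thus ?thesis using False
      by (auto simp: dist_fls_def fls_ge_iff_subdegree inverse_less_iff_less)
  next
    case neg: False
    have "inverse (2 ^ N) \<le> (1::real)" by (simp add: field_simps)
    also have "1 \<le> (2::real) ^ nat (- fls_subdegree (x - y))" by simp
    finally show ?thesis using False neg by (auto simp: dist_fls_def fls_ge_iff_subdegree)
  qed
qed simp

lemma tendsto_fls_iff:
  fixes g :: "'a::group_add fls"
  shows "(f \<longlongrightarrow> g) F \<longleftrightarrow> (\<forall>N. eventually (\<lambda>x. fls_ge N (f x - g)) F)"
proof
  assume lim: "(f \<longlongrightarrow> g) F"
  show "\<forall>N. eventually (\<lambda>x. fls_ge N (f x - g)) F"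
  proof
    fix N
    have "eventually (\<lambda>x. dist (f x) g < inverse (2 ^ nat N)) F"
      using lim by (auto simp: tendsto_iff)
    thus "eventually (\<lambda>x. fls_ge N (f x - g)) F"
      by eventually_elim (auto simp: dist_fls_less_iff elim!: fls_ge_mono)
  qed
next
  assume *: "\<forall>N. eventually (\<lambda>x. fls_ge N (f x - g)) F"
  show "(f \<longlongrightarrow> g) F"
    unfolding tendsto_iff
  proof safe
    fix \<epsilon> :: real assume "\<epsilon> > 0"
    then obtain N where N: "inverse (2 ^ N) < \<epsilon>"
      using real_arch_pow_inv[of \<epsilon> "1/2"] by (auto simp: power_divide inverse_eq_divide)
    from *[rule_format, of "int N + 1"]
    show "eventually (\<lambda>x. dist (f x) g < \<epsilon>) F"
      by eventually_elim (use N in \<open>auto simp flip: dist_fls_less_iff\<close>)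
  qed
qed

instance fls :: (ab_group_add) topological_ab_group_add
proof
  fix a b :: "'a fls"
  have "((\<lambda>x::'a fls. x) \<longlongrightarrow> a) (nhds a)" for a by (rule filterlim_ident)
  note lim = this[unfolded tendsto_fls_iff, rule_format]
  show "LIM x (nhds a \<times>\<^sub>F nhds b). fst x + snd x :> nhds (a + b)"
    unfolding tendsto_fls_iff
  proof
    fix N
    from eventually_prodI[OF lim[of N a] lim[of N b]]
    show "eventually (\<lambda>x. fls_ge N (fst x + snd x - (a + b))) (nhds a \<times>\<^sub>F nhds b)"
      by eventually_elim (use fls_ge_add in \<open>fastforce simp: algebra_simps\<close>)
  qed
  show "(uminus \<longlongrightarrow> - a) (nhds a)"
    unfolding tendsto_fls_iff
  proof
    fix N
    from lim[of N a] show "eventually (\<lambda>x. fls_ge N (- x - - a)) (nhds a)"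
      by eventually_elim (use fls_ge_uminus in \<open>fastforce simp: algebra_simps\<close>)
  qed
qed

instance fls :: (field) topological_semigroup_mult
proof
  fix a b :: "'a fls"
  have "((\<lambda>x::'a fls. x) \<longlongrightarrow> a) (nhds a)" for a by (rule filterlim_ident)
  note lim = this[unfolded tendsto_fls_iff, rule_format]
  show "LIM x (nhds a \<times>\<^sub>F nhds b). fst x * snd x :> nhds (a * b)"
    unfolding tendsto_fls_iff
  proof
    fix N
    \<comment> \<open>Close to \<open>b\<close> the second factor still has order at least
      \<open>B\<close>, so \<open>x y - a b = (x - a) y + a (y - b)\<close> is small in both
      summands.\<close>
    define A B where "A = fls_subdegree a" and "B = min 0 (fls_subdegree b)"
    from eventually_prodI[OF lim[of "N - B" a] lim[of "max 0 (N - A)" b]]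
    show "eventually (\<lambda>x. fls_ge N (fst x * snd x - (a * b))) (nhds a \<times>\<^sub>F nhds b)"
    proof eventually_elim
      case (elim x)
      have "fls_ge B (b + (snd x - b))"
        by (intro fls_ge_add fls_ge_mono[OF fls_ge_subdegree] fls_ge_mono[OF elim[THEN conjunct2]])
           (auto simp: B_def)
      hence "fls_ge N ((fst x - a) * snd x)"
        using elim by (intro fls_ge_mult'[of "N - B" _ B]) auto
      moreover have "fls_ge N (a * (snd x - b))"
        using elim by (intro fls_ge_mult'[of A _ "max 0 (N - A)"]) (auto simp: A_def fls_ge_subdegree)
      ultimately have "fls_ge N ((fst x - a) * snd x + a * (snd x - b))" by (rule fls_ge_add)
      thus ?case by (simp add: algebra_simps)
    qed
  qed
qed

section \<open>Series whose n-th term has order at least n\<close>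

lemma tendsto_fls_ge:
  fixes f :: "nat \<Rightarrow> 'a::group_add fls"
  assumes "\<And>n. fls_ge (int n) (f n - a)"
  shows "f \<longlonglongrightarrow> a"
  unfolding tendsto_fls_iff
proof
  fix N
  show "eventually (\<lambda>n. fls_ge N (f n - a)) sequentially"
    using eventually_ge_at_top[of "nat N"] by eventually_elim (auto intro: fls_ge_mono[OF assms])
qed

lemma Lim_fls_ge:
  fixes f :: "_ \<Rightarrow> 'a::ab_group_add fls"
  assumes "(f \<longlongrightarrow> a) F" "\<And>x. fls_ge N (f x)" "F \<noteq> bot"
  shows "fls_ge N a"
proof -
  have "eventually (\<lambda>x. fls_ge N (f x - a)) F" using assms(1) by (simp add: tendsto_fls_iff)
  then obtain x where "fls_ge N (f x - a)" using assms(3) by (metis eventually_happens)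
  from fls_ge_diff[OF assms(2)[of x] this] show ?thesis by simp
qed

text \<open>Terms beyond index \<open>nat N\<close> cannot reach the coefficient of order
  \<open>N\<close>. For negative \<open>N\<close> only the term of index 0 is listed, and its
  coefficient is 0 as well.\<close>

lemma sums_fls:
  fixes f :: "nat \<Rightarrow> 'a::ab_group_add fls"
  assumes f: "\<And>n. fls_ge (int n) (f n)"
  shows "f sums suminf f" and "suminf f $$ N = (\<Sum>n\<le>nat N. f n $$ N)"
proof -
  have nth_sum: "(\<Sum>n\<in>A. f n) $$ m = (\<Sum>n\<in>A. f n $$ m)" for A m
    by (induction A rule: infinite_finite_induct) auto
  define s where "s = Abs_fls (\<lambda>m. \<Sum>n\<le>nat m. f n $$ m)"
  have s: "s $$ m = (\<Sum>n\<le>nat m. f n $$ m)" for m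
  proof -
    have *: "\<forall>m<0. (\<Sum>n\<le>nat m. f n $$ m) = 0"
      by (auto intro!: sum.neutral fls_geD[OF f])
    show ?thesis unfolding s_def by (subst nth_Abs_fls_lower_bound[OF *]) auto
  qed
  have "(\<lambda>M. \<Sum>n<M. f n) \<longlonglongrightarrow> s"
  proof (rule tendsto_fls_ge)
    fix M
    show "fls_ge (int M) ((\<Sum>n<M. f n) - s)"
      unfolding fls_ge_def
    proof safe
      fix m assume m: "m < int M"
      have "(\<Sum>n<M. f n $$ m) = (\<Sum>n\<le>nat m. f n $$ m)"
        using m by (cases "m < 0")
          (auto intro!: sum.mono_neutral_right fls_geD[OF f] sum.neutral simp: fls_geD[OF f])
      thus "((\<Sum>n<M. f n) - s) $$ m = 0" by (simp add: s nth_sum)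
    qed
  qed
  hence "f sums s" by (simp add: sums_def)
  thus "f sums suminf f" and "suminf f $$ N = (\<Sum>n\<le>nat N. f n $$ N)"
    using s by (auto simp: sums_iff)
qed

lemma suminf_fls_ge:
  fixes f :: "nat \<Rightarrow> 'a::ab_group_add fls"
  assumes f: "\<And>n. fls_ge (int n) (f n)" and k: "\<And>n. fls_ge k (f n)"
  shows "fls_ge k (suminf f)"
  using k by (auto simp: fls_ge_def sums_fls(2)[OF f] intro!: sum.neutral)

text \<open>The two bounds confine the coefficient of order \<open>N\<close> to the square of
  indices up to \<open>nat N\<close>, where finite sums commute.\<close>

lemma suminf_swap_fls:
  fixes f :: "nat \<Rightarrow> nat \<Rightarrow> 'a::ab_group_add fls"
  assumes "\<And>m n. fls_ge (int m) (f m n)" "\<And>m n. fls_ge (int n) (f m n)"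
  shows "(\<Sum>m. \<Sum>n. f m n) = (\<Sum>n. \<Sum>m. f m n)"
proof (rule fls_eqI)
  fix N
  have "(\<Sum>m. \<Sum>n. f m n) $$ N = (\<Sum>m\<le>nat N. \<Sum>n\<le>nat N. f m n $$ N)"
    by (subst sums_fls(2)) (auto intro!: suminf_fls_ge assms simp: sums_fls(2) assms)
  also have "\<dots> = (\<Sum>n\<le>nat N. \<Sum>m\<le>nat N. f m n $$ N)" by (rule sum.swap)
  also have "\<dots> = (\<Sum>n. \<Sum>m. f m n) $$ N"
    by (subst sums_fls(2)) (auto intro!: suminf_fls_ge assms simp: sums_fls(2) assms)
  finally show "(\<Sum>m. \<Sum>n. f m n) $$ N = (\<Sum>n. \<Sum>m. f m n) $$ N" .
qed

lemma sums_mult_fls: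
  fixes c :: "'a::field fls"
  shows "f sums a \<Longrightarrow> (\<lambda>n. c * f n) sums (c * a)"
  unfolding sums_def sum_distrib_left[symmetric] by (intro tendsto_intros)

lemma sums_diff_fls:
  fixes f :: "nat \<Rightarrow> 'a::ab_group_add fls"
  shows "f sums a \<Longrightarrow> g sums b \<Longrightarrow> (\<lambda>n. f n - g n) sums (a - b)"
  unfolding sums_def sum_subtractf by (intro tendsto_intros)

lemma suminf_mult_fls:
  fixes c :: "'a::field fls"
  assumes "\<And>n. fls_ge (int n) (f n)"
  shows "(\<Sum>n. c * f n) = c * suminf f"
  using sums_mult_fls[OF sums_fls(1)[OF assms], of c] by (simp add: sums_iff)

lemma telescope_sums_fls:
  fixes g :: "nat \<Rightarrow> 'a::ab_group_add fls"
  assumes "\<And>n. fls_ge (int n) (g n)"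
  shows "(\<lambda>n. g n - g (Suc n)) sums g 0"
proof -
  have "g \<longlonglongrightarrow> 0" by (rule tendsto_fls_ge) (simp add: assms)
  hence "(\<lambda>n. g 0 - g n) \<longlonglongrightarrow> g 0 - 0" by (intro tendsto_intros)
  thus ?thesis by (simp add: sums_def sum_lessThan_telescope')
qed

lemma suminf_split_head_fls:
  fixes f :: "nat \<Rightarrow> 'a::ab_group_add fls"
  assumes "\<And>n. fls_ge (int n) (f n)"
  shows "suminf f = f 0 + (\<Sum>n. f (Suc n))"
proof -
  have "(\<lambda>n. f (Suc n)) sums (\<Sum>n. f (Suc n))"
    using fls_ge_mono[OF assms] by (intro sums_fls) auto
  from sums_Suc[OF this] show ?thesis by (simp add: sums_iff add.commute)
qed

text \<open>By the ultrametric inequality, enlarging \<open>B\<close> only adds an element of order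
  at least \<open>N\<close>; one good finite set for each \<open>N\<close> is therefore
  enough.\<close>

lemma has_sum_flsI:
  fixes f :: "'i \<Rightarrow> 'a::ab_group_add fls"
  assumes "\<And>N. \<exists>B. finite B \<and> B \<subseteq> A \<and> (\<forall>i\<in>A - B. fls_ge N (f i)) \<and> fls_ge N (sum f B - S)"
  shows "(f has_sum S) A"
  unfolding has_sum_def tendsto_fls_iff
proof
  fix N
  obtain B where B: "finite B" "B \<subseteq> A" "\<And>i. i \<in> A - B \<Longrightarrow> fls_ge N (f i)" "fls_ge N (sum f B - S)"
    using assms[of N] by blast
  have "fls_ge N (sum f C - S)" if "finite C" "B \<subseteq> C" "C \<subseteq> A" for C
  proof -
    have "sum f C = sum f (C - B) + sum f B"
      using that B by (subst sum.subset_diff[of B C]) auto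
    moreover have "fls_ge N (sum f (C - B))" using that B by (intro fls_ge_sum) auto
    ultimately have "sum f C - S = sum f (C - B) + (sum f B - S)" "fls_ge N (sum f (C - B))"
      by (auto simp: algebra_simps)
    thus ?thesis using B(4) by (metis fls_ge_add)
  qed
  thus "\<forall>\<^sub>F C in finite_subsets_at_top A. fls_ge N (sum f C - S)"
    using B by (auto simp: eventually_finite_subsets_at_top intro!: exI[of _ B])
qed

subsection \<open>Shifted factorials\<close>

text \<open>A finite product, unlike \<open>qpoch\<close>; \<open>qpoch_nonneg\<close> and
  \<open>qpoch_neg\<close> connect the two.\<close>

definition fpoch :: "'a::field fls \<Rightarrow> nat \<Rightarrow> 'a fls" where
  "fpoch a n = (\<Prod>j<n. 1 - a * qq ^ j)"

lemma fpoch_0 [simp]: "fpoch a 0 = 1"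
  by (simp add: fpoch_def)

lemma fpoch_Suc: "fpoch a (Suc n) = fpoch a n * (1 - a * qq ^ n)"
  by (simp add: fpoch_def)

lemma fpoch_add: "fpoch a (m + n) = fpoch a m * fpoch (a * qq ^ m) n"
  by (induction n) (simp_all add: fpoch_Suc power_add algebra_simps)

lemma fpoch_shift: "fpoch (a * qq) n * (1 - a) = fpoch a n * (1 - a * qq ^ n)"
  using fpoch_add[of a 1 n] fpoch_add[of a n 1] by (simp add: fpoch_Suc algebra_simps)

lemma fls_ge_fpoch: "fls_ge 0 a \<Longrightarrow> fls_ge 0 (fpoch a n)"
  unfolding fpoch_def
  by (intro fls_ge_prod0 fls_ge_diff fls_ge_one fls_ge_mult'[of 0 _ 0] fls_ge_X_power) auto

lemma fls_one_unit_minus_X_power: "fls_ge 1 a \<Longrightarrow> fls_one_unit (1 - a * qq ^ n)"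
  by (intro fls_one_unit_minus fls_ge_mult'[of 1 _ 0] fls_ge_X_power) auto

lemma fls_one_unit_fpoch: "fls_ge 1 a \<Longrightarrow> fls_one_unit (fpoch a n)"
  unfolding fpoch_def by (intro fls_one_unit_prod fls_one_unit_minus_X_power)

lemma fls_ge_X [simp]: "fls_ge 1 qq"
  using fls_ge_X_power[of 1 1] by simp

lemma fls_ge_times_X: "fls_ge 0 a \<Longrightarrow> fls_ge 1 (a * qq)"
  by (rule fls_ge_mult'[of 0 _ 1]) auto

lemma fpoch_has_prod:
  fixes a :: "'a::field fls"
  assumes a: "fls_ge 1 a"
  shows "fpoch a \<longlonglongrightarrow> qpoch_inf a" and "fls_one_unit (qpoch_inf a)"
proof -
  \<comment> \<open>The increment \<open>fpoch a (Suc n) - fpoch a n\<close>, which turns the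
    partial products into partial sums of growing order.\<close>
  define g where "g n = - (a * qq ^ n * fpoch a n)" for n
  have g: "fls_ge (int n) (g n)" for n
    unfolding g_def using fls_one_unit_ge[OF fls_one_unit_fpoch[OF a]] a
    by (intro fls_ge_uminus fls_ge_mult'[of "int n" _ 0] fls_ge_mult'[of 0 _ "int n"] fls_ge_X_power)
       (auto elim: fls_ge_mono)
  have eq: "fpoch a n = 1 + (\<Sum>k<n. g k)" for n
    by (induction n) (auto simp: g_def fpoch_Suc algebra_simps)
  have "(\<lambda>n. 1 + (\<Sum>k<n. g k)) \<longlonglongrightarrow> 1 + suminf g"
    using sums_fls(1)[of g, OF g] unfolding sums_def by (intro tendsto_intros)
  hence lim: "fpoch a \<longlonglongrightarrow> 1 + suminf g" unfolding eq[symmetric] .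
  have "((\<lambda>n. fpoch a n - 1) \<longlongrightarrow> 1 + suminf g - 1) sequentially" by (intro tendsto_intros lim)
  hence u: "fls_one_unit (1 + suminf g)" unfolding fls_one_unit_def
    by (rule Lim_fls_ge) (use fls_one_unit_fpoch[OF a] in \<open>auto simp: fls_one_unit_def\<close>)
  have "(\<lambda>n. \<Prod>i\<le>n. 1 - a * qq ^ i) \<longlonglongrightarrow> 1 + suminf g"
    using LIMSEQ_Suc[OF lim] by (simp add: fpoch_def lessThan_Suc_atMost)
  \<comment> \<open>Taken from index 0, the raw product must have a nonzero limit, hence the unit
    property above.\<close>
  hence "(\<lambda>k. 1 - a * qq ^ k) has_prod (1 + suminf g)"
    using fls_one_unit_nz[OF u] by (simp add: has_prod_def raw_has_prod_def)
  hence "qpoch_inf a = 1 + suminf g" unfolding qpoch_inf_def by (metis has_prod_unique)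
  thus "fpoch a \<longlonglongrightarrow> qpoch_inf a" "fls_one_unit (qpoch_inf a)" using lim u by auto
qed

text \<open>Only the shifted base must have positive order, so \<open>a\<close> itself may have a
  pole in \<open>q\<close>. Negative indices of \<open>qpoch\<close> lead to such bases.\<close>

lemma qpoch_inf_split:
  fixes a :: "'a::field fls"
  assumes a: "fls_ge 1 (a * qq ^ n)" and nz: "\<And>j. j < n \<Longrightarrow> 1 - a * qq ^ j \<noteq> 0"
  shows "qpoch_inf a = fpoch a n * qpoch_inf (a * qq ^ n)"
proof -
  let ?L = "fpoch a n * qpoch_inf (a * qq ^ n)"
  have "(\<lambda>m. fpoch a n * fpoch (a * qq ^ n) m) \<longlonglongrightarrow> ?L"
    by (intro tendsto_intros fpoch_has_prod a)
  hence "(\<lambda>m. fpoch a (m + n)) \<longlonglongrightarrow> ?L" by (simp add: fpoch_add[symmetric] add.commute)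
  hence "fpoch a \<longlonglongrightarrow> ?L" by (rule LIMSEQ_offset)
  hence "(\<lambda>n. \<Prod>i\<le>n. 1 - a * qq ^ i) \<longlonglongrightarrow> ?L"
    using LIMSEQ_Suc by (fastforce simp: fpoch_def lessThan_Suc_atMost)
  moreover have "?L \<noteq> 0"
    using nz fls_one_unit_nz[OF fpoch_has_prod(2)[OF a]] by (auto simp: fpoch_def)
  ultimately have "(\<lambda>k. 1 - a * qq ^ k) has_prod ?L"
    by (simp add: has_prod_def raw_has_prod_def)
  thus ?thesis unfolding qpoch_inf_def by (metis has_prod_unique)
qed

lemma qpoch_inf_split':
  fixes a :: "'a::field fls"
  assumes a: "fls_ge 1 a"
  shows "qpoch_inf a = fpoch a n * qpoch_inf (a * qq ^ n)"
proof (rule qpoch_inf_split)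
  show "fls_ge 1 (a * qq ^ n)" by (intro fls_ge_mult'[of 1 _ 0] fls_ge_X_power a) auto
  show "1 - a * qq ^ j \<noteq> 0" for j
    by (intro fls_one_unit_nz fls_one_unit_minus_X_power a)
qed

subsection \<open>The q-Gauss sum\<close>

context
  fixes a b :: "'a::field fls"
  assumes ab: "fls_ge 0 a" "fls_ge 0 b"
begin

text \<open>The q-Gauss series has argument \<open>c / (a b)\<close> for a lower parameter
  \<open>c\<close>. Taking the argument \<open>t\<close> as the variable, with
  \<open>c = a b t\<close>, avoids division by \<open>a\<close> and \<open>b\<close>.\<close>

definition gauss_term :: "'a fls \<Rightarrow> nat \<Rightarrow> 'a fls" where
  "gauss_term t n = fpoch a n * fpoch b n / (fpoch qq n * fpoch (a * b * t) n) * t ^ n"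

lemma gauss_C: "fls_ge k t \<Longrightarrow> fls_ge k (a * b * t)"
  using ab fls_ge_mult'[of 0 _ k] fls_ge_mult'[of 0 a 0 b 0] by auto

lemma fls_ge_gauss_term:
  assumes "fls_ge k t" "k \<ge> 1"
  shows "fls_ge (int n * k) (gauss_term t n)"
proof -
  have "fls_ge 0 (fpoch a n * fpoch b n / (fpoch qq n * fpoch (a * b * t) n))"
    by (intro fls_ge_divide fls_ge_mult'[of 0 _ 0] fls_ge_fpoch
      fls_one_unit_mult fls_one_unit_fpoch ab fls_ge_mono[OF gauss_C[OF assms(1)]] assms(2)) auto
  thus ?thesis unfolding gauss_term_def
    by (intro fls_ge_mult'[of 0 _ "int n * k"] fls_ge_power assms(1)) auto
qed

lemma fls_ge_gauss_term': "fls_ge 1 t \<Longrightarrow> fls_ge (int n) (gauss_term t n)"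
  using fls_ge_gauss_term[of 1 t n] by simp

text \<open>Term by term, the two sides differ by \<open>(1 - C) (h n - h (Suc n))\<close>. The sum
  telescopes, and \<open>h 0 = 0\<close> leaves no boundary term.\<close>

lemma gauss_contiguous:
  assumes t: "fls_ge 1 t"
  shows "(1 - t) * (1 - a * b * t) * suminf (gauss_term t)
           = (1 - a * t) * (1 - b * t) * suminf (gauss_term (t * qq))"
proof -
  define C where "C = a * b * t"
  define h where "h n = gauss_term t n * (1 - qq ^ n)" for n
  have C: "fls_ge 1 C" unfolding C_def by (rule gauss_C[OF t])
  have tq: "fls_ge 1 (t * qq)" by (rule fls_ge_mult'[OF t fls_ge_X]) simp
  have h: "fls_ge (int n) (h n)" for n unfolding h_def
    by (intro fls_ge_mult'[of "int n" _ 0] fls_ge_gauss_term' t fls_ge_diff fls_ge_X_power) auto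
  have step: "(1 - t) * (1 - C) * gauss_term t n - (1 - a * t) * (1 - b * t) * gauss_term (t * qq) n
      = (1 - C) * (h n - h (Suc n))" for n
  proof -
    define x where "x = (qq ^ n :: 'a fls)"
    note nz = fls_one_unit_nz[OF fls_one_unit_minus_X_power[OF C], of n, folded x_def]
      fls_one_unit_nz[OF fls_one_unit_minus_X_power[OF C], of 0]
      fls_one_unit_nz[OF fls_one_unit_minus_X_power[OF fls_ge_X[where 'a='a]], of n, folded x_def]
      fls_one_unit_nz[OF fls_one_unit_fpoch[OF C], of n]
      fls_one_unit_nz[OF fls_one_unit_fpoch[OF fls_ge_X[where 'a='a]], of n]
    have Cq: "fpoch (a * b * (t * qq)) n = fpoch C n * (1 - C * x) / (1 - C)"
      using fpoch_shift[of C n] nz by (simp add: C_def x_def field_simps)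
    have 1: "gauss_term (t * qq) n = gauss_term t n * (x * (1 - C) / (1 - C * x))"
      using nz unfolding gauss_term_def Cq C_def[symmetric] x_def[symmetric] power_mult_distrib
        power_mult[symmetric] mult.commute[of 1]
      by (simp add: x_def[symmetric] field_simps)
    have 2: "h (Suc n) = gauss_term t n * (t * (1 - a * x) * (1 - b * x) / (1 - C * x))"
    proof -
      define E1 E2 where "E1 = 1 - C * x" and "E2 = 1 - qq * x"
      have "E1 \<noteq> 0" "E2 \<noteq> 0" using nz by (auto simp: E1_def E2_def)
      thus ?thesis
        using nz unfolding gauss_term_def h_def fpoch_Suc power_Suc C_def[symmetric] x_def[symmetric]
          E1_def[symmetric] E2_def[symmetric]
        by (simp add: divide_simps mult_ac)
    qed
    have nz': "1 - C * x \<noteq> 0" using nz by (simp add: x_def)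
    define G u w where "G = gauss_term t n" and "u = x * (1 - C) / (1 - C * x)"
      and "w = t * (1 - a * x) * (1 - b * x) / (1 - C * x)"
    \<comment> \<open>With the common factor \<open>G\<close> removed, a rational identity in
      \<open>x = q^n\<close> remains.\<close>
    have "(1 - t) * (1 - C) - (1 - a * t) * (1 - b * t) * u = (1 - C) * ((1 - x) - w)"
      using nz' unfolding u_def w_def by (simp add: divide_simps) (simp add: C_def, algebra)
    hence "G * ((1 - t) * (1 - C) - (1 - a * t) * (1 - b * t) * u) = G * ((1 - C) * ((1 - x) - w))"
      by simp
    thus ?thesis unfolding 1 2 h_def[of n] u_def[symmetric] w_def[symmetric] G_def[symmetric]
        x_def[symmetric]
      by algebra
  qed
  have "(\<lambda>n. (1 - C) * (h n - h (Suc n))) sums ((1 - C) * h 0)"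
    by (intro sums_mult_fls telescope_sums_fls h)
  moreover have "(\<lambda>n. (1 - t) * (1 - C) * gauss_term t n - (1 - a * t) * (1 - b * t) * gauss_term (t * qq) n)
     sums ((1 - t) * (1 - C) * suminf (gauss_term t)
           - (1 - a * t) * (1 - b * t) * suminf (gauss_term (t * qq)))"
    by (intro sums_diff_fls sums_mult_fls sums_fls fls_ge_gauss_term' t tq)
  ultimately have "(1 - t) * (1 - C) * suminf (gauss_term t)
           - (1 - a * t) * (1 - b * t) * suminf (gauss_term (t * qq)) = (1 - C) * h 0"
    unfolding step by (rule sums_unique2[rotated])
  thus ?thesis by (simp add: h_def C_def)
qed

text \<open>Iterating the contiguous relation moves the argument to \<open>t q^n\<close>. There the
  series tends to its first term 1, and the accumulated factors tend to the four infinite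
  products.\<close>

lemma q_gauss:
  assumes t: "fls_ge 1 t"
  shows "suminf (gauss_term t)
           = qpoch_inf (a * t) * qpoch_inf (b * t) / (qpoch_inf (a * b * t) * qpoch_inf t)"
proof -
  have at: "fls_ge 1 (a * t)" "fls_ge 1 (b * t)" "fls_ge 1 (a * b * t)"
    using ab t gauss_C by (auto intro!: fls_ge_mult'[of 0 _ 1])
  have tq: "fls_ge (int n + 1) (t * qq ^ n)" for n
    by (rule fls_ge_mult'[OF t fls_ge_X_power[OF order_refl]]) simp
  have iter: "fpoch t n * fpoch (a * b * t) n * suminf (gauss_term t)
      = fpoch (a * t) n * fpoch (b * t) n * suminf (gauss_term (t * qq ^ n))" for n
  proof (induction n)
    case (Suc n)
    have "fpoch t (Suc n) * fpoch (a * b * t) (Suc n) * suminf (gauss_term t)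
      = (1 - t * qq ^ n) * (1 - a * b * t * qq ^ n) * (fpoch t n * fpoch (a * b * t) n * suminf (gauss_term t))"
      by (simp add: fpoch_Suc mult_ac)
    also have "\<dots> = fpoch (a * t) n * fpoch (b * t) n *
       ((1 - t * qq ^ n) * (1 - a * b * (t * qq ^ n)) * suminf (gauss_term (t * qq ^ n)))"
      unfolding Suc by (simp add: mult_ac)
    also have "\<dots> = fpoch (a * t) (Suc n) * fpoch (b * t) (Suc n) * suminf (gauss_term (t * qq ^ Suc n))"
      by (subst gauss_contiguous) (auto intro: fls_ge_mono[OF tq] simp: fpoch_Suc mult_ac)
    finally show ?case .
  qed simp
  have "(\<lambda>n. suminf (gauss_term (t * qq ^ n))) \<longlonglongrightarrow> 1"
  proof (rule tendsto_fls_ge)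
    fix n
    have ge: "fls_ge (int m) (gauss_term (t * qq ^ n) m)" for m
      by (intro fls_ge_gauss_term' fls_ge_mono[OF tq]) auto
    have "suminf (gauss_term (t * qq ^ n)) = 1 + (\<Sum>m. gauss_term (t * qq ^ n) (Suc m))"
      by (subst suminf_split_head_fls) (use ge in \<open>auto simp: gauss_term_def\<close>)
    moreover have "fls_ge (int n) (\<Sum>m. gauss_term (t * qq ^ n) (Suc m))"
      by (intro suminf_fls_ge fls_ge_mono[OF ge] fls_ge_mono[OF fls_ge_gauss_term[OF tq]])
         (auto simp: algebra_simps)
    ultimately show "fls_ge (int n) (suminf (gauss_term (t * qq ^ n)) - 1)" by simp
  qed
  hence "(\<lambda>n. fpoch (a * t) n * fpoch (b * t) n * suminf (gauss_term (t * qq ^ n)))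
     \<longlonglongrightarrow> qpoch_inf (a * t) * qpoch_inf (b * t) * 1"
    by (intro tendsto_intros fpoch_has_prod at)
  moreover have "(\<lambda>n. fpoch t n * fpoch (a * b * t) n * suminf (gauss_term t))
     \<longlonglongrightarrow> qpoch_inf t * qpoch_inf (a * b * t) * suminf (gauss_term t)"
    by (intro tendsto_intros fpoch_has_prod at t)
  ultimately have "qpoch_inf t * qpoch_inf (a * b * t) * suminf (gauss_term t)
      = qpoch_inf (a * t) * qpoch_inf (b * t)"
    unfolding iter using LIMSEQ_unique by fastforce
  moreover have "qpoch_inf t \<noteq> 0" "qpoch_inf (a * b * t) \<noteq> 0"
    by (intro fls_one_unit_nz fpoch_has_prod at t)+
  ultimately show ?thesis by (simp add: field_simps)
qed

end

subsection \<open>The unit Bailey pair with a free parameter\<close>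

abbreviation qfac :: "nat \<Rightarrow> 'a::field fls" where
  "qfac n \<equiv> fpoch qq n"

lemma qfac_nz [simp]: "qfac n \<noteq> 0"
  by (intro fls_one_unit_nz fls_one_unit_fpoch fls_ge_X)

lemma one_minus_X_power_nz [simp]: "n > 0 \<Longrightarrow> 1 - qq ^ n \<noteq> (0 :: 'a::field fls)"
  by (intro fls_one_unit_nz fls_one_unit_minus fls_ge_X_power) auto

lemma qfac_Suc: "qfac (Suc n) = qfac n * (1 - qq ^ Suc n)"
  by (simp add: fpoch_Suc)

text \<open>The exponent \<open>\<Sum>{..<r}\<close> is \<open>r (r - 1) / 2\<close>. By the
  q-binomial theorem, the sum of
  \<open>(- 1)^r q^(r (r - 1) / 2) / ((q)_(n - r) (q)_(n + r))\<close> over \<open>r\<close> from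
  \<open>- n\<close> to \<open>n\<close> vanishes; the factor \<open>1 + q^r\<close> folds
  \<open>r\<close> and \<open>- r\<close> together, and the right-hand side is minus the middle
  term.\<close>

lemma alternating_qfac_sum:
  assumes n: "n > 0"
  shows "(\<Sum>r=1..n. (- 1) ^ r * qq ^ (\<Sum>{..<r}) * (1 + qq ^ r) / (qfac (n - r) * qfac (n + r)))
           = - 1 / (qfac n * qfac n :: 'a::field fls)"
proof -
  define s :: "nat \<Rightarrow> 'a fls"
    where "s r = (- 1) ^ r * qq ^ (\<Sum>{..<r}) / (qfac (n - r) * qfac (n + r))" for r
  define H where "H r = s r * (1 - qq ^ (n + r)) / (1 - qq ^ n)" for r
  \<comment> \<open>The case \<open>r = n\<close> is excluded because \<open>n - Suc n\<close> is
    truncated to 0, so \<open>s (Suc n)\<close> would not vanish as it should. The last term is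
    instead identified with \<open>H n\<close>.\<close>
  have step: "s r * (1 + qq ^ r) = H r - H (Suc r)" if "r < n" for r
  proof -
    obtain k where k: "n = r + Suc k" using \<open>r < n\<close> by (metis less_imp_Suc_add add_Suc_right)
    define x u :: "'a fls" where "x = qq ^ r" and "u = qq ^ Suc k"
    define p where "p = s r"
    define E1 E2 E3 where "E1 = 1 - u" and "E2 = 1 - x * u * x * qq" and "E3 = 1 - x * u"
    have nz: "E1 \<noteq> 0" "E2 \<noteq> 0" "E3 \<noteq> 0"
      using one_minus_X_power_nz[of "Suc k"] one_minus_X_power_nz[of "Suc (n + r)"]
        one_minus_X_power_nz[of n]
      by (simp_all add: E1_def E2_def E3_def u_def x_def k power_add mult_ac)
    have sSuc: "s (Suc r) = - p * x * E1 / E2"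
    proof -
      have *: "n - r = Suc k" "n - Suc r = k" "n + Suc r = Suc (n + r)" "\<Sum>{..<Suc r} = \<Sum>{..<r} + r"
        using k by auto
      have **: "(1 - qq ^ Suc k) = E1" "1 - qq ^ Suc (n + r) = E2"
        by (simp_all add: E1_def E2_def u_def x_def k power_add mult_ac)
      show ?thesis unfolding p_def s_def * qfac_Suc[of k] qfac_Suc[of "n + r"] ** power_add x_def[symmetric]
        using nz by (simp add: divide_simps)
    qed
    have a: "qq ^ (n + r) = x * u * x" "qq ^ (n + Suc r) = x * u * x * qq" "qq ^ n = x * u"
      by (simp_all add: k x_def u_def power_add)
    have "p * (1 + x) = p * (1 - x * u * x) / E3 - (- p * x * E1 / E2) * E2 / E3"
      using nz by (simp add: divide_simps) (simp add: E1_def E3_def, algebra)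
    thus ?thesis unfolding H_def sSuc a x_def[symmetric] p_def[symmetric]
      by (simp add: E2_def E3_def)
  qed
  have "(\<Sum>r=1..M. s r * (1 + qq ^ r)) = H 1 - H (Suc M)" if "M < n" for M
    using that by (induction M) (auto simp: step)
  from this[of "n - 1"] have "(\<Sum>r=1..n-1. s r * (1 + qq ^ r)) = H 1 - H n" using n by simp
  moreover have "(\<Sum>r=1..n. s r * (1 + qq ^ r)) = (\<Sum>r=1..n-1. s r * (1 + qq ^ r)) + s n * (1 + qq ^ n)"
    using n by (cases n) auto
  moreover have "H n = s n * (1 + qq ^ n)"
  proof -
    have "qq ^ (n + n) = qq ^ n * (qq ^ n :: 'a fls)" by (simp add: power_add)
    thus ?thesis unfolding H_def using one_minus_X_power_nz[OF n, where 'a = 'a]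
      by (simp add: divide_simps algebra_simps)
  qed
  moreover have "H 1 = - 1 / (qfac n * qfac n)"
  proof -
    obtain k where k: "n = Suc k" using n by (cases n) auto
    define E where "E = (1 - qq ^ Suc (Suc k) :: 'a fls)"
    define E' where "E' = (1 - qq ^ Suc k :: 'a fls)"
    have "E \<noteq> 0" "E' \<noteq> 0" unfolding E_def E'_def by (rule one_minus_X_power_nz; simp)+
    moreover have "n - 1 = k" "n + 1 = Suc (Suc k)" "\<Sum>{..<1::nat} = 0" using k by auto
    ultimately show ?thesis unfolding H_def s_def
      by (simp only: k qfac_Suc E_def[symmetric] E'_def[symmetric]) (simp add: divide_simps)
  qed
  ultimately show ?thesis by (simp add: s_def mult_ac)
qed

text \<open>The alpha side of a Bailey pair relative to 1, with beta side
  \<open>1 / ((z q)_n (y q)_n)\<close>. The general formula combines \<open>r\<close> and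
  \<open>- r\<close>; at \<open>r = 0\<close> it would count the central term twice, giving 2 when
  \<open>z\<close> and \<open>y\<close> differ from 1.\<close>

definition bailey_alpha :: "'a::field fls \<Rightarrow> 'a fls \<Rightarrow> nat \<Rightarrow> 'a fls" where
  "bailey_alpha z y r = (if r = 0 then 1 else
     (- 1) ^ r * (1 - z) * (1 - y) * qq ^ (\<Sum>{..r}) * (1 + qq ^ r)
       / ((1 - z * qq ^ r) * (1 - y * qq ^ r)))"

text \<open>Since \<open>z y = 1\<close>, with \<open>n = Suc k\<close> one has \<open>(1 - z q^n)
  (1 - y q^n) = (1 - q^(n-r)) (1 - q^(n+r)) + q^(n-r) (1 - z q^r) (1 - y q^r)\<close>. The first
  summand lowers \<open>n\<close> in the q-factorials; the second cancels the denominators of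
  \<open>bailey_alpha\<close> and leaves a multiple of the vanishing q-binomial sum.\<close>

lemma bailey_pair_step:
  fixes z y :: "'a::field fls"
  assumes z: "fls_ge 0 z" and y: "fls_ge 0 y" and yz: "z * y = 1"
  defines "S \<equiv> \<lambda>n. \<Sum>r\<le>n. bailey_alpha z y r / (qfac (n - r) * qfac (n + r))"
  shows "(1 - z * qq ^ Suc k) * (1 - y * qq ^ Suc k) * S (Suc k) = S k"
proof -
  define n where "n = Suc k"
  define w where "w = (1 - z) * (1 - y)"
  define A where "A = bailey_alpha z y"
  have nz: "1 - z * qq ^ r \<noteq> 0" "1 - y * qq ^ r \<noteq> 0" if "r > 0" for r
    using that by (intro fls_one_unit_nz fls_one_unit_minus fls_ge_mult'[of 0 _ 1] z y fls_ge_X_power; simp)+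
  \<comment> \<open>The value at \<open>r = n\<close> is set to 0, in accordance with the factor
    \<open>1 - q^(n-r)\<close>.\<close>
  define f where "f r = (if r \<le> k then A r / (qfac (k - r) * qfac (k + r)) else 0)" for r
  define g where "g r = A r * qq ^ (n - r) * (1 - z * qq ^ r) * (1 - y * qq ^ r) / (qfac (n - r) * qfac (n + r))" for r
  have *: "(1 - z * qq ^ n) * (1 - y * qq ^ n) * (A r / (qfac (n - r) * qfac (n + r))) = f r + g r"
    if "r \<le> n" for r
  proof (cases "r = n")
    case True
    thus ?thesis by (simp add: f_def g_def n_def)
  next
    case False
    hence r: "r \<le> k" using that by (simp add: n_def)
    define x u :: "'a fls" where "x = qq ^ r" and "u = qq ^ (n - r)"
    have N: "qq ^ n = u * x" using that by (simp add: x_def u_def flip: power_add)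
    have Nr: "qq ^ (n + r) = u * x * x" using N by (simp add: x_def power_add)
    have "n - r = Suc (k - r)" "n + r = Suc (k + r)" using r by (auto simp: n_def)
    hence P: "qfac (n - r) = qfac (k - r) * (1 - u)" "qfac (n + r) = qfac (k + r) * (1 - u * x * x)"
      using Nr by (simp_all add: qfac_Suc u_def)
    have nz: "1 - u \<noteq> 0" "1 - u * x * x \<noteq> 0"
      using qfac_nz[of "n - r", where 'a = 'a] qfac_nz[of "n + r", where 'a = 'a] unfolding P by auto
    define E1 E2 where "E1 = 1 - u" and "E2 = 1 - u * x * x"
    have E: "E1 \<noteq> 0" "E2 \<noteq> 0" using nz by (auto simp: E1_def E2_def)
    have "(1 - z * (u * x)) * (1 - y * (u * x)) = E1 * E2 + u * (1 - z * x) * (1 - y * x)"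
      unfolding E1_def E2_def using yz by algebra
    thus ?thesis using r E unfolding f_def g_def P N x_def[symmetric] u_def[symmetric]
        E1_def[symmetric] E2_def[symmetric]
      by (simp add: divide_simps) (simp add: algebra_simps)
  qed
  have g0: "g 0 = w * qq ^ n / (qfac n * qfac n)"
    by (simp add: g_def A_def bailey_alpha_def w_def)
  have g: "g r = w * qq ^ n * ((- 1) ^ r * qq ^ (\<Sum>{..<r}) * (1 + qq ^ r) / (qfac (n - r) * qfac (n + r)))"
    if "r \<in> {1..n}" for r
  proof -
    have "\<Sum>{..r} + (n - r) = \<Sum>{..<r} + n" using that by (simp add: lessThan_Suc_atMost[symmetric])
    hence "qq ^ (\<Sum>{..r}) * qq ^ (n - r) = (qq ^ (\<Sum>{..<r}) * qq ^ n :: 'a fls)"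
      by (simp flip: power_add)
    thus ?thesis unfolding g_def A_def bailey_alpha_def w_def using nz[of r] that
      by (simp add: divide_simps)
  qed
  have "(\<Sum>r\<le>n. g r) = g 0 + (\<Sum>r=1..n. g r)"
    by (simp add: atMost_atLeast0 sum.atLeast_Suc_atMost)
  also have "(\<Sum>r=1..n. g r) = w * qq ^ n * (- 1 / (qfac n * qfac n))"
  proof -
    have "n > 0" by (simp add: n_def)
    show ?thesis unfolding alternating_qfac_sum[OF \<open>n > 0\<close>, where 'a = 'a, symmetric] sum_distrib_left
      by (intro sum.cong refl g)
  qed
  finally have "(\<Sum>r\<le>n. g r) = 0" by (simp add: g0)
  moreover have "(\<Sum>r\<le>n. f r) = S k"
    by (simp add: n_def f_def S_def A_def)
  moreover have "(1 - z * qq ^ n) * (1 - y * qq ^ n) * S n = (\<Sum>r\<le>n. f r + g r)"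
    unfolding S_def A_def[symmetric] sum_distrib_left by (intro sum.cong refl *) auto
  ultimately show ?thesis by (simp add: n_def sum.distrib)
qed

lemma bailey_pair:
  fixes z y :: "'a::field fls"
  assumes "fls_ge 0 z" "fls_ge 0 y" "z * y = 1"
  shows "(\<Sum>r\<le>n. bailey_alpha z y r / (qfac (n - r) * qfac (n + r)))
           = 1 / (fpoch (z * qq) n * fpoch (y * qq) n)"
proof (induction n)
  case 0
  show ?case by (simp add: bailey_alpha_def)
next
  case (Suc n)
  have nz: "1 - z * qq ^ Suc n \<noteq> 0" "1 - y * qq ^ Suc n \<noteq> 0"
    by (intro fls_one_unit_nz fls_one_unit_minus fls_ge_mult'[of 0 _ 1] assms fls_ge_X_power; simp)+
  have "fpoch (a * qq) (Suc n) = fpoch (a * qq) n * (1 - a * qq ^ Suc n)" for a :: "'a fls"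
    by (simp add: fpoch_Suc mult_ac)
  note fp = this
  have aux: "S = 1 / (p * a * (p' * b))" if "a * b * S = 1 / (p * p')" "a \<noteq> 0" "b \<noteq> 0"
    for S p p' a b :: "'a fls"
  proof -
    have "S = (a * b * S) / (a * b)" using that(2,3) by simp
    thus ?thesis unfolding that(1) by (simp add: mult_ac)
  qed
  show ?case unfolding fp by (rule aux[OF bailey_pair_step[OF assms, of n, unfolded Suc] nz])
qed

subsection \<open>The Bailey lemma for the unit pair\<close>

text \<open>This is \<open>d^n (-1/d)_n\<close> with the denominators cleared; its order bound needs
  no assumption on \<open>1/d\<close>.\<close>

definition rpoch :: "'a::field fls \<Rightarrow> nat \<Rightarrow> 'a fls" where
  "rpoch d n = (\<Prod>j<n. d + qq ^ j)"

lemma rpoch_0 [simp]: "rpoch d 0 = 1"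
  by (simp add: rpoch_def)

lemma rpoch_Suc: "rpoch d (Suc n) = rpoch d n * (d + qq ^ n)"
  by (simp add: rpoch_def)

lemma fls_ge_rpoch: "fls_ge 0 d \<Longrightarrow> fls_ge 0 (rpoch d n)"
  unfolding rpoch_def by (intro fls_ge_prod0 fls_ge_add fls_ge_X_power) auto

lemma rpoch_add:
  assumes "d \<noteq> 0"
  shows "rpoch d (r + k) = rpoch d r * d ^ k * fpoch (- (qq ^ r / d)) k"
  using assms by (induction k) (simp_all add: rpoch_Suc fpoch_Suc power_add field_simps)

lemma rpoch_conv_fpoch:
  assumes "d \<noteq> 0"
  shows "rpoch d n = d ^ n * fpoch (- 1 / d) n"
  using rpoch_add[OF assms, of 0 n] by simp

text \<open>In the coefficient of order \<open>N\<close>, the triangle \<open>r + k \<le> N\<close>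
  and the whole square give the same sum, because the terms outside the triangle have order above
  \<open>N\<close>.\<close>

lemma suminf_antidiagonal_fls:
  fixes f :: "nat \<Rightarrow> nat \<Rightarrow> 'a::ab_group_add fls"
  assumes f: "\<And>r k. fls_ge (int (r + k)) (f r k)"
  shows "(\<Sum>n. \<Sum>r\<le>n. f r (n - r)) = (\<Sum>r. \<Sum>k. f r k)"
proof (rule fls_eqI)
  fix N
  have nth_sum: "(\<Sum>n\<in>A. g n) $$ m = (\<Sum>n\<in>A. g n $$ m)" for A m and g :: "nat \<Rightarrow> 'a fls"
    by (induction A rule: infinite_finite_induct) auto
  have f': "fls_ge (int k) (f r k)" "fls_ge (int r) (f r k)" for r k
    by (rule fls_ge_mono[OF f], simp)+
  have "(\<Sum>n. \<Sum>r\<le>n. f r (n - r)) $$ N = (\<Sum>n\<le>nat N. \<Sum>r\<le>n. f r (n - r) $$ N)"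
    by (subst sums_fls(2)) (auto intro!: fls_ge_sum fls_ge_mono[OF f] simp: nth_sum)
  also have "\<dots> = (\<Sum>(r, k) | r + k \<le> nat N. f r k $$ N)"
    by (rule sum.triangle_reindex_eq[symmetric])
  also have "\<dots> = (\<Sum>(r, k) \<in> {..nat N} \<times> {..nat N}. f r k $$ N)"
    by (rule sum.mono_neutral_left) (auto intro!: fls_geD[OF f])
  also have "\<dots> = (\<Sum>r. \<Sum>k. f r k) $$ N"
    by (subst sums_fls(2))
       (auto intro!: suminf_fls_ge f' simp: sums_fls(2)[OF f'(1)] sum.cartesian_product)
  finally show "(\<Sum>n. \<Sum>r\<le>n. f r (n - r)) $$ N = (\<Sum>r. \<Sum>k. f r k) $$ N" .
qed

definition pair_product :: "'a::field fls \<Rightarrow> 'a fls \<Rightarrow> 'a fls" where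
  "pair_product d e =
     (qpoch_inf (- d * qq) * qpoch_inf (- e * qq)) / (qpoch_inf qq * qpoch_inf (d * e * qq))"

text \<open>The weight of \<open>alpha_r\<close> in the Bailey lemma with \<open>a = 1\<close> and
  free parameters \<open>-1/d\<close> and \<open>-1/e\<close>, that is
  \<open>(-1/d)_r (-1/e)_r (d e q)^r / ((-d q)_r (-e q)_r)\<close>.\<close>

definition kappa :: "'a::field fls \<Rightarrow> 'a fls \<Rightarrow> nat \<Rightarrow> 'a fls" where
  "kappa d e r = rpoch d r * rpoch e r * qq ^ r / (fpoch (- d * qq) r * fpoch (- e * qq) r)"

lemma fls_ge_kappa:
  assumes "fls_ge 0 d" "fls_ge 0 e"
  shows "fls_ge (int r) (kappa d e r)"
  unfolding kappa_def
  by (intro fls_ge_divide fls_ge_mult'[of 0 _ "int r"] fls_ge_mult'[of 0 _ 0] fls_ge_rpoch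
      fls_ge_X_power fls_one_unit_mult fls_one_unit_fpoch fls_ge_mult'[of 0 _ 1] fls_ge_uminus assms)
    auto

lemma fls_ge_bailey_alpha:
  assumes "fls_ge 0 z" "fls_ge 0 y"
  shows "fls_ge 0 (bailey_alpha z y r)"
proof (cases "r = 0")
  case False
  have "fls_ge 0 ((- 1) ^ r * (1 - z) * (1 - y) * qq ^ (\<Sum>{..r}) * (1 + qq ^ r))"
    by (intro fls_ge_mult'[of 0 _ 0] fls_ge_diff fls_ge_add assms fls_ge_X_power) (auto intro: sum_nonneg)
  moreover have "fls_one_unit ((1 - z * qq ^ r) * (1 - y * qq ^ r))"
    using False by (intro fls_one_unit_mult fls_one_unit_minus fls_ge_mult'[of 0 _ 1] fls_ge_X_power assms) auto
  ultimately show ?thesis using False by (simp add: bailey_alpha_def fls_ge_divide)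
qed (simp add: bailey_alpha_def)

text \<open>Expand the denominators by \<open>bailey_pair\<close> and put \<open>n = r + k\<close>.
  For fixed \<open>r\<close> the sum over \<open>k\<close> is a q-Gauss sum, whose value separates
  into a product free of \<open>r\<close> and the weight \<open>kappa\<close>. The bounds on
  \<open>1 / d\<close> and \<open>1 / e\<close> give its numerator parameters nonnegative
  order.\<close>

lemma unit_bailey_lemma:
  fixes d e z y :: "'a::field fls"
  assumes de: "fls_ge 0 d" "fls_ge 0 e" "fls_ge 0 (1 / d)" "fls_ge 0 (1 / e)" "d \<noteq> 0" "e \<noteq> 0"
    and zy: "fls_ge 0 z" "fls_ge 0 y" "z * y = 1"
  shows "(\<Sum>n. rpoch d n * rpoch e n * qq ^ n / (fpoch (z * qq) n * fpoch (y * qq) n))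
           = pair_product d e * (\<Sum>r. bailey_alpha z y r * kappa d e r)"
proof -
  define A where "A = bailey_alpha z y"
  define G where "G r k = rpoch d (r + k) * rpoch e (r + k) * qq ^ (r + k) * A r
    / (qfac k * qfac (k + 2 * r))" for r k
  have G: "fls_ge (int (r + k)) (G r k)" for r k
  proof -
    have "fls_ge (int (r + k)) (rpoch d (r + k) * rpoch e (r + k) * qq ^ (r + k) * A r)"
      unfolding A_def
      by (intro fls_ge_mult'[of "int (r + k)" _ 0] fls_ge_mult'[of 0 _ "int (r + k)"]
          fls_ge_mult'[of 0 _ 0] fls_ge_rpoch fls_ge_X_power fls_ge_bailey_alpha de zy) auto
    thus ?thesis unfolding G_def
      by (intro fls_ge_divide fls_one_unit_mult fls_one_unit_fpoch fls_ge_X) auto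
  qed
  have "(\<Sum>n. rpoch d n * rpoch e n * qq ^ n / (fpoch (z * qq) n * fpoch (y * qq) n))
      = (\<Sum>n. \<Sum>r\<le>n. G r (n - r))"
  proof (intro suminf_cong)
    fix n
    have "rpoch d n * rpoch e n * qq ^ n / (fpoch (z * qq) n * fpoch (y * qq) n)
      = rpoch d n * rpoch e n * qq ^ n * (\<Sum>r\<le>n. A r / (qfac (n - r) * qfac (n + r)))"
      unfolding A_def bailey_pair[OF zy] by simp
    also have "\<dots> = (\<Sum>r\<le>n. G r (n - r))"
      unfolding sum_distrib_left
      by (intro sum.cong refl) (auto simp: G_def mult_2 intro!: arg_cong2[of _ _ _ _ "(/)"])
    finally show "rpoch d n * rpoch e n * qq ^ n / (fpoch (z * qq) n * fpoch (y * qq) n)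
      = (\<Sum>r\<le>n. G r (n - r))" .
  qed
  also have "\<dots> = (\<Sum>r. \<Sum>k. G r k)" by (rule suminf_antidiagonal_fls[OF G])
  also have "\<dots> = (\<Sum>r. pair_product d e * (A r * kappa d e r))"
  proof (intro suminf_cong)
    fix r
    \<comment> \<open>The tails of \<open>rpoch\<close> after \<open>r\<close> factors supply
      \<open>a\<close> and \<open>b\<close>; \<open>t\<close> then satisfies
      \<open>a b t = q^(2 r + 1)\<close>, the base left after splitting \<open>qfac (2 * r)\<close>
      off \<open>qfac (k + 2 * r)\<close>.\<close>
    define a b t where "a = - (qq ^ r / d)" and "b = - (qq ^ r / e)" and "t = d * e * qq"
    have div: "x / d = x * (1 / d)" "x / e = x * (1 / e)" for x by simp_all
    have ab: "fls_ge 0 a" "fls_ge 0 b" unfolding a_def b_def div[of "qq ^ r"]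
      by (intro fls_ge_uminus fls_ge_mult'[of 0 _ 0] fls_ge_X_power de; simp)+
    have t: "fls_ge 1 t" unfolding t_def by (intro fls_ge_times_X fls_ge_mult'[of 0 _ 0] de) auto
    have pr: "a * t = (- e * qq) * qq ^ r" "b * t = (- d * qq) * qq ^ r"
        "a * b * t = qq * qq ^ (2 * r)"
      using de by (simp_all add: a_def b_def t_def mult_2 power_add)
    have "G r k = A r * (rpoch d r * rpoch e r * qq ^ r / qfac (2 * r)) * gauss_term a b t k" for k
    proof -
      have "qfac (k + 2 * r) = qfac (2 * r) * fpoch (a * b * t) k"
        unfolding pr by (subst add.commute) (rule fpoch_add)
      moreover have "t ^ k = d ^ k * e ^ k * qq ^ k" by (simp add: t_def power_mult_distrib)
      ultimately show ?thesis
        unfolding G_def gauss_term_def[OF ab] rpoch_add[OF de(5)] rpoch_add[OF de(6)]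
          a_def[symmetric] b_def[symmetric]
        by (simp add: power_add mult_ac)
    qed
    hence "(\<Sum>k. G r k) = (\<Sum>k. A r * (rpoch d r * rpoch e r * qq ^ r / qfac (2 * r)) * gauss_term a b t k)"
      by (rule suminf_cong)
    also have "\<dots> = A r * (rpoch d r * rpoch e r * qq ^ r / qfac (2 * r)) * suminf (gauss_term a b t)"
      by (rule suminf_mult_fls[OF fls_ge_gauss_term'[OF ab t]])
    also have "suminf (gauss_term a b t) = qpoch_inf (- e * qq * qq ^ r) * qpoch_inf (- d * qq * qq ^ r)
      / (qpoch_inf (qq * qq ^ (2 * r)) * qpoch_inf (d * e * qq))"
      unfolding q_gauss[OF ab t] pr by (simp add: t_def)
    also have "A r * (rpoch d r * rpoch e r * qq ^ r / qfac (2 * r)) * \<dots> = pair_product d e * (A r * kappa d e r)"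
    proof -
      have u: "fls_ge 1 (- e * qq)" "fls_ge 1 (- d * qq)"
        by (intro fls_ge_times_X fls_ge_uminus de)+
      have s: "qpoch_inf (- e * qq) = fpoch (- e * qq) r * qpoch_inf (- e * qq * qq ^ r)"
          "qpoch_inf (- d * qq) = fpoch (- d * qq) r * qpoch_inf (- d * qq * qq ^ r)"
          "qpoch_inf qq = qfac (2 * r) * qpoch_inf (qq * qq ^ (2 * r) :: 'a fls)"
        by (intro qpoch_inf_split' u fls_ge_X)+
      have "fpoch (- e * qq) r \<noteq> 0" "fpoch (- d * qq) r \<noteq> 0"
        by (intro fls_one_unit_nz fls_one_unit_fpoch u)+
      thus ?thesis unfolding pair_product_def kappa_def s by simp
    qed
    finally show "(\<Sum>k. G r k) = pair_product d e * (A r * kappa d e r)" .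
  qed
  also have "\<dots> = pair_product d e * (\<Sum>r. A r * kappa d e r)"
  proof (rule suminf_mult_fls)
    show "fls_ge (int r) (A r * kappa d e r)" for r
      unfolding A_def by (rule fls_ge_mult'[OF fls_ge_bailey_alpha fls_ge_kappa]) (use de zy in auto)
  qed
  finally show ?thesis by (simp add: A_def)
qed

subsection \<open>Transformation of the largest-part generating function\<close>

text \<open>The share of the rank generating function due to pairs whose largest part is
  \<open>Suc n\<close>, as \<open>max_term_eq_pair_gf\<close> shows for constants with
  \<open>z y = 1\<close>.\<close>

definition max_term :: "'a::field fls \<Rightarrow> 'a fls \<Rightarrow> 'a fls \<Rightarrow> 'a fls \<Rightarrow> nat \<Rightarrow> 'a fls" where
  "max_term d e z y n = (1 + d) * (1 + e) * qq ^ Suc n * z ^ n *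
     fpoch (- d * y * qq) n * fpoch (- e * y * qq) n / (fpoch (y * qq) (Suc n) * fpoch (d * e * qq) (Suc n))"

context
  fixes d e z y :: "'a::field fls"
  assumes ge: "fls_ge 0 d" "fls_ge 0 e" "fls_ge 0 z" "fls_ge 0 y" and zy: "z * y = 1"
begin

text \<open>A 3phi2 term with a numerator parameter \<open>q\<close> that cancels
  \<open>(q)_n\<close>. The index \<open>i\<close> shifts one lower parameter and the argument
  together; \<open>i > 0\<close> gives the argument positive order.\<close>

definition phi_term :: "nat \<Rightarrow> nat \<Rightarrow> 'a fls" where
  "phi_term i n = fpoch (- d * y * qq) n * fpoch (- e * y * qq) n
     / (fpoch (y * qq ^ Suc i) n * fpoch (d * e * qq * qq) n) * (z * qq ^ i) ^ n"

lemma unit_phi: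
  "fls_one_unit (fpoch (y * qq ^ Suc i) n)" "fls_one_unit (fpoch (d * e * qq * qq) n)"
  "fls_one_unit (1 - y * qq ^ Suc i)" "fls_one_unit (1 - d * e * qq)"
  "fls_one_unit (1 - z * qq ^ Suc i)"
  by (intro fls_one_unit_fpoch fls_one_unit_minus fls_ge_times_X fls_ge_mult'[of 0 _ 1]
      fls_ge_mult'[of 0 _ 0] fls_ge_X_power ge; simp)+

lemma fls_ge_phi: "i > 0 \<Longrightarrow> fls_ge (int n) (phi_term i n)"
proof -
  assume i: "i > 0"
  have "fls_ge (int n * 1) ((z * qq ^ i) ^ n)"
    using i by (intro fls_ge_power fls_ge_mult'[of 0 _ 1] ge fls_ge_X_power) auto
  moreover have "fls_ge 0 (fpoch (- d * y * qq) n * fpoch (- e * y * qq) n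
     / (fpoch (y * qq ^ Suc i) n * fpoch (d * e * qq * qq) n))"
    by (intro fls_ge_divide fls_one_unit_mult unit_phi fls_ge_mult'[of 0 _ 0] fls_ge_fpoch
        fls_ge_uminus ge fls_ge_mono[OF fls_ge_X]) auto
  ultimately show ?thesis unfolding phi_term_def by (intro fls_ge_mult'[of 0 _ "int n"]) auto
qed

text \<open>The antidifference \<open>g\<close> is the term times \<open>1 - d e q^(n+1)\<close>.
  Its initial value \<open>g 0\<close> is the inhomogeneous term \<open>1 - d e q\<close>.\<close>

lemma phi_step:
  assumes i: "i > 0"
  shows "(1 - z * qq ^ i) * suminf (phi_term i)
    = (1 - d * e * qq) + (d + qq ^ i) * (e + qq ^ i) * qq / (1 - y * qq ^ Suc i) * suminf (phi_term (Suc i))"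
proof -
  define D C where "D = y * qq ^ Suc i" and "C = d * e * qq * qq"
  define g where "g n = phi_term i n * (1 - d * e * qq * qq ^ n)" for n
  define K where "K = (d + qq ^ i) * (e + qq ^ i) * qq / (1 - D)"
  have D: "fls_ge 1 D" and C: "fls_ge 1 C" unfolding D_def C_def
    by (intro fls_ge_mult'[of 0 _ 1] fls_ge_mult'[of 0 _ 0] ge fls_ge_X_power fls_ge_mono[OF fls_ge_X] fls_ge_X; simp)+
  have step: "(1 - z * qq ^ i) * phi_term i n - K * phi_term (Suc i) n = g n - g (Suc n)" for n
  proof -
    define x p t where "x = (qq ^ n :: 'a fls)" and "p = (qq ^ i :: 'a fls)" and "t = phi_term i n"
    define E1 E2 E3 where "E1 = 1 - D * x" and "E2 = 1 - D" and "E3 = 1 - C * x"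
    have nz: "E1 \<noteq> 0" "E2 \<noteq> 0" "E3 \<noteq> 0" "fpoch D n \<noteq> 0" "fpoch C n \<noteq> 0"
      using fls_one_unit_minus_X_power[OF D, of n] fls_one_unit_minus_X_power[OF D, of 0]
       fls_one_unit_minus_X_power[OF C, of n] fls_one_unit_fpoch[OF D] fls_one_unit_fpoch[OF C]
      by (auto simp: E1_def E2_def E3_def x_def dest: fls_one_unit_nz)
    have Dq: "fpoch (y * qq ^ Suc (Suc i)) n = fpoch D n * E1 / E2"
      using fpoch_shift[of D n] nz by (simp add: E1_def E2_def D_def x_def field_simps)
    define P where "P = fpoch (- d * y * qq) n * fpoch (- e * y * qq) n"
    have t: "t = P / (fpoch D n * fpoch C n) * (z * p) ^ n"
      by (simp add: t_def phi_term_def P_def C_def D_def p_def)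
    have "(z * qq ^ Suc i) ^ n = (z * p) ^ n * x"
      by (simp add: power_mult_distrib x_def p_def mult_ac flip: power_mult)
    hence "phi_term (Suc i) n = P / (fpoch D n * E1 / E2 * fpoch C n) * ((z * p) ^ n * x)"
      unfolding phi_term_def Dq by (simp add: P_def C_def)
    hence 1: "phi_term (Suc i) n = t * (x * E2 / E1)"
      using nz unfolding t by (simp add: mult_ac)
    have 2: "g (Suc n) = t * (z * p * (1 + d * y * qq * x) * (1 + e * y * qq * x) / E1)"
    proof -
      have "d * e * qq * qq ^ Suc n = C * x" by (simp add: C_def x_def mult_ac)
      hence "g (Suc n) = P * ((1 + d * y * qq * x) * (1 + e * y * qq * x))
          / (fpoch D n * E1 * (fpoch C n * E3)) * ((z * p) ^ n * (z * p)) * E3"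
        unfolding g_def phi_term_def fpoch_Suc
        by (simp add: P_def C_def D_def p_def x_def E1_def E3_def mult_ac)
      thus ?thesis using nz unfolding t by (simp add: mult_ac)
    qed
    have g: "g n = t * (1 - d * e * qq * x)" by (simp add: g_def t_def x_def)
    have Dp: "D = y * p * qq" by (simp add: D_def p_def mult_ac)
    define Q W where "Q = (d + p) * (e + p) * qq" and "W = z * p * (1 + d * y * qq * x) * (1 + e * y * qq * x)"
    \<comment> \<open>What remains after clearing denominators; here \<open>z y = 1\<close> enters
      the recurrence.\<close>
    have *: "(1 - z * p) * E1 - Q * x = (1 - d * e * qq * x) * E1 - W"
      unfolding E1_def Dp Q_def W_def using zy by algebra
    have aux: "a * t - (Q / E2) * (t * (x * E2 / E1)) = t * v - t * (W / E1)"
      if "a * E1 - Q * x = v * E1 - W" for a v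
    proof -
      have "a * t - (Q / E2) * (t * (x * E2 / E1)) = t * (a * E1 - Q * x) / E1"
        using nz by (simp add: right_diff_distrib diff_divide_distrib mult_ac)
      also have "\<dots> = t * v - t * (W / E1)"
        unfolding that using nz by (simp add: right_diff_distrib diff_divide_distrib mult_ac)
      finally show ?thesis .
    qed
    show ?thesis unfolding 1 2 g t_def[symmetric] p_def[symmetric] K_def E2_def[symmetric]
        Q_def[symmetric] W_def[symmetric] by (rule aux[OF *])
  qed
  have "fls_ge (int n) (g n)" for n unfolding g_def
    by (intro fls_ge_mult'[of "int n" _ 0] fls_ge_phi i fls_ge_diff fls_ge_mult'[of 0 _ 0] ge fls_ge_X_power
        fls_ge_mono[OF fls_ge_X]) auto
  hence "(\<lambda>n. g n - g (Suc n)) sums g 0" by (rule telescope_sums_fls)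
  moreover have "(\<lambda>n. (1 - z * qq ^ i) * phi_term i n - K * phi_term (Suc i) n) sums
    ((1 - z * qq ^ i) * suminf (phi_term i) - K * suminf (phi_term (Suc i)))"
    using i by (intro sums_diff_fls sums_mult_fls sums_fls fls_ge_phi) auto
  ultimately have "(1 - z * qq ^ i) * suminf (phi_term i) - K * suminf (phi_term (Suc i)) = g 0"
    unfolding step by (rule sums_unique2[rotated])
  thus ?thesis by (simp add: g_def phi_term_def K_def D_def algebra_simps)
qed

text \<open>Normalizing the sums of \<open>phi_term i\<close> to \<open>V i\<close> turns
  \<open>phi_step\<close> into \<open>T i V i = T i + T (i+1) V (i+1)\<close>. Iteration from
  \<open>i = 1\<close> peels off the terms of the right-hand series, and the remainder tends to 0.
  The summand 1 on the left is \<open>T 0\<close>.\<close>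

lemma suminf_max_term:
  "1 + suminf (max_term d e z y)
     = (\<Sum>n. rpoch d n * rpoch e n * qq ^ n / (fpoch (z * qq) n * fpoch (y * qq) n))"
proof -
  define T where "T n = rpoch d n * rpoch e n * qq ^ n / (fpoch (z * qq) n * fpoch (y * qq) n)" for n
  define V where "V i = (1 - z * qq ^ i) / (1 - d * e * qq) * suminf (phi_term i)" for i
  have zge: "fls_ge 1 (z * qq)" "fls_ge 1 (y * qq)" by (intro fls_ge_times_X ge)+
  have T: "fls_ge (int n) (T n)" for n unfolding T_def
    by (intro fls_ge_divide fls_ge_mult'[of 0 _ "int n"] fls_ge_mult'[of 0 _ 0] fls_ge_rpoch
      fls_ge_X_power fls_one_unit_mult fls_one_unit_fpoch zge ge) auto
  have nz: "1 - y * qq ^ Suc i \<noteq> 0" "1 - z * qq ^ Suc i \<noteq> 0" "1 - d * e * qq \<noteq> 0" for i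
    using unit_phi fls_one_unit_nz by blast+
  have TSuc: "T (Suc i) = T i * ((d + qq ^ i) * (e + qq ^ i) * qq / ((1 - y * qq ^ Suc i) * (1 - z * qq ^ Suc i)))" for i
    unfolding T_def rpoch_Suc fpoch_Suc by (simp add: mult_ac)
  have V: "T i * V i = T i + T (Suc i) * V (Suc i)" if "i > 0" for i
  proof -
    have "V i = ((1 - z * qq ^ i) * suminf (phi_term i)) / (1 - d * e * qq)" by (simp add: V_def)
    also have "\<dots> = 1 + (d + qq ^ i) * (e + qq ^ i) * qq / ((1 - y * qq ^ Suc i) * (1 - z * qq ^ Suc i)) * V (Suc i)"
      unfolding phi_step[OF that] V_def using nz by (simp add: add_divide_distrib)
    finally show ?thesis unfolding TSuc by (simp add: algebra_simps)
  qed
  have "max_term d e z y n = T 1 * (1 - z * qq) / (1 - d * e * qq) * phi_term 1 n" for n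
  proof -
    have *: "fpoch (y * qq) (Suc n) = (1 - y * qq) * fpoch (y * qq * qq) n"
        "fpoch (d * e * qq) (Suc n) = (1 - d * e * qq) * fpoch (d * e * qq * qq) n"
      using fpoch_add[of _ 1 n] by (auto simp: fpoch_Suc)
    have "T 1 = (1 + d) * (1 + e) * qq / ((1 - z * qq) * (1 - y * qq))"
      by (simp add: T_def rpoch_Suc fpoch_Suc add.commute)
    hence "T 1 * (1 - z * qq) = (1 + d) * (1 + e) * qq / (1 - y * qq)"
      using nz(2)[of 0] by simp
    thus ?thesis unfolding max_term_def * phi_term_def by (simp add: power_mult_distrib mult_ac)
  qed
  hence "suminf (max_term d e z y) = (\<Sum>n. T 1 * (1 - z * qq) / (1 - d * e * qq) * phi_term 1 n)"
    by (rule suminf_cong)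
  also have "\<dots> = T 1 * (1 - z * qq) / (1 - d * e * qq) * suminf (phi_term 1)"
    by (intro suminf_mult_fls fls_ge_phi) simp
  also have "\<dots> = T 1 * V 1" by (simp add: V_def)
  finally have max: "suminf (max_term d e z y) = T 1 * V 1" .
  have iter: "T 1 * V 1 = (\<Sum>i<n. T (Suc i)) + T (Suc n) * V (Suc n)" for n
  proof (induction n)
    case (Suc n)
    have "T (Suc n) * V (Suc n) = T (Suc n) + T (Suc (Suc n)) * V (Suc (Suc n))" by (rule V) simp
    with Suc show ?case by simp
  qed simp
  have "fls_ge 0 (V (Suc n))" for n unfolding V_def
    by (intro fls_ge_mult'[of 0 _ 0] fls_ge_divide suminf_fls_ge fls_ge_diff ge unit_phi fls_ge_X_power
        fls_ge_one fls_ge_phi fls_ge_mono[OF fls_ge_phi]) auto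
  hence *: "fls_ge (int n) (T (Suc n) * V (Suc n))" for n
    by (intro fls_ge_mult'[of "int (Suc n)" _ 0] T) auto
  have "(\<lambda>n. \<Sum>i<n. T (Suc i)) \<longlonglongrightarrow> T 1 * V 1"
  proof (rule tendsto_fls_ge)
    fix n show "fls_ge (int n) ((\<Sum>i<n. T (Suc i)) - T 1 * V 1)"
      unfolding iter[of n] using fls_ge_uminus[OF *[of n]] by simp
  qed
  hence "(\<Sum>n. T (Suc n)) = T 1 * V 1" by (simp add: sums_def[symmetric] sums_iff)
  moreover have "suminf T = T 0 + (\<Sum>n. T (Suc n))" by (rule suminf_split_head_fls[OF T])
  ultimately have "1 + suminf (max_term d e z y) = suminf T" using max by (simp add: T_def[of 0])
  thus ?thesis by (simp add: T_def[abs_def])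
qed

end

subsection \<open>Generating functions of overpartition pairs\<close>

definition add_part :: "pair_part \<Rightarrow> overpart \<times> overpart \<Rightarrow> overpart \<times> overpart" where
  "add_part x P =
     (if in_lambda x then (add_mset (part_size x, overlined x) (fst P), snd P)
      else (fst P, add_mset (part_size x, overlined x) (snd P)))"

definition valid_pair :: "overpart \<times> overpart \<Rightarrow> bool" where
  "valid_pair P \<longleftrightarrow> is_overpartition (fst P) \<and> is_overpartition (snd P)"

definition pair_weight :: "overpart \<times> overpart \<Rightarrow> nat" where
  "pair_weight P = weight (fst P) + weight (snd P)"

definition pairs_in :: "pair_part set \<Rightarrow> nat \<Rightarrow> (overpart \<times> overpart) set" where
  "pairs_in S n = {P. valid_pair P \<and> pair_weight P = n \<and> pair_parts P \<subseteq> S}"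

lemma weight_add_mset [simp]: "weight (add_mset (k, b) p) = k + weight p"
  by (simp add: weight_def)

lemma num_overlined_add_mset [simp]:
  "num_overlined (add_mset (k, b) p) = of_bool b + num_overlined p"
  by (simp add: num_overlined_def)

lemma num_nonoverlined_add_mset [simp]:
  "num_nonoverlined (add_mset (k, b) p) = of_bool (\<not> b) + num_nonoverlined p"
  by (simp add: num_nonoverlined_def)

lemma pair_parts_add_part: "pair_parts (add_part x P) = insert x (pair_parts P)"
  by (cases x; cases P) (auto simp: add_part_def)

lemma pair_weight_add_part: "pair_weight (add_part x P) = part_size x + pair_weight P"
  by (simp add: add_part_def pair_weight_def)

lemma inj_add_part: "inj (add_part x)"
  by (auto simp: inj_def add_part_def prod_eq_iff split: if_splits)

lemma in_pair_parts_iff: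
  "x \<in> pair_parts P \<longleftrightarrow> (part_size x, overlined x) \<in># (if in_lambda x then fst P else snd P)"
  by (cases x; cases P) (force simp: image_iff)

declare pair_parts.simps [simp del]

lemma obtain_add_part:
  assumes "x \<in> pair_parts P"
  obtains Q where "P = add_part x Q"
proof (cases "in_lambda x")
  case True
  with assms have "(part_size x, overlined x) \<in># fst P" by (simp add: in_pair_parts_iff)
  then obtain l where "fst P = add_mset (part_size x, overlined x) l" by (metis multi_member_split)
  thus ?thesis using True that[of "(l, snd P)"] by (simp add: add_part_def prod_eq_iff)
next
  case False
  with assms have "(part_size x, overlined x) \<in># snd P" by (simp add: in_pair_parts_iff)
  then obtain m where "snd P = add_mset (part_size x, overlined x) m" by (metis multi_member_split)
  thus ?thesis using False that[of "(fst P, m)"] by (simp add: add_part_def prod_eq_iff)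
qed

lemma is_overpartition_add_mset:
  "is_overpartition (add_mset (k, b) p) \<longleftrightarrow> is_overpartition p \<and> k > 0 \<and> (b \<longrightarrow> (k, b) \<notin># p)"
proof -
  have "(\<forall>j. count (add_mset (k, True) p) (j, True) \<le> 1) \<longleftrightarrow>
        (\<forall>j. count p (j, True) \<le> 1) \<and> (k, True) \<notin># p"
  proof (intro iffI conjI allI)
    assume *: "\<forall>j. count (add_mset (k, True) p) (j, True) \<le> 1"
    show "(k, True) \<notin># p" using *[rule_format, of k] by (simp add: not_in_iff)
    show "count p (j, True) \<le> 1" for j using *[rule_format, of j] by (simp split: if_splits)
  next
    fix j
    assume *: "(\<forall>j. count p (j, True) \<le> 1) \<and> (k, True) \<notin># p"
    thus "count (add_mset (k, True) p) (j, True) \<le> 1" by (auto simp: not_in_iff)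
  qed
  thus ?thesis by (cases b) (auto simp: is_overpartition_def)
qed

lemma valid_pair_add_part:
  "valid_pair (add_part x P) \<longleftrightarrow>
     valid_pair P \<and> part_size x > 0 \<and> (overlined x \<longrightarrow> x \<notin> pair_parts P)"
  by (auto simp: valid_pair_def add_part_def is_overpartition_add_mset in_pair_parts_iff)

text \<open>An overlined part occurs at most once, so removing it leaves a pair over
  \<open>S\<close>. This recurrence yields a factor \<open>1 + w q^k\<close>.\<close>

lemma pairs_in_insert_overlined:
  assumes "x \<notin> S" "overlined x" "part_size x > 0"
  shows "pairs_in (insert x S) n = pairs_in S n \<union>
           (if part_size x \<le> n then add_part x ` pairs_in S (n - part_size x) else {})"
proof (intro equalityI subsetI)
  fix P assume P: "P \<in> pairs_in (insert x S) n"
  show "P \<in> pairs_in S n \<union> (if part_size x \<le> n then add_part x ` pairs_in S (n - part_size x) else {})"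
  proof (cases "x \<in> pair_parts P")
    case True
    then obtain Q where "P = add_part x Q" by (rule obtain_add_part)
    thus ?thesis using P assms
      by (auto simp: pairs_in_def valid_pair_add_part pair_weight_add_part pair_parts_add_part)
  qed (use P in \<open>auto simp: pairs_in_def\<close>)
next
  fix P
  assume "P \<in> pairs_in S n \<union> (if part_size x \<le> n then add_part x ` pairs_in S (n - part_size x) else {})"
  then consider "P \<in> pairs_in S n"
    | Q where "part_size x \<le> n" "Q \<in> pairs_in S (n - part_size x)" "P = add_part x Q"
    by (auto split: if_splits)
  thus "P \<in> pairs_in (insert x S) n"
    by cases (use assms in \<open>auto simp: pairs_in_def valid_pair_add_part pair_weight_add_part
        pair_parts_add_part\<close>)
qed

text \<open>Removing one copy may leave others, so \<open>insert x S\<close> reappears on the right.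
  This recurrence yields a factor \<open>1 / (1 - w q^k)\<close>.\<close>

lemma pairs_in_insert_nonoverlined:
  assumes "\<not> overlined x" "part_size x > 0"
  shows "pairs_in (insert x S) n = pairs_in S n \<union>
           (if part_size x \<le> n then add_part x ` pairs_in (insert x S) (n - part_size x) else {})"
proof (intro equalityI subsetI)
  fix P assume P: "P \<in> pairs_in (insert x S) n"
  show "P \<in> pairs_in S n \<union> (if part_size x \<le> n then add_part x ` pairs_in (insert x S) (n - part_size x) else {})"
  proof (cases "x \<in> pair_parts P")
    case True
    then obtain Q where "P = add_part x Q" by (rule obtain_add_part)
    thus ?thesis using P assms
      by (auto simp: pairs_in_def valid_pair_add_part pair_weight_add_part pair_parts_add_part)
  qed (use P in \<open>auto simp: pairs_in_def\<close>)
next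
  fix P
  assume "P \<in> pairs_in S n \<union> (if part_size x \<le> n then add_part x ` pairs_in (insert x S) (n - part_size x) else {})"
  then consider "P \<in> pairs_in S n"
    | Q where "part_size x \<le> n" "Q \<in> pairs_in (insert x S) (n - part_size x)" "P = add_part x Q"
    by (auto split: if_splits)
  thus "P \<in> pairs_in (insert x S) n"
    by cases (use assms in \<open>auto simp: pairs_in_def valid_pair_add_part pair_weight_add_part
        pair_parts_add_part\<close>)
qed

lemma pairs_in_empty: "pairs_in {} n = (if n = 0 then {({#}, {#})} else {})"
  by (auto simp: pairs_in_def valid_pair_def pair_weight_def weight_def is_overpartition_def
      pair_parts.simps)

lemma finite_pairs_in:
  assumes "finite S" "\<And>x. x \<in> S \<Longrightarrow> part_size x > 0"
  shows "finite (pairs_in S n)"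
  using assms
proof (induction S arbitrary: n rule: finite_induct)
  case (insert x S)
  have S: "finite (pairs_in S n)" for n using insert by auto
  show ?case
  proof (cases "overlined x")
    case False
    \<comment> \<open>For a non-overlined part the recurrence returns to the same set at smaller
      weight, hence a second induction.\<close>
    show ?thesis
    proof (induction n rule: less_induct)
      case (less n)
      thus ?case using S insert.prems[of x] False
        by (subst pairs_in_insert_nonoverlined) auto
    qed
  qed (use S insert in \<open>subst pairs_in_insert_overlined, auto\<close>)
qed (simp add: pairs_in_empty)

definition parts_upto :: "nat \<Rightarrow> pair_part set" where
  "parts_upto N = {x. part_size x \<in> {1..N}}"

lemma parts_upto_0 [simp]: "parts_upto 0 = {}"
  by (simp add: parts_upto_def)

lemma parts_upto_Suc:
  "parts_upto (Suc N) = insert (Part (Suc N) True True) (insert (Part (Suc N) True False)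
     (insert (Part (Suc N) False True) (insert (Part (Suc N) False False) (parts_upto N))))"
proof (intro set_eqI)
  fix x show "x \<in> parts_upto (Suc N) \<longleftrightarrow> x \<in> insert (Part (Suc N) True True) (insert (Part (Suc N) True False)
     (insert (Part (Suc N) False True) (insert (Part (Suc N) False False) (parts_upto N))))"
    by (cases x) (auto simp: parts_upto_def)
qed

lemma finite_parts_upto: "finite (parts_upto N)"
  by (induction N) (simp_all add: parts_upto_Suc)

text \<open>No part exceeds the total weight.\<close>

lemma overpartition_pairs_eq: "overpartition_pairs n = pairs_in (parts_upto n) n"
proof (intro equalityI subsetI)
  fix P assume "P \<in> overpartition_pairs n"
  hence P: "valid_pair P" "pair_weight P = n"
    by (auto simp: overpartition_pairs_def valid_pair_def pair_weight_def)
  have "x \<in> parts_upto n" if "x \<in> pair_parts P" for x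
    using obtain_add_part[OF that] P
    by (metis parts_upto_def mem_Collect_eq atLeastAtMost_iff le_add1 pair_weight_add_part
        valid_pair_add_part less_eq_Suc_le One_nat_def)
  thus "P \<in> pairs_in (parts_upto n) n" using P by (auto simp: pairs_in_def)
qed (auto simp: overpartition_pairs_def valid_pair_def pair_weight_def pairs_in_def)

lemma finite_pairs_upto: "finite (pairs_in (parts_upto N) n)"
  by (intro finite_pairs_in finite_parts_upto) (auto simp: parts_upto_def)

lemma finite_overpartition_pairs: "finite (overpartition_pairs n)"
  by (simp add: overpartition_pairs_eq finite_pairs_upto)

section \<open>Product formulas for pairs with bounded parts\<close>

context
  fixes d e y :: "'a::field"
begin

text \<open>The exponent of \<open>y\<close> is the part of the rank that is additive over the
  parts. The factor from \<open>largest - chi\<close> is not multiplicative and is kept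
  apart.\<close>

definition pair_wt :: "overpart \<times> overpart \<Rightarrow> 'a" where
  "pair_wt P = d ^ (num_overlined (fst P) + num_nonoverlined (snd P)) * e ^ size (snd P) *
     y ^ (size (fst P) + num_overlined (snd P))"

definition part_wt :: "pair_part \<Rightarrow> 'a" where
  "part_wt x = (if in_lambda x then if overlined x then d * y else y
                else if overlined x then e * y else d * e)"

lemma pair_wt_add_part: "pair_wt (add_part x P) = part_wt x * pair_wt P"
  by (auto simp: pair_wt_def part_wt_def add_part_def)

definition pair_gf :: "pair_part set \<Rightarrow> 'a fls" where
  "pair_gf S = fps_to_fls (Abs_fps (\<lambda>n. \<Sum>P\<in>pairs_in S n. pair_wt P))"

lemma sum_add_part: "(\<Sum>P\<in>add_part x ` A. pair_wt P) = part_wt x * (\<Sum>P\<in>A. pair_wt P)"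
  by (subst sum.reindex)
     (auto simp: pair_wt_add_part sum_distrib_left intro: inj_on_subset[OF inj_add_part])

lemma fps_gf_eqI:
  fixes f g h :: "nat \<Rightarrow> 'a"
  assumes "\<And>n. f n = g n + (if k \<le> n then w * h (n - k) else 0)"
  shows "fps_to_fls (Abs_fps f) = fps_to_fls (Abs_fps g) + fls_const w * qq ^ k * fps_to_fls (Abs_fps h)"
proof -
  have "Abs_fps f = Abs_fps g + fps_const w * (fps_X ^ k * Abs_fps h)"
    using assms by (auto simp: fps_eq_iff fps_X_power_mult_nth)
  thus ?thesis by (simp add: fls_times_fps_to_fls fps_to_fls_power mult.assoc)
qed

lemma pair_gf_insert_overlined:
  assumes "finite S" "\<And>y. y \<in> S \<Longrightarrow> part_size y > 0" "x \<notin> S" "overlined x" "part_size x > 0"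
  shows "pair_gf (insert x S) = (1 + fls_const (part_wt x) * qq ^ part_size x) * pair_gf S"
proof -
  have "pair_gf (insert x S) = pair_gf S + fls_const (part_wt x) * qq ^ part_size x * pair_gf S"
    unfolding pair_gf_def
  proof (rule fps_gf_eqI)
    fix n
    have "pairs_in S n \<inter> add_part x ` pairs_in S (n - part_size x) = {}"
      using assms(3) by (auto simp: pairs_in_def pair_parts_add_part)
    thus "(\<Sum>P\<in>pairs_in (insert x S) n. pair_wt P) = (\<Sum>P\<in>pairs_in S n. pair_wt P) +
       (if part_size x \<le> n then part_wt x * (\<Sum>P\<in>pairs_in S (n - part_size x). pair_wt P) else 0)"
      using assms finite_pairs_in[of S]
      by (subst pairs_in_insert_overlined) (auto simp: sum.union_disjoint sum_add_part)
  qed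
  thus ?thesis by (simp add: algebra_simps)
qed

lemma pair_gf_insert_nonoverlined:
  assumes "finite S" "\<And>y. y \<in> S \<Longrightarrow> part_size y > 0" "x \<notin> S" "\<not> overlined x" "part_size x > 0"
  shows "(1 - fls_const (part_wt x) * qq ^ part_size x) * pair_gf (insert x S) = pair_gf S"
proof -
  have "pair_gf (insert x S) = pair_gf S + fls_const (part_wt x) * qq ^ part_size x * pair_gf (insert x S)"
    unfolding pair_gf_def
  proof (rule fps_gf_eqI)
    fix n
    have fin: "finite (pairs_in S m)" "finite (pairs_in (insert x S) m)" for m
      using assms by (auto intro!: finite_pairs_in)
    have "pairs_in S n \<inter> add_part x ` pairs_in (insert x S) (n - part_size x) = {}"
      using assms(3) by (auto simp: pairs_in_def pair_parts_add_part)
    thus "(\<Sum>P\<in>pairs_in (insert x S) n. pair_wt P) = (\<Sum>P\<in>pairs_in S n. pair_wt P) +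
       (if part_size x \<le> n then part_wt x * (\<Sum>P\<in>pairs_in (insert x S) (n - part_size x). pair_wt P) else 0)"
      using assms fin
      by (subst pairs_in_insert_nonoverlined) (auto simp: sum.union_disjoint sum_add_part)
  qed
  thus ?thesis by (simp add: algebra_simps)
qed

text \<open>The non-overlined part in \<mu> is the smallest of the four kinds of size
  \<open>Suc N\<close>, and the one for which \<open>chi\<close> is 1 if it is the maximum. This
  intermediate stage isolates it.\<close>

definition parts_mu :: "nat \<Rightarrow> pair_part set" where
  "parts_mu N = insert (Part (Suc N) False False) (parts_upto N)"

lemma pair_gf_mu:
  "pair_gf (parts_mu N) = pair_gf (parts_upto N) / (1 - fls_const (d * e) * qq ^ Suc N)"
proof -
  have "(1 - fls_const (d * e) * qq ^ Suc N) * pair_gf (parts_mu N) = pair_gf (parts_upto N)"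
    using pair_gf_insert_nonoverlined[of "parts_upto N" "Part (Suc N) False False"] finite_parts_upto
    by (simp add: part_wt_def parts_mu_def) (simp add: parts_upto_def)
  moreover have "1 - fls_const (d * e) * qq ^ Suc N \<noteq> 0"
    by (intro fls_one_unit_nz fls_one_unit_minus fls_ge_mult'[of 0 _ 1] fls_ge_X_power) auto
  ultimately show ?thesis by (simp add: field_simps)
qed

lemma pair_gf_upto_Suc:
  "pair_gf (parts_upto (Suc N)) = pair_gf (parts_mu N) * (1 + fls_const (d * y) * qq ^ Suc N)
     * (1 + fls_const (e * y) * qq ^ Suc N) / (1 - fls_const y * qq ^ Suc N)"
proof -
  define B where "B = parts_mu N"
  define B1 where "B1 = insert (Part (Suc N) False True) B"
  define B2 where "B2 = insert (Part (Suc N) True False) B1"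
  note defs = B_def B1_def B2_def parts_mu_def parts_upto_def
  have fin: "finite B" "finite B1" "finite B2"
    by (simp_all add: B_def B1_def B2_def parts_mu_def finite_parts_upto)
  have pos: "part_size x > 0" if "x \<in> B2" for x using that by (auto simp: defs)
  have 1: "pair_gf B1 = (1 + fls_const (e * y) * qq ^ Suc N) * pair_gf B"
    using pair_gf_insert_overlined[of B "Part (Suc N) False True"] fin(1) pos
    by (simp add: part_wt_def B1_def B2_def) (simp add: defs)
  have 2: "(1 - fls_const y * qq ^ Suc N) * pair_gf B2 = pair_gf B1"
    using pair_gf_insert_nonoverlined[of B1 "Part (Suc N) True False"] fin(2) pos
    by (simp add: part_wt_def B2_def) (simp add: defs)
  have 3: "pair_gf (parts_upto (Suc N)) = (1 + fls_const (d * y) * qq ^ Suc N) * pair_gf B2"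
    using pair_gf_insert_overlined[of B2 "Part (Suc N) True True"] fin(3) pos
    by (simp add: part_wt_def parts_upto_Suc B2_def) (simp add: defs)
  have "1 - fls_const y * qq ^ Suc N \<noteq> 0"
    by (intro fls_one_unit_nz fls_one_unit_minus fls_ge_mult'[of 0 _ 1] fls_ge_X_power) auto
  hence "pair_gf B2 = pair_gf B1 / (1 - fls_const y * qq ^ Suc N)"
    using 2 by (simp add: field_simps)
  thus ?thesis unfolding 3 1 B_def by (simp add: mult_ac)
qed

lemma pair_gf_upto:
  "pair_gf (parts_upto N) =
     fpoch (- fls_const d * fls_const y * qq) N * fpoch (- fls_const e * fls_const y * qq) N
       / (fpoch (fls_const y * qq) N * fpoch (fls_const d * fls_const e * qq) N)"
proof (induction N)
  case 0
  have "(\<lambda>n. \<Sum>P\<in>pairs_in {} n. pair_wt P) = (\<lambda>n. if n = 0 then 1 else 0)"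
    by (auto simp: pairs_in_empty pair_wt_def num_overlined_def num_nonoverlined_def)
  moreover have "Abs_fps (\<lambda>n. if n = 0 then 1 else (0::'a)) = 1" by (simp add: fps_eq_iff)
  ultimately show ?case by (simp add: pair_gf_def)
next
  case (Suc N)
  show ?case unfolding pair_gf_upto_Suc pair_gf_mu Suc fpoch_Suc
    by (simp add: mult_ac flip: fls_const_mult_const)
qed

end

subsection \<open>The rank generating function by largest part\<close>

lemma pair_gf_nth: "pair_gf d e y S $$ int n = (\<Sum>P\<in>pairs_in S n. pair_wt d e y P)"
  by (simp add: pair_gf_def)

lemma pairs_in_mono: "S \<subseteq> S' \<Longrightarrow> pairs_in S n \<subseteq> pairs_in S' n"
  by (auto simp: pairs_in_def)

lemma finite_pair_parts: "finite (pair_parts P)"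
  by (cases P) (simp add: pair_parts.simps)

text \<open>Some part lies outside \<open>parts_mu N\<close>, hence above all of it; the maximum
  therefore has size \<open>Suc N\<close> and is of a kind with \<open>chi = 0\<close>.\<close>

lemma largest_chi_upto:
  assumes "P \<in> pairs_in (parts_upto (Suc N)) n - pairs_in (parts_mu N) n"
  shows "largest P - chi P = Suc N"
proof -
  have P: "pair_parts P \<subseteq> parts_upto (Suc N)" "\<not> pair_parts P \<subseteq> parts_mu N"
    using assms by (auto simp: pairs_in_def)
  then obtain x where x: "x \<in> pair_parts P" "x \<notin> parts_mu N" by auto
  define m where "m = Max (pair_parts P)"
  have ne: "pair_parts P \<noteq> {}" using x by auto
  have m: "m \<in> pair_parts P" "x \<le> m"
    unfolding m_def using x ne finite_pair_parts by (auto intro: Max_in)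
  have "x \<in> parts_upto (Suc N)" "m \<in> parts_upto (Suc N)" using m x P by auto
  hence "part_size m = Suc N \<and> (in_lambda m \<or> overlined m)"
    using m(2) x(2) unfolding parts_upto_Suc parts_mu_def
    by (auto simp: less_eq_pair_part_def less_pair_part_def parts_upto_def)
  thus ?thesis using ne by (auto simp: largest_def chi_def m_def)
qed

text \<open>The maximum is the non-overlined \<open>Suc N\<close> in \<mu>, and
  \<open>chi = 1\<close> lowers the value to \<open>N\<close>.\<close>

lemma largest_chi_mu:
  assumes "P \<in> pairs_in (parts_mu N) n - pairs_in (parts_upto N) n"
  shows "largest P - chi P = N"
proof -
  have P: "pair_parts P \<subseteq> parts_mu N" "\<not> pair_parts P \<subseteq> parts_upto N"
    using assms by (auto simp: pairs_in_def)
  then obtain x where x: "x \<in> pair_parts P" "x = Part (Suc N) False False"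
    by (auto simp: parts_mu_def)
  define m where "m = Max (pair_parts P)"
  have ne: "pair_parts P \<noteq> {}" using x by auto
  have m: "m \<in> pair_parts P" "x \<le> m"
    unfolding m_def using x ne finite_pair_parts by (auto intro: Max_in)
  have "m \<in> parts_mu N" using m P by auto
  hence "m = x"
    using m(2) x(2) unfolding parts_mu_def
    by (auto simp: less_eq_pair_part_def less_pair_part_def parts_upto_def)
  thus ?thesis using ne x(2) by (auto simp: largest_def chi_def m_def[symmetric])
qed

lemma chi_le_largest:
  assumes "P \<in> overpartition_pairs n"
  shows "chi P \<le> largest P"
proof (cases "pair_parts P = {}")
  case False
  hence "Max (pair_parts P) \<in> pair_parts P" using finite_pair_parts by (intro Max_in)
  hence "Max (pair_parts P) \<in> parts_upto n"
    using assms by (auto simp: overpartition_pairs_eq pairs_in_def)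
  thus ?thesis using False by (auto simp: chi_def largest_def parts_upto_def)
qed (simp add: chi_def largest_def)

text \<open>Each difference of consecutive generating functions selects the pairs whose maximum is
  new at that stage. The powers of \<open>z\<close> are the values of \<open>largest - chi\<close>
  there.\<close>

lemma max_term_eq_pair_gf:
  fixes d e z y :: "'a::field"
  assumes zy: "z * y = 1"
  shows "max_term (fls_const d) (fls_const e) (fls_const z) (fls_const y) N =
     fls_const (z ^ N) * (pair_gf d e y (parts_mu N) - pair_gf d e y (parts_upto N)) +
     fls_const (z ^ Suc N) * (pair_gf d e y (parts_upto (Suc N)) - pair_gf d e y (parts_mu N))"
proof -
  define D E Z Y A x where "D = fls_const d" and "E = fls_const e" and "Z = fls_const z"
    and "Y = fls_const y" and "A = pair_gf d e y (parts_upto N)" and "x = (qq ^ Suc N :: 'a fls)"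
  define E1 E2 where "E1 = 1 - D * E * x" and "E2 = 1 - Y * x"
  have nz: "E1 \<noteq> 0" "E2 \<noteq> 0" unfolding E1_def E2_def D_def E_def Y_def x_def
    by (intro fls_one_unit_nz fls_one_unit_minus fls_ge_mult'[of 0 _ 1] fls_ge_mult'[of 0 _ 0] fls_ge_X_power; simp)+
  have ZY: "Z * Y = 1" using zy by (simp add: Z_def Y_def)
  have B: "pair_gf d e y (parts_mu N) = A / E1"
    unfolding pair_gf_mu A_def E1_def D_def E_def x_def by simp
  have U: "pair_gf d e y (parts_upto (Suc N)) = A / E1 * (1 + D * Y * x) * (1 + E * Y * x) / E2"
    unfolding pair_gf_upto_Suc B E2_def D_def E_def Y_def x_def by simp
  have Zp: "fls_const (z ^ N) = Z ^ N" "fls_const (z ^ Suc N) = Z ^ N * Z"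
    by (simp_all add: Z_def fls_const_power flip: fls_const_mult_const)
  have "max_term D E Z Y N = (1 + D) * (1 + E) * x * Z ^ N * A / (E1 * E2)"
    unfolding max_term_def A_def pair_gf_upto fpoch_Suc
    by (simp add: D_def E_def Y_def E1_def E2_def x_def mult_ac)
  also have "\<dots> = Z ^ N * A * ((1 + D) * (1 + E) * x) / (E1 * E2)" by simp
  \<comment> \<open>Because \<open>Z Y = 1\<close>, the contributions of the two stages collapse to
    a single product.\<close>
  also have "(1 + D) * (1 + E) * x
      = (E2 - E1 * E2) + Z * ((1 + D * Y * x) * (1 + E * Y * x) - E2)"
    unfolding E1_def E2_def using ZY by algebra
  also have "Z ^ N * A * \<dots> / (E1 * E2) = Z ^ N * (A / E1 - A)
     + Z ^ N * Z * (A / E1 * (1 + D * Y * x) * (1 + E * Y * x) / E2 - A / E1)"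
    using nz by (simp add: divide_simps) (simp add: algebra_simps)
  finally show ?thesis unfolding B U Zp A_def[symmetric]
    by (simp add: D_def E_def Z_def Y_def)
qed

lemma rank_sum_upto:
  fixes d e z y :: "'a::field"
  assumes zy: "z * y = 1"
  shows "(\<Sum>P\<in>pairs_in (parts_upto N) n. pair_wt d e y P * z ^ (largest P - chi P)) =
     (if n = 0 then 1 else 0) +
     (\<Sum>M<N. max_term (fls_const d) (fls_const e) (fls_const z) (fls_const y) M $$ int n)"
proof (induction N)
  case 0
  show ?case
    by (simp add: pairs_in_empty pair_wt_def num_overlined_def num_nonoverlined_def largest_def
        pair_parts.simps)
next
  case (Suc N)
  define f where "f P = pair_wt d e y P * z ^ (largest P - chi P)" for P
  define U B U' where "U = pairs_in (parts_upto N) n" and "B = pairs_in (parts_mu N) n"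
    and "U' = pairs_in (parts_upto (Suc N)) n"
  have sub: "U \<subseteq> B" "B \<subseteq> U'" unfolding U_def B_def U'_def
    by (rule pairs_in_mono; auto simp: parts_mu_def parts_upto_Suc)+
  have fin: "finite U'" "finite B" using finite_pairs_upto[of "Suc N" n] sub
    by (auto simp: U'_def intro: finite_subset)
  have "sum f U' = sum f U + sum f (B - U) + sum f (U' - B)"
    using sub fin by (simp add: sum.subset_diff[of B U'] sum.subset_diff[of U B])
  also have "sum f (B - U) = (\<Sum>P\<in>B - U. z ^ N * pair_wt d e y P)"
    unfolding f_def U_def B_def by (intro sum.cong) (auto simp: largest_chi_mu)
  also have "\<dots> = z ^ N * (sum (pair_wt d e y) B - sum (pair_wt d e y) U)"
    using sub fin by (simp add: sum_distrib_left[symmetric] sum_diff)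
  also have "sum f (U' - B) = (\<Sum>P\<in>U' - B. z ^ Suc N * pair_wt d e y P)"
    unfolding f_def U'_def B_def by (intro sum.cong) (auto simp: largest_chi_upto)
  also have "\<dots> = z ^ Suc N * (sum (pair_wt d e y) U' - sum (pair_wt d e y) B)"
    using sub fin by (simp add: sum_distrib_left[symmetric] sum_diff)
  finally show ?case using Suc
    by (simp add: max_term_eq_pair_gf[OF zy] pair_gf_nth U_def B_def U'_def f_def[abs_def])
qed

definition rank_wt :: "'a::field \<Rightarrow> 'a \<Rightarrow> 'a \<Rightarrow> overpart \<times> overpart \<Rightarrow> 'a" where
  "rank_wt d e z P = d ^ (num_overlined (fst P) + num_nonoverlined (snd P)) * e ^ size (snd P) *
     z powi rank_pair P"

lemma rank_sum:
  fixes d e z y :: "'a::field"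
  assumes zy: "z * y = 1"
  shows "(\<Sum>P\<in>overpartition_pairs n. rank_wt d e z P) =
     (1 + suminf (max_term (fls_const d) (fls_const e) (fls_const z) (fls_const y))) $$ int n"
proof -
  define m where "m = max_term (fls_const d) (fls_const e) (fls_const z) (fls_const y)"
  have z: "z \<noteq> 0" "y = inverse z" using zy inverse_unique[OF zy] by auto
  have m: "fls_ge (int (Suc k)) (m k)" for k
  proof -
    have u: "fls_ge 1 (fls_const a * qq)" "fls_ge 1 (- fls_const a * fls_const b * qq)"
      "fls_ge 1 (fls_const a * fls_const b * qq)" for a b :: 'a
      by (intro fls_ge_times_X fls_ge_mult'[of 0 _ 0] fls_ge_uminus fls_ge_const; simp)+
    have "fls_ge (int (Suc k)) ((1 + fls_const d) * (1 + fls_const e) * qq ^ Suc k * fls_const z ^ k *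
     fpoch (- fls_const d * fls_const y * qq) k * fpoch (- fls_const e * fls_const y * qq) k)"
    proof -
      have 1: "fls_ge 0 ((1 + fls_const d) * (1 + fls_const e))"
        by (intro fls_ge_mult'[of 0 _ 0] fls_ge_add) auto
      have 2: "fls_ge 0 (fls_const z ^ k)" using fls_ge_power[of 0 "fls_const z" k] by simp
      have 3: "fls_ge 0 (fpoch (- fls_const a * fls_const y * qq) k)" for a
        by (intro fls_ge_fpoch fls_ge_mono[OF u(2)]) simp
      have 4: "fls_ge (int (Suc k)) ((1 + fls_const d) * (1 + fls_const e) * qq ^ Suc k)"
        by (rule fls_ge_mult'[OF 1 fls_ge_X_power[OF order_refl]]) simp
      show ?thesis
        by (rule fls_ge_mult'[OF fls_ge_mult'[OF fls_ge_mult'[OF 4 2 order_refl] 3 order_refl] 3]) simp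
    qed
    thus ?thesis unfolding m_def max_term_def
      by (intro fls_ge_divide fls_one_unit_mult fls_one_unit_fpoch u)
  qed
  have pw: "z powi (int a - int b) = z ^ a * inverse z ^ b" for a b
    using z(1) by (simp add: power_int_diff power_inverse divide_inverse)
  have "rank_wt d e z P = pair_wt d e y P * z ^ (largest P - chi P)" if "P \<in> overpartition_pairs n" for P
  proof -
    obtain l mu where P: "P = (l, mu)" by (cases P)
    have "rank_pair P = int (largest P - chi P) - int (size l + num_overlined mu)"
      using chi_le_largest[OF that] by (simp add: P)
    hence "z powi rank_pair P = z ^ (largest P - chi P) * y ^ (size l + num_overlined mu)"
      unfolding z(2) by (simp only: pw)
    thus ?thesis by (simp add: rank_wt_def pair_wt_def P)
  qed
  hence "(\<Sum>P\<in>overpartition_pairs n. rank_wt d e z P) =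
      (\<Sum>P\<in>pairs_in (parts_upto n) n. pair_wt d e y P * z ^ (largest P - chi P))"
    unfolding overpartition_pairs_eq[symmetric] by (intro sum.cong refl)
  also have "\<dots> = (if n = 0 then 1 else 0) + (\<Sum>k<n. m k $$ int n)"
    unfolding rank_sum_upto[OF zy] m_def ..
  \<comment> \<open>The added term \<open>k = n\<close> has order at least \<open>n + 1\<close> and
    contributes nothing; the new range is that of \<open>sums_fls\<close>.\<close>
  also have "(\<Sum>k<n. m k $$ int n) = (\<Sum>k\<le>n. m k $$ int n)"
    by (simp add: lessThan_Suc_atMost[symmetric] fls_geD[OF m])
  also have "\<dots> = suminf m $$ int n"
    by (subst sums_fls(2)) (auto intro: fls_ge_mono[OF m])
  finally show ?thesis by (simp add: m_def)
qed

subsection \<open>Extracting the coefficients of the rank generating function\<close>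

text \<open>Multiplication by \<open>z^K\<close> clears the negative exponents, and a nonzero
  polynomial has finitely many roots.\<close>

lemma laurent_coeffs_zero:
  fixes a :: "int \<Rightarrow> 'a::field"
  assumes M: "finite M" and Z: "infinite Z" "0 \<notin> Z"
    and eq: "\<And>z. z \<in> Z \<Longrightarrow> (\<Sum>m\<in>M. a m * z powi m) = 0" and m: "m \<in> M"
  shows "a m = 0"
proof -
  obtain K where K: "\<And>m. m \<in> M \<Longrightarrow> - int K \<le> m"
  proof -
    have "- int (nat (- Min M)) \<le> k" if "k \<in> M" for k using Min_le[OF M that] by simp
    thus ?thesis using that by blast
  qed
  define p where "p = (\<Sum>m\<in>M. monom (a m) (nat (m + int K)))"
  have "poly p z = 0" if "z \<in> Z" for z
  proof -
    have z: "z \<noteq> 0" using that Z by auto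
    have "poly p z = (\<Sum>m\<in>M. a m * z ^ nat (m + int K))" by (simp add: p_def poly_sum poly_monom)
    also have "\<dots> = (\<Sum>m\<in>M. z ^ K * (a m * z powi m))"
    proof (intro sum.cong refl)
      fix m assume "m \<in> M"
      hence "z ^ nat (m + int K) = z powi (m + int K)"
        using K[OF \<open>m \<in> M\<close>] by (simp add: power_int_def)
      also have "\<dots> = z powi m * z ^ K" using z by (simp add: power_int_add)
      finally show "a m * z ^ nat (m + int K) = z ^ K * (a m * z powi m)" by simp
    qed
    also have "\<dots> = 0" using eq[OF that] by (simp flip: sum_distrib_left)
    finally show ?thesis .
  qed
  hence "Z \<subseteq> {z. poly p z = 0}" by auto
  hence p: "p = 0" using Z(1) poly_roots_finite infinite_super by blast
  have "nat (k + int K) = nat (m + int K) \<longleftrightarrow> k = m" if "k \<in> M" for k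
    using K[OF that] K[OF m] by auto
  hence "coeff p (nat (m + int K)) = (\<Sum>k\<in>M. if k = m then a k else 0)"
    by (auto simp: p_def coeff_sum coeff_monom intro!: sum.cong)
  thus ?thesis using M m p by simp
qed

lemma sum_symmetric_interval:
  fixes f :: "int \<Rightarrow> 'a::comm_monoid_add"
  shows "(\<Sum>m=- int N..int N. f m) = f 0 + (\<Sum>j<N. f (int j + 1) + f (- int j - 1))"
proof (induction N)
  case (Suc N)
  have "{- int (Suc N)..int (Suc N)} = insert (int N + 1) (insert (- int N - 1) {- int N..int N})" by auto
  thus ?case using Suc by (simp add: add_ac)
qed simp

lemma geometric_sums_fls:
  fixes a :: "'a::field fls"
  assumes a: "fls_ge 1 a"
  shows "(\<lambda>j. a ^ j) sums (1 / (1 - a))"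
proof -
  have ge: "fls_ge (int j) (a ^ j)" for j using fls_ge_power[OF a, of j] by simp
  have "(\<lambda>j. a ^ j - a ^ Suc j) sums (a ^ 0)" by (rule telescope_sums_fls[OF ge])
  hence "(\<lambda>j. (1 / (1 - a)) * (a ^ j - a ^ Suc j)) sums ((1 / (1 - a)) * a ^ 0)"
    by (rule sums_mult_fls)
  moreover have "(1 / (1 - a)) * (a ^ j - a ^ Suc j) = a ^ j" for j
    using fls_one_unit_nz[OF fls_one_unit_minus[OF a]] by (simp add: field_simps)
  ultimately show ?thesis by simp
qed

lemma suminf_swap_fls':
  fixes h :: "nat \<Rightarrow> nat \<Rightarrow> 'a::field fls" and b :: "nat \<Rightarrow> 'a fls"
  assumes "\<And>m n. fls_ge (int m) (h m n)" "\<And>m n. fls_ge (int n) (h m n)" "\<And>n. fls_ge 0 (b n)"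
  shows "(\<Sum>m. \<Sum>n. b n * h m n) = (\<Sum>n. b n * (\<Sum>m. h m n))"
proof -
  have "(\<Sum>m. \<Sum>n. b n * h m n) = (\<Sum>n. \<Sum>m. b n * h m n)"
    by (intro suminf_swap_fls fls_ge_mult'[OF assms(3) assms(1)] fls_ge_mult'[OF assms(3) assms(2)]) auto
  also have "(\<lambda>n. \<Sum>m. b n * h m n) = (\<lambda>n. b n * (\<Sum>m. h m n))"
    by (intro ext suminf_mult_fls assms(1))
  finally show ?thesis .
qed

context
  fixes d e :: "'a::field"
  assumes de: "d \<noteq> 0" "e \<noteq> 0"
begin

text \<open>For \<open>r > 0\<close>, the factor of \<open>bailey_alpha\<close> times
  \<open>kappa\<close> that does not depend on \<open>z\<close> and \<open>y\<close>, with
  \<open>1 + q^r\<close> left out.\<close>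

definition theta_coeff :: "nat \<Rightarrow> 'a fls" where
  "theta_coeff r = (- 1) ^ r * qq ^ (\<Sum>{..r}) * kappa (fls_const d) (fls_const e) r"

definition tail_term :: "nat \<Rightarrow> nat \<Rightarrow> 'a fls" where
  "tail_term r j = theta_coeff (Suc r) * (1 - qq ^ Suc r) * (qq ^ Suc r) ^ j"

text \<open>Minus the coefficient of \<open>z^m\<close> in the rank generating function for
  \<open>m = j + 1\<close> and for \<open>m = - j - 1\<close>; the shift lets \<open>j\<close> start
  at 0.\<close>

definition tail_gf :: "nat \<Rightarrow> 'a fls" where
  "tail_gf j = pair_product (fls_const d) (fls_const e) * (\<Sum>r. tail_term r j)"

definition central_gf :: "'a fls" where
  "central_gf = pair_product (fls_const d) (fls_const e) * (1 + 2 * (\<Sum>r. theta_coeff (Suc r)))"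

lemma fls_ge_theta: "fls_ge (int r) (theta_coeff r)"
  unfolding theta_coeff_def
  by (intro fls_ge_mult'[of 0 _ "int r"] fls_ge_mult'[of 0 _ 0] fls_ge_X_power fls_ge_kappa)
     (auto intro: sum_nonneg)

lemma fls_ge_tail_term: "fls_ge (int r) (tail_term r j)" "fls_ge (int j) (tail_term r j)"
proof -
  have *: "fls_ge (int (Suc r + Suc r * j)) (tail_term r j)"
    unfolding tail_term_def power_mult[symmetric]
    by (intro fls_ge_mult'[of "int (Suc r)" _ "int (Suc r * j)"] fls_ge_mult'[of "int (Suc r)" _ 0]
        fls_ge_theta fls_ge_diff fls_ge_one fls_ge_X_power) auto
  show "fls_ge (int r) (tail_term r j)" by (rule fls_ge_mono[OF *]) simp
  show "fls_ge (int j) (tail_term r j)" by (rule fls_ge_mono[OF *]) simp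
qed

lemma fls_ge_pair_product: "fls_ge 0 (pair_product (fls_const d) (fls_const e))"
  unfolding pair_product_def
  by (intro fls_one_unit_ge fls_one_unit_divide fls_one_unit_mult fpoch_has_prod fls_ge_times_X
      fls_ge_uminus fls_ge_mult'[of 0 _ 0] fls_ge_const fls_ge_X) auto

lemma fls_ge_tail_gf: "fls_ge (int j) (tail_gf j)"
  unfolding tail_gf_def
  by (intro fls_ge_mult'[of 0 _ "int j"] fls_ge_pair_product suminf_fls_ge) (auto intro: fls_ge_tail_term)

text \<open>Partial fractions with \<open>x = q^r\<close> and \<open>z y = 1\<close> give \<open>(1
  - z) (1 - y) (1 + x) / ((1 - z x) (1 - y x)) = 2 - (1 - x) z / (1 - z x) - (1 - x) y / (1 - y
  x)\<close>. The 2 feeds \<open>central_gf\<close>, and the geometric series of the two fractions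
  feed \<open>tail_gf\<close>.\<close>

lemma bailey_sum_expansion:
  assumes z: "z * y = 1"
  shows "pair_product (fls_const d) (fls_const e) *
      (\<Sum>r. bailey_alpha (fls_const z) (fls_const y) r * kappa (fls_const d) (fls_const e) r)
    = central_gf - (\<Sum>j. fls_const (z ^ Suc j + y ^ Suc j) * tail_gf j)"
proof -
  define A where "A r = bailey_alpha (fls_const z) (fls_const y) r * kappa (fls_const d) (fls_const e) r" for r
  define b where "b j = fls_const (z ^ Suc j + y ^ Suc j)" for j
  define P where "P = pair_product (fls_const d) (fls_const e)"
  have A: "fls_ge (int r) (A r)" for r unfolding A_def
    by (rule fls_ge_mult'[OF fls_ge_bailey_alpha fls_ge_kappa]) auto
  have ASuc: "A (Suc r) = 2 * theta_coeff (Suc r) - (\<Sum>j. b j * tail_term r j)" for r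
  proof -
    define x where "x = (qq ^ Suc r :: 'a fls)"
    define Z Y T where "Z = fls_const z" and "Y = fls_const y" and "T = theta_coeff (Suc r)"
    have zx: "fls_ge 1 (Z * x)" "fls_ge 1 (Y * x)"
      unfolding Z_def Y_def x_def by (intro fls_ge_mult'[of 0 _ 1] fls_ge_const fls_ge_X_power; simp)+
    define E1 E2 where "E1 = 1 - Z * x" and "E2 = 1 - Y * x"
    have nz: "E1 \<noteq> 0" "E2 \<noteq> 0"
      unfolding E1_def E2_def using zx by (auto intro!: fls_one_unit_nz fls_one_unit_minus simp del: right_minus_eq)
    have "(\<lambda>j. T * (1 - x) * Z * (Z * x) ^ j - - (T * (1 - x) * Y) * (Y * x) ^ j) sums
        (T * (1 - x) * Z * (1 / E1) - - (T * (1 - x) * Y) * (1 / E2))"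
      unfolding E1_def E2_def by (intro sums_diff_fls sums_mult_fls geometric_sums_fls zx)
    also have "(\<lambda>j. T * (1 - x) * Z * (Z * x) ^ j - - (T * (1 - x) * Y) * (Y * x) ^ j)
       = (\<lambda>j. b j * tail_term r j)"
    proof
      fix j
      have "b j = Z ^ Suc j + Y ^ Suc j"
        by (simp add: b_def Z_def Y_def fls_const_power fls_plus_const[symmetric]
            flip: fls_const_mult_const)
      thus "T * (1 - x) * Z * (Z * x) ^ j - - (T * (1 - x) * Y) * (Y * x) ^ j = b j * tail_term r j"
        unfolding tail_term_def T_def[symmetric] x_def[symmetric]
        by (simp add: power_mult_distrib distrib_left distrib_right mult_ac)
    qed
    finally have 1: "(\<Sum>j. b j * tail_term r j) = T * ((1 - x) * Z / E1 + (1 - x) * Y / E2)"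
      by (simp add: sums_iff distrib_left mult.assoc)
    have 2: "A (Suc r) = T * ((1 - Z) * (1 - Y) * (1 + x) / (E1 * E2))"
      unfolding A_def bailey_alpha_def T_def theta_coeff_def
      by (simp add: Z_def Y_def x_def E1_def E2_def mult_ac)
    have 3: "(1 - Z) * (1 - Y) * (1 + x) / (E1 * E2) = 2 - ((1 - x) * Z / E1 + (1 - x) * Y / E2)"
    proof -
      have "Z * Y = 1" using z by (simp add: Z_def Y_def)
      hence "(1 - Z) * (1 - Y) * (1 + x) = 2 * (E1 * E2) - ((1 - x) * Z * E2 + (1 - x) * Y * E1)"
        unfolding E1_def E2_def by algebra
      thus ?thesis using nz by (simp add: divide_simps)
    qed
    show ?thesis unfolding 1 2 3 T_def[symmetric] by (simp only: right_diff_distrib mult.commute[of T 2])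
  qed
  have thS: "fls_ge (int r) (theta_coeff (Suc r))" for r by (rule fls_ge_mono[OF fls_ge_theta]) simp
  have bt: "fls_ge (int m) (b n * tail_term m n)" "fls_ge (int n) (b n * tail_term m n)" for m n
    unfolding b_def
    by (rule fls_ge_mult'[OF fls_ge_const fls_ge_tail_term(1)], simp)
       (rule fls_ge_mult'[OF fls_ge_const fls_ge_tail_term(2)], simp)
  have "(\<lambda>r. A (Suc r)) sums (2 * (\<Sum>r. theta_coeff (Suc r)) - (\<Sum>r. \<Sum>j. b j * tail_term r j))"
    unfolding ASuc by (intro sums_diff_fls sums_mult_fls sums_fls thS suminf_fls_ge bt)
  moreover have "suminf A = A 0 + (\<Sum>r. A (Suc r))" by (rule suminf_split_head_fls[OF A])
  moreover have "A 0 = 1" by (simp add: A_def bailey_alpha_def kappa_def)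
  moreover have "(\<Sum>r. \<Sum>j. b j * tail_term r j) = (\<Sum>j. b j * (\<Sum>r. tail_term r j))"
    by (rule suminf_swap_fls') (auto simp: b_def intro: fls_ge_tail_term)
  ultimately have "suminf A = 1 + 2 * (\<Sum>r. theta_coeff (Suc r)) - (\<Sum>j. b j * (\<Sum>r. tail_term r j))"
    by (simp add: sums_iff)
  hence "P * suminf A = central_gf - P * (\<Sum>j. b j * (\<Sum>r. tail_term r j))"
    by (simp add: central_gf_def P_def right_diff_distrib)
  also have "P * (\<Sum>j. b j * (\<Sum>r. tail_term r j)) = (\<Sum>j. P * (b j * (\<Sum>r. tail_term r j)))"
  proof (rule suminf_mult_fls[symmetric])
    show "fls_ge (int j) (b j * (\<Sum>r. tail_term r j))" for j
      unfolding b_def by (intro fls_ge_mult'[OF fls_ge_const] suminf_fls_ge) (auto intro: fls_ge_tail_term)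
  qed
  also have "\<dots> = (\<Sum>j. b j * tail_gf j)"
    by (simp add: tail_gf_def P_def mult_ac)
  finally show ?thesis by (simp add: P_def A_def b_def)
qed

lemma rank_sum_expansion:
  assumes "z \<noteq> 0"
  shows "(\<Sum>P\<in>overpartition_pairs n. rank_wt d e z P) =
     central_gf $$ int n - (\<Sum>j\<le>n. (z powi (int j + 1) + z powi (- int j - 1)) * tail_gf j $$ int n)"
proof -
  define y where "y = inverse z"
  have zy: "z * y = 1" using assms by (simp add: y_def)
  have ZY: "fls_const z * fls_const y = 1" using zy by simp
  have d: "fls_ge 0 (1 / fls_const d)" "fls_ge 0 (1 / fls_const e)"
    by (simp_all add: divide_inverse fls_inverse_const)
  have "(\<Sum>P\<in>overpartition_pairs n. rank_wt d e z P) =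
      (1 + suminf (max_term (fls_const d) (fls_const e) (fls_const z) (fls_const y))) $$ int n"
    by (rule rank_sum[OF zy])
  also have "1 + suminf (max_term (fls_const d) (fls_const e) (fls_const z) (fls_const y))
     = central_gf - (\<Sum>j. fls_const (z ^ Suc j + y ^ Suc j) * tail_gf j)"
  proof -
    have "1 + suminf (max_term (fls_const d) (fls_const e) (fls_const z) (fls_const y))
       = (\<Sum>n. rpoch (fls_const d) n * rpoch (fls_const e) n * qq ^ n
            / (fpoch (fls_const z * qq) n * fpoch (fls_const y * qq) n))"
      by (intro suminf_max_term fls_ge_const ZY)
    also have "\<dots> = pair_product (fls_const d) (fls_const e) *
       (\<Sum>r. bailey_alpha (fls_const z) (fls_const y) r * kappa (fls_const d) (fls_const e) r)"
      using de by (intro unit_bailey_lemma fls_ge_const ZY d) auto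
    finally show ?thesis unfolding bailey_sum_expansion[OF zy] .
  qed
  also have "\<dots> $$ int n = central_gf $$ int n - (\<Sum>j\<le>n. (z ^ Suc j + y ^ Suc j) * tail_gf j $$ int n)"
    using fls_ge_mult'[OF fls_ge_const fls_ge_tail_gf]
    by (subst fls_minus_nth, subst sums_fls(2)) auto
  also have "(\<lambda>j. z ^ Suc j + y ^ Suc j) = (\<lambda>j. z powi (int j + 1) + z powi (- int j - 1))"
  proof
    fix j
    have "int j + 1 = int (Suc j)" "- int j - 1 = - int (Suc j)" by simp_all
    thus "z ^ Suc j + y ^ Suc j = z powi (int j + 1) + z powi (- int j - 1)"
      by (simp only: power_int_of_nat power_int_minus y_def power_inverse)
  qed
  finally show ?thesis .
qed

definition rank_gf :: "int \<Rightarrow> 'a fls" where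
  "rank_gf m = (if m = 0 then central_gf else - tail_gf (nat \<bar>m\<bar> - 1))"

definition stat_wt :: "overpart \<times> overpart \<Rightarrow> 'a" where
  "stat_wt P = d ^ (num_overlined (fst P) + num_nonoverlined (snd P)) * e ^ size (snd P)"

text \<open>For fixed \<open>n\<close>, multiplying both sides by \<open>z^m\<close> and summing
  over \<open>m\<close> gives two Laurent polynomials that agree at every nonzero \<open>z\<close>,
  by \<open>rank_sum_expansion\<close>.\<close>

lemma rank_gf_nth:
  assumes inf: "infinite (UNIV :: 'a set)"
  shows "(\<Sum>P\<in>{P\<in>overpartition_pairs n. rank_pair P = m}. stat_wt P) = rank_gf m $$ int n"
proof -
  let ?A = "overpartition_pairs n"
  \<comment> \<open>Large enough for one interval to contain \<open>m\<close>, all ranks of pairs of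
    \<open>n\<close>, and every exponent of the expansion up to \<open>n + 1\<close>.\<close>
  define N where "N = Max (insert (nat \<bar>m\<bar>) (insert (Suc n) ((\<lambda>P. nat \<bar>rank_pair P\<bar>) ` ?A)))"
  define M where "M = {- int N..int N}"
  have fin: "finite (insert (nat \<bar>m\<bar>) (insert (Suc n) ((\<lambda>P. nat \<bar>rank_pair P\<bar>) ` ?A)))"
    by (simp add: finite_overpartition_pairs)
  have N: "k \<le> N" if "k \<in> insert (nat \<bar>m\<bar>) (insert (Suc n) ((\<lambda>P. nat \<bar>rank_pair P\<bar>) ` ?A))" for k
    unfolding N_def by (rule Max_ge[OF fin that])
  have nN: "n < N" using N[of "Suc n"] by simp
  have rM: "rank_pair P \<in> M" if "P \<in> ?A" for P
    using N[of "nat \<bar>rank_pair P\<bar>"] that by (auto simp: M_def)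
  have mM: "m \<in> M" using N[of "nat \<bar>m\<bar>"] by (auto simp: M_def)
  define a where "a m = (\<Sum>P\<in>{P\<in>?A. rank_pair P = m}. stat_wt P) - rank_gf m $$ int n" for m
  have "(\<Sum>m\<in>M. a m * z powi m) = 0" if "z \<in> UNIV - {0}" for z
  proof -
    have z: "z \<noteq> 0" using that by simp
    have "(\<Sum>m\<in>M. (\<Sum>P\<in>{P\<in>?A. rank_pair P = m}. stat_wt P) * z powi m)
      = (\<Sum>m\<in>M. \<Sum>P\<in>{P\<in>?A. rank_pair P = m}. rank_wt d e z P)"
      by (auto simp: sum_distrib_right rank_wt_def stat_wt_def intro!: sum.cong)
    also have "\<dots> = (\<Sum>P\<in>?A. rank_wt d e z P)"
      using rM by (intro sum.group finite_overpartition_pairs) (auto simp: M_def)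
    also have "\<dots> = (\<Sum>m\<in>M. rank_gf m $$ int n * z powi m)"
    proof -
      have "(\<Sum>m\<in>M. rank_gf m $$ int n * z powi m) = central_gf $$ int n +
         (\<Sum>j<N. - ((z powi (int j + 1) + z powi (- int j - 1)) * tail_gf j $$ int n))"
      proof -
        have "nat (\<bar>int j + 1\<bar>) - 1 = j" "nat (\<bar>- int j - 1\<bar>) - 1 = j" for j by linarith+
        thus ?thesis unfolding M_def sum_symmetric_interval
          by (auto simp: rank_gf_def algebra_simps intro!: sum.cong)
      qed
      also have "(\<Sum>j<N. - ((z powi (int j + 1) + z powi (- int j - 1)) * tail_gf j $$ int n))
        = (\<Sum>j\<le>n. - ((z powi (int j + 1) + z powi (- int j - 1)) * tail_gf j $$ int n))"
        using nN by (intro sum.mono_neutral_right) (auto simp: fls_geD[OF fls_ge_tail_gf])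
      finally show ?thesis unfolding rank_sum_expansion[OF z] by (simp add: sum_negf)
    qed
    finally show ?thesis by (simp add: a_def left_diff_distrib sum_subtractf)
  qed
  hence "a m = 0"
    using inf mM by (intro laurent_coeffs_zero[of M "UNIV - {0}" a m]) (auto simp: M_def)
  thus ?thesis by (simp add: a_def)
qed

end

subsection \<open>Symmetrized moments\<close>

lemma sum_by_value:
  fixes f :: "'b \<Rightarrow> 'c::comm_monoid_add"
  assumes "finite A"
  shows "(\<Sum>v\<in>g ` A. \<Sum>x\<in>{x\<in>A. g x = v}. f x) = sum f A"
  using assms by (intro sum.group) auto

lemma int_binomial_of_nat: "int_binomial (int a) k = int (a choose k)"
proof -
  have "(of_int (int_binomial (int a) k) :: rat) = of_int (int (a choose k))"
    by (simp add: of_int_int_binomial binomial_gbinomial)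
  thus ?thesis by (simp only: of_int_eq_iff)
qed

lemma int_binomial_negated_upper: "int_binomial a k = (- 1) ^ k * int_binomial (int k - a - 1) k"
proof -
  have "(of_int (int_binomial a k) :: rat) = of_int ((- 1) ^ k * int_binomial (int k - a - 1) k)"
    using gbinomial_negated_upper[of "of_int a :: rat" k] by (simp add: of_int_int_binomial)
  thus ?thesis by (simp only: of_int_eq_iff)
qed

lemma suminf_drop_zeros_fls:
  fixes f :: "nat \<Rightarrow> 'a::ab_group_add fls"
  assumes f: "\<And>n. fls_ge (int n) (f n)" and 0: "\<And>n. n < v \<Longrightarrow> f n = 0"
  shows "suminf f = (\<Sum>n. f (n + v))"
  using 0
proof (induction v)
  case (Suc v)
  have "suminf f = (\<Sum>n. f (n + v))" using Suc by simp
  also have "\<dots> = f (0 + v) + (\<Sum>n. f (Suc n + v))"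
    by (intro suminf_split_head_fls fls_ge_mono[OF f]) simp
  finally show ?case using Suc.prems[of v] by simp
qed simp

lemma fls_ge_of_nat [simp]: "fls_ge 0 (of_nat n :: 'a::field fls)"
  by (simp add: fls_of_nat)

lemma fls_ge_of_nat_times_power:
  fixes x :: "'a::field fls"
  assumes "fls_ge 1 x"
  shows "fls_ge (int j) (of_nat k * x ^ j)"
  using fls_ge_mult'[OF fls_ge_of_nat fls_ge_power[OF assms]] by simp

text \<open>Pascal's rule gives \<open>s = x (t + s)\<close> for consecutive sums \<open>t\<close>
  and \<open>s\<close>, so raising \<open>k\<close> multiplies the sum by
  \<open>x / (1 - x)\<close>.\<close>

lemma suminf_binomial_fls:
  fixes x :: "'a::field fls"
  assumes x: "fls_ge 1 x"
  shows "(\<Sum>j. of_nat (j choose k) * x ^ j) = x ^ k / (1 - x) ^ Suc k"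
proof (induction k)
  case 0
  show ?case using geometric_sums_fls[OF x] by (simp add: sums_iff)
next
  case (Suc k)
  define t s where "t = (\<Sum>j. of_nat (j choose k) * x ^ j)" and "s = (\<Sum>j. of_nat (j choose Suc k) * x ^ j)"
  have "s = (\<Sum>j. of_nat (Suc j choose Suc k) * x ^ Suc j)"
    unfolding s_def by (subst suminf_split_head_fls[OF fls_ge_of_nat_times_power[OF x]]) simp
  also have "\<dots> = (\<Sum>j. x * (of_nat (j choose k) * x ^ j + of_nat (j choose Suc k) * x ^ j))"
    by (intro suminf_cong) (simp add: algebra_simps)
  also have "\<dots> = x * (\<Sum>j. of_nat (j choose k) * x ^ j + of_nat (j choose Suc k) * x ^ j)"
    by (intro suminf_mult_fls fls_ge_add fls_ge_of_nat_times_power x)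
  also have "(\<Sum>j. of_nat (j choose k) * x ^ j + of_nat (j choose Suc k) * x ^ j) = t + s"
    unfolding t_def s_def
    by (intro sums_unique[symmetric] sums_add sums_fls fls_ge_of_nat_times_power x)
  finally have "s * (1 - x) = x * t" by (simp add: algebra_simps)
  moreover have nz: "1 - x \<noteq> 0" by (intro fls_one_unit_nz fls_one_unit_minus x)
  ultimately have "s = x * t / (1 - x)" by (simp add: nonzero_eq_divide_eq)
  also have "\<dots> = x ^ Suc k / (1 - x) ^ Suc (Suc k)" unfolding t_def Suc by simp
  finally show ?case by (simp add: s_def)
qed

text \<open>Shifting the upper index by \<open>w\<close> divides the binomial series by
  \<open>x^w\<close>. The shifts \<open>v\<close> and \<open>v + 1\<close> give \<open>x^v\<close>
  and \<open>x^(v-1)\<close> over the common denominator.\<close>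

lemma suminf_symmetrized_binomial:
  fixes x :: "'a::field fls"
  assumes x: "fls_ge 1 x" "x \<noteq> 0" and v: "v > 0"
  shows "(\<Sum>j. of_nat ((j + v choose 2 * v) + (j + v + 1 choose 2 * v)) * x ^ j)
           = x ^ (v - 1) * (1 + x) / (1 - x) ^ Suc (2 * v)"
proof -
  define p where "p w = (\<Sum>j. of_nat (j + w choose 2 * v) * x ^ j)" for w
  \<comment> \<open>The bound on \<open>w\<close> makes the \<open>w\<close> binomials lost in the
    shift vanish; it admits \<open>w = v + 1\<close> because \<open>v > 0\<close>.\<close>
  have p: "x ^ w * p w = x ^ (2 * v) / (1 - x) ^ Suc (2 * v)" if "w \<le> 2 * v" for w
  proof -
    have "x ^ w * p w = (\<Sum>j. x ^ w * (of_nat (j + w choose 2 * v) * x ^ j))"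
      unfolding p_def by (intro suminf_mult_fls[symmetric] fls_ge_of_nat_times_power x)
    also have "\<dots> = (\<Sum>j. of_nat (j + w choose 2 * v) * x ^ (j + w))"
      by (simp add: power_add mult_ac)
    also have "\<dots> = (\<Sum>j. of_nat (j choose 2 * v) * x ^ j)"
      using that by (intro suminf_drop_zeros_fls[symmetric] fls_ge_of_nat_times_power x)
         (auto simp: binomial_eq_0)
    finally show ?thesis by (simp add: suminf_binomial_fls[OF x(1)])
  qed
  define R where "R = x ^ (v - 1) / (1 - x) ^ Suc (2 * v)"
  have R: "x ^ (2 * v) / (1 - x) ^ Suc (2 * v) = x ^ v * (x * R)"
    "x ^ (2 * v) / (1 - x) ^ Suc (2 * v) = x ^ (v + 1) * R"
    using v by (simp_all add: R_def mult_2 power_add power_eq_if[of x v])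
  have "p v = x * R" using p[of v] x(2) unfolding R(1) by simp
  moreover have "p (v + 1) = R" using p[of "v + 1"] x(2) v unfolding R(2) by simp
  moreover have "(\<lambda>j. of_nat (j + v choose 2 * v) * x ^ j + of_nat (j + (v + 1) choose 2 * v) * x ^ j)
      sums (p v + p (v + 1))"
    unfolding p_def by (intro sums_add sums_fls fls_ge_of_nat_times_power x)
  hence "(\<Sum>j. of_nat ((j + v choose 2 * v) + (j + v + 1 choose 2 * v)) * x ^ j) = p v + p (v + 1)"
    by (simp add: sums_iff algebra_simps)
  ultimately show ?thesis by (simp add: R_def algebra_simps add_divide_distrib)
qed

definition stat_r :: "overpart \<times> overpart \<Rightarrow> nat" where
  "stat_r P = num_overlined (fst P) + num_nonoverlined (snd P)"

definition stat_s :: "overpart \<times> overpart \<Rightarrow> nat" where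
  "stat_s P = size (snd P)"

definition moment_kernel :: "nat \<Rightarrow> int \<Rightarrow> int" where
  "moment_kernel k m = int_binomial (m + (int k - 1) div 2) k"

text \<open>Only ranks that occur contribute, so the sum over all integers is finite and can be
  regrouped by pairs.\<close>

lemma eta_eq_sum:
  "eta k r s n = (\<Sum>P\<in>{P\<in>overpartition_pairs n. stat_r P = r \<and> stat_s P = s}. moment_kernel k (rank_pair P))"
proof -
  let ?A = "{P\<in>overpartition_pairs n. stat_r P = r \<and> stat_s P = s}"
  have fin: "finite ?A" using finite_overpartition_pairs[of n] by simp
  have rc: "rank_count r s m n = card {P\<in>?A. rank_pair P = m}" for m
  proof -
    have "{(la, mu). (la, mu) \<in> overpartition_pairs n \<and> rank_pair (la, mu) = m \<and>
                     num_overlined la + num_nonoverlined mu = r \<and> size mu = s} = {P\<in>?A. rank_pair P = m}"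
      by (auto simp: stat_r_def stat_s_def)
    thus ?thesis by (simp only: rank_count_def)
  qed
  have "eta k r s n = (\<Sum>\<^sub>\<infinity>m\<in>rank_pair ` ?A. moment_kernel k m * int (rank_count r s m n))"
    unfolding eta_def moment_kernel_def
  proof (rule infsum_cong_neutral)
    fix m assume "m \<in> UNIV - rank_pair ` ?A"
    hence "{P\<in>?A. rank_pair P = m} = {}" by blast
    hence "rank_count r s m n = 0" unfolding rc by (simp only: card.empty)
    thus "int_binomial (m + (int k - 1) div 2) k * int (rank_count r s m n) = 0" by simp
  qed auto
  also have "\<dots> = (\<Sum>m\<in>rank_pair ` ?A. moment_kernel k m * int (rank_count r s m n))"
    using fin by (intro infsum_finite finite_imageI)
  also have "\<dots> = (\<Sum>m\<in>rank_pair ` ?A. \<Sum>P\<in>{P\<in>?A. rank_pair P = m}. moment_kernel k (rank_pair P))"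
    unfolding rc by (intro sum.cong refl) (simp add: mult.commute)
  also have "\<dots> = (\<Sum>P\<in>?A. moment_kernel k (rank_pair P))"
    by (rule sum_by_value[OF fin])
  finally show ?thesis .
qed

text \<open>For \<open>k = 2 v + 1\<close> the factors of the kernel run over
  \<open>m - v, ..., m + v\<close>, centred at \<open>m\<close>, and their number is odd.\<close>

lemma moment_kernel_odd: "odd k \<Longrightarrow> moment_kernel k (- m) = - moment_kernel k m"
proof -
  assume "odd k"
  then obtain v where k: "k = 2 * v + 1" by (elim oddE)
  have eq: "int k - (- m + int v) - 1 = m + int v" and c: "(int k - 1) div 2 = int v"
    by (simp_all add: k)
  show ?thesis unfolding moment_kernel_def c
    using int_binomial_negated_upper[of "- m + int v" k, unfolded eq] \<open>odd k\<close> by simp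
qed

text \<open>The factors run over \<open>m - v, ..., m + v - 1\<close>, so the kernel vanishes at 0
  but is not even. Reflecting the upper argument turns its value at \<open>- j - 1\<close> into an
  ordinary binomial coefficient.\<close>

lemma moment_kernel_even:
  assumes v: "v > 0"
  shows "moment_kernel (2 * v) 0 = 0"
    and "moment_kernel (2 * v) (int j + 1) + moment_kernel (2 * v) (- int j - 1)
           = int ((j + v choose 2 * v) + (j + v + 1 choose 2 * v))"
proof -
  have c: "(int (2 * v) - 1) div 2 = int v - 1" using v by simp
  have "0 + (int v - 1) = int (v - 1)" using v by simp
  thus "moment_kernel (2 * v) 0 = 0"
    using v unfolding moment_kernel_def c by (simp only: int_binomial_of_nat) (simp add: binomial_eq_0)
  have 1: "int j + 1 + (int v - 1) = int (j + v)" by simp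
  have "int_binomial (- int j - 1 + (int v - 1)) (2 * v) = int_binomial (int (j + v + 1)) (2 * v)"
    by (subst int_binomial_negated_upper) (simp add: algebra_simps)
  hence 2: "int_binomial (- int j - 1 + (int v - 1)) (2 * v) = int (j + v + 1 choose 2 * v)"
    by (simp only: int_binomial_of_nat)
  show "moment_kernel (2 * v) (int j + 1) + moment_kernel (2 * v) (- int j - 1)
           = int ((j + v choose 2 * v) + (j + v + 1 choose 2 * v))"
    unfolding moment_kernel_def c 1 2 int_binomial_of_nat by simp
qed

section \<open>Moments as coefficients of powers of \<open>q\<close>\<close>

context
  fixes d e :: "'a::field"
  assumes de: "d \<noteq> 0" "e \<noteq> 0" and inf: "infinite (UNIV :: 'a set)"
begin

text \<open>Ranks \<open>m\<close> and \<open>- m\<close> share one generating function, so a weight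
  \<open>B\<close> enters only through \<open>B 0\<close> and the sums
  \<open>B m + B (- m)\<close>.\<close>

lemma weighted_rank_sum:
  fixes B :: "int \<Rightarrow> 'a"
  shows "(\<Sum>P\<in>overpartition_pairs n. stat_wt d e P * B (rank_pair P)) =
     B 0 * central_gf d e $$ int n - (\<Sum>j\<le>n. (B (int j + 1) + B (- int j - 1)) * tail_gf d e j $$ int n)"
proof -
  let ?A = "overpartition_pairs n"
  have finA: "finite ?A" by (rule finite_overpartition_pairs)
  have fin: "finite (insert (Suc n) ((\<lambda>P. nat \<bar>rank_pair P\<bar>) ` ?A))" by (simp add: finA)
  define N where "N = Max (insert (Suc n) ((\<lambda>P. nat \<bar>rank_pair P\<bar>) ` ?A))"
  have N: "k \<le> N" if "k \<in> insert (Suc n) ((\<lambda>P. nat \<bar>rank_pair P\<bar>) ` ?A)" for k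
    unfolding N_def by (rule Max_ge[OF fin that])
  have nN: "n < N" using N[of "Suc n"] by simp
  have rM: "rank_pair P \<in> {- int N..int N}" if "P \<in> ?A" for P
    using N[of "nat \<bar>rank_pair P\<bar>"] that by auto
  have "(\<Sum>P\<in>?A. stat_wt d e P * B (rank_pair P))
    = (\<Sum>m=- int N..int N. \<Sum>P\<in>{P\<in>?A. rank_pair P = m}. stat_wt d e P * B (rank_pair P))"
    using rM by (intro sum.group[symmetric] finA) auto
  also have "\<dots> = (\<Sum>m=- int N..int N. rank_gf d e m $$ int n * B m)"
    by (intro sum.cong refl) (simp add: rank_gf_nth[OF de inf, symmetric] sum_distrib_right)
  also have "\<dots> = central_gf d e $$ int n * B 0 +
         (\<Sum>j<N. - ((B (int j + 1) + B (- int j - 1)) * tail_gf d e j $$ int n))"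
  proof -
    have "nat (\<bar>int j + 1\<bar>) - 1 = j" "nat (\<bar>- int j - 1\<bar>) - 1 = j" for j by linarith+
    thus ?thesis unfolding sum_symmetric_interval
      by (auto simp: rank_gf_def[OF de] algebra_simps intro!: sum.cong)
  qed
  also have "(\<Sum>j<N. - ((B (int j + 1) + B (- int j - 1)) * tail_gf d e j $$ int n))
      = (\<Sum>j\<le>n. - ((B (int j + 1) + B (- int j - 1)) * tail_gf d e j $$ int n))"
    using nN by (intro sum.mono_neutral_right) (auto simp: fls_geD[OF fls_ge_tail_gf[OF de]])
  finally show ?thesis by (simp add: sum_negf mult.commute)
qed

definition moment_coeff :: "nat \<Rightarrow> nat \<Rightarrow> 'a" where
  "moment_coeff k n = (\<Sum>P\<in>overpartition_pairs n. stat_wt d e P * of_int (moment_kernel k (rank_pair P)))"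

lemma moment_coeff_odd: "odd k \<Longrightarrow> moment_coeff k n = 0"
proof -
  assume k: "odd k"
  have "moment_kernel k (- int j - 1) = - moment_kernel k (int j + 1)" for j
    using moment_kernel_odd[OF k, of "int j + 1"] by simp
  moreover have "moment_kernel k 0 = 0" using moment_kernel_odd[OF k, of 0] by simp
  ultimately show ?thesis unfolding moment_coeff_def
    by (subst weighted_rank_sum[where B = "\<lambda>m. of_int (moment_kernel k m)"]) simp
qed

text \<open>For \<open>r > 0\<close> and \<open>v > 0\<close> this is the sum of the terms
  \<open>r\<close> and \<open>- r\<close> of the bilateral series; see
  \<open>N_even_eq\<close>.\<close>

definition even_moment_term :: "nat \<Rightarrow> nat \<Rightarrow> 'a fls" where
  "even_moment_term v r = - (theta_coeff d e r * (qq ^ r) ^ (v - 1) * (1 + qq ^ r) / (1 - qq ^ r) ^ (2 * v))"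

lemma fls_ge_even_moment_term: "r > 0 \<Longrightarrow> fls_ge (int r) (even_moment_term v r)"
  unfolding even_moment_term_def power_mult[symmetric]
  by (intro fls_ge_uminus fls_ge_divide fls_ge_mult'[of "int r" _ 0] fls_ge_theta[OF de] fls_ge_add
      fls_ge_one fls_ge_X_power fls_one_unit_power fls_one_unit_minus) auto

lemma moment_coeff_even:
  assumes v: "v > 0"
  shows "moment_coeff (2 * v) n =
     (pair_product (fls_const d) (fls_const e) * (\<Sum>r. even_moment_term v (Suc r))) $$ int n"
proof -
  define b where "b j = (of_nat ((j + v choose 2 * v) + (j + v + 1 choose 2 * v)) :: 'a fls)" for j
  define P where "P = pair_product (fls_const d) (fls_const e)"
  have b: "fls_ge 0 (b j)" for j unfolding b_def by (rule fls_ge_of_nat)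
  have bn: "of_int (moment_kernel (2 * v) (int j + 1)) + of_int (moment_kernel (2 * v) (- int j - 1))
     = (of_nat ((j + v choose 2 * v) + (j + v + 1 choose 2 * v)) :: 'a)" for j
    by (simp only: of_int_add[symmetric] moment_kernel_even(2)[OF v] of_int_of_nat_eq)
  have "moment_coeff (2 * v) n = - (\<Sum>j\<le>n. (b j * tail_gf d e j) $$ int n)"
    unfolding moment_coeff_def weighted_rank_sum[where B = "\<lambda>m. of_int (moment_kernel (2 * v) m)"]
      bn moment_kernel_even(1)[OF v] b_def
    by (simp only: fls_mult_of_nat_nth of_int_0 mult_zero_left diff_0)
  also have "(\<Sum>j\<le>n. (b j * tail_gf d e j) $$ int n) = (\<Sum>j. b j * tail_gf d e j) $$ int n"
    by (subst sums_fls(2)) (auto intro!: fls_ge_mult'[OF b fls_ge_tail_gf[OF de]])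
  also have "(\<Sum>j. b j * tail_gf d e j) = (\<Sum>j. P * (b j * (\<Sum>r. tail_term d e r j)))"
    by (simp add: tail_gf_def[OF de] P_def mult_ac)
  also have "\<dots> = P * (\<Sum>j. b j * (\<Sum>r. tail_term d e r j))"
  proof (rule suminf_mult_fls)
    show "fls_ge (int j) (b j * (\<Sum>r. tail_term d e r j))" for j
      by (intro fls_ge_mult'[OF b] suminf_fls_ge) (auto intro: fls_ge_tail_term[OF de])
  qed
  also have "(\<Sum>j. b j * (\<Sum>r. tail_term d e r j)) = (\<Sum>r. \<Sum>j. b j * tail_term d e r j)"
    by (rule suminf_swap_fls'[symmetric]) (auto intro: b fls_ge_tail_term[OF de])
  also have "(\<lambda>r. \<Sum>j. b j * tail_term d e r j) = (\<lambda>r. - 1 * even_moment_term v (Suc r))"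
  proof
    fix r
    define x where "x = (qq ^ Suc r :: 'a fls)"
    have "fls_ge 1 x" unfolding x_def by (rule fls_ge_X_power) simp
    moreover have "x \<noteq> 0" by (simp add: x_def)
    ultimately have x: "fls_ge 1 x" "x \<noteq> 0" .
    have nz: "1 - x \<noteq> 0" by (intro fls_one_unit_nz fls_one_unit_minus x)
    have "(\<Sum>j. b j * tail_term d e r j) = (\<Sum>j. theta_coeff d e (Suc r) * (1 - x) * (b j * x ^ j))"
      by (simp add: tail_term_def[OF de] x_def mult_ac)
    also have "\<dots> = theta_coeff d e (Suc r) * (1 - x) * (\<Sum>j. b j * x ^ j)"
      unfolding b_def by (intro suminf_mult_fls fls_ge_of_nat_times_power x)
    also have "(\<Sum>j. b j * x ^ j) = x ^ (v - 1) * (1 + x) / (1 - x) ^ Suc (2 * v)"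
      unfolding b_def by (rule suminf_symmetrized_binomial[OF x v])
    \<comment> \<open>The factor \<open>1 - x\<close> of \<open>tail_term\<close> lowers the
      exponent \<open>2 v + 1\<close> to \<open>2 v\<close>. The sign here cancels the one brought
      in by \<open>weighted_rank_sum\<close>.\<close>
    finally show "(\<Sum>j. b j * tail_term d e r j) = - 1 * even_moment_term v (Suc r)"
      unfolding even_moment_term_def x_def[symmetric] using nz by simp
  qed
  also have "(\<Sum>r. - 1 * even_moment_term v (Suc r)) = - 1 * (\<Sum>r. even_moment_term v (Suc r))"
    by (intro suminf_mult_fls fls_ge_mono[OF fls_ge_even_moment_term]) auto
  finally show ?thesis by (simp add: P_def)
qed

text \<open>For each \<open>n\<close> only finitely many statistics \<open>(r, s)\<close> are
  attained. Summing over them collects the coefficient of \<open>q^n\<close>, and the triples with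
  large \<open>n\<close> have large order.\<close>

lemma eta_has_sum:
  assumes S: "\<And>n. S $$ int n = moment_coeff k n" "fls_ge 0 S"
  shows "((\<lambda>(r, s, n). of_int (eta k r s n) * fls_const d ^ r * fls_const e ^ s * qq ^ n) has_sum S) UNIV"
proof (rule has_sum_flsI)
  fix N :: int
  define f :: "nat \<times> nat \<times> nat \<Rightarrow> 'a fls"
    where "f = (\<lambda>(r, s, n). of_int (eta k r s n) * fls_const d ^ r * fls_const e ^ s * qq ^ n)"
  define st where "st P = (stat_r P, stat_s P)" for P
  define I where "I n = st ` overpartition_pairs n" for n
  \<comment> \<open>Outside \<open>B\<close>, either \<open>n\<close> is at least \<open>N\<close>
    or no pair of \<open>n\<close> has the statistics \<open>(r, s)\<close>, so that the term is
    0.\<close>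
  define B where "B = (\<lambda>(n, r, s). (r, s, n)) ` (SIGMA n:{..<nat N}. I n)"
  have finI: "finite (I n)" for n by (simp add: I_def finite_overpartition_pairs)
  have f: "f (r, s, n) = fls_const (\<Sum>P\<in>{P\<in>overpartition_pairs n. st P = (r, s)}.
      stat_wt d e P * of_int (moment_kernel k (rank_pair P))) * qq ^ n" for r s n
  proof -
    have "{P\<in>overpartition_pairs n. st P = (r, s)} = {P\<in>overpartition_pairs n. stat_r P = r \<and> stat_s P = s}"
      by (auto simp: st_def)
    hence "(\<Sum>P\<in>{P\<in>overpartition_pairs n. st P = (r, s)}. stat_wt d e P * of_int (moment_kernel k (rank_pair P)))
      = (\<Sum>P\<in>{P\<in>overpartition_pairs n. stat_r P = r \<and> stat_s P = s}. d ^ r * e ^ s * of_int (moment_kernel k (rank_pair P)))"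
      by (auto intro!: sum.cong simp: stat_wt_def[OF de] stat_r_def stat_s_def)
    also have "\<dots> = d ^ r * e ^ s * of_int (eta k r s n)"
      by (simp add: eta_eq_sum sum_distrib_left)
    finally show ?thesis
      by (simp add: f_def fls_const_power fls_of_int mult_ac flip: fls_const_mult_const)
  qed
  have "fls_ge N (f i)" if "i \<in> UNIV - B" for i
  proof -
    obtain r s n where i: "i = (r, s, n)" by (cases i)
    show ?thesis
    proof (cases "N \<le> int n")
      case True
      show ?thesis unfolding i f
        by (rule fls_ge_mult'[OF fls_ge_const fls_ge_X_power[OF True]]) simp
    next
      case False
      have "(r, s) \<notin> I n"
      proof
        assume "(r, s) \<in> I n"
        hence "i \<in> B" unfolding B_def i using False by (intro image_eqI[of _ _ "(n, r, s)"]) auto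
        thus False using that by simp
      qed
      hence "\<forall>P\<in>overpartition_pairs n. st P \<noteq> (r, s)" unfolding I_def by (metis imageI)
      hence "{P\<in>overpartition_pairs n. st P = (r, s)} = {}" by blast
      thus ?thesis unfolding i f by (simp only: sum.empty) simp
    qed
  qed
  moreover have "fls_ge N (sum f B - S)"
  proof -
    have "sum f B = (\<Sum>n<nat N. \<Sum>(r, s)\<in>I n. f (r, s, n))"
      unfolding B_def using finI
      by (subst sum.reindex) (auto simp: inj_on_def sum.Sigma case_prod_unfold)
    also have "\<dots> = (\<Sum>n<nat N. fls_const (moment_coeff k n) * qq ^ n)"
    proof (rule sum.cong[OF refl])
      fix n
      have const_sum: "(\<Sum>v\<in>A. fls_const (g v)) = fls_const (sum g A)" for A and g :: "nat \<times> nat \<Rightarrow> 'a"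
        by (induction A rule: infinite_finite_induct) (auto simp: fls_plus_const)
      have "(\<Sum>(r, s)\<in>I n. f (r, s, n)) = fls_const (\<Sum>v\<in>I n. \<Sum>P\<in>{P\<in>overpartition_pairs n. st P = v}.
        stat_wt d e P * of_int (moment_kernel k (rank_pair P))) * qq ^ n"
        unfolding const_sum[symmetric] sum_distrib_right by (intro sum.cong refl) (auto simp: f)
      thus "(\<Sum>(r, s)\<in>I n. f (r, s, n)) = fls_const (moment_coeff k n) * qq ^ n"
        unfolding I_def moment_coeff_def by (simp only: sum_by_value[OF finite_overpartition_pairs])
    qed
    finally have sum: "sum f B = (\<Sum>n<nat N. fls_const (moment_coeff k n) * qq ^ n)" .
    have nth_sum: "(\<Sum>n\<in>A. g n) $$ m = (\<Sum>n\<in>A. g n $$ m)" for A m and g :: "nat \<Rightarrow> 'a fls"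
      by (induction A rule: infinite_finite_induct) auto
    show ?thesis unfolding fls_ge_def
    proof safe
      fix m assume m: "m < N"
      have Xn: "(fls_const c * qq ^ n) $$ m = (if m = int n then c else 0)" for c :: 'a and n
        by (simp add: fls_X_power_conv_shift_1)
      show "(sum f B - S) $$ m = 0"
      proof (cases "m < 0")
        case True
        thus ?thesis using fls_geD[OF S(2) True] by (simp add: sum nth_sum Xn)
      next
        case False
        have "(\<Sum>n<nat N. if m = int n then moment_coeff k n else 0) = moment_coeff k (nat m)"
        proof -
          have "(\<Sum>n<nat N. if m = int n then moment_coeff k n else 0)
            = (\<Sum>n<nat N. if n = nat m then moment_coeff k n else 0)"
            using False by (intro sum.cong) auto
          thus ?thesis using m False by simp
        qed
        thus ?thesis using S(1)[of "nat m"] False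
          unfolding fls_minus_nth sum nth_sum Xn by simp
      qed
    qed
  qed
  moreover have "finite B" using finI by (simp add: B_def)
  ultimately show "\<exists>B. finite B \<and> B \<subseteq> UNIV \<and>
     (\<forall>i\<in>UNIV - B. fls_ge N ((\<lambda>(r, s, n). of_int (eta k r s n) * fls_const d ^ r * fls_const e ^ s * qq ^ n) i)) \<and>
     fls_ge N (sum (\<lambda>(r, s, n). of_int (eta k r s n) * fls_const d ^ r * fls_const e ^ s * qq ^ n) B - S)"
    unfolding f_def by blast
qed

end

subsection \<open>Folding the bilateral series\<close>

text \<open>Symmetric intervals without 0 serve as the finite sets in \<open>has_sum_flsI\<close>;
  over them the sum is a partial sum of the series of paired terms.\<close>

lemma has_sum_int_nonzero_fls:
  fixes t :: "int \<Rightarrow> 'a::ab_group_add fls"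
  assumes t: "\<And>m. m \<noteq> 0 \<Longrightarrow> fls_ge \<bar>m\<bar> (t m)"
  shows "(t has_sum (\<Sum>j. t (int j + 1) + t (- int j - 1))) (UNIV - {0})"
proof (rule has_sum_flsI)
  fix N :: int
  define u where "u j = t (int j + 1) + t (- int j - 1)" for j
  define B where "B = {- int (nat N)..int (nat N)} - {0}"
  have u: "fls_ge (int j) (u j)" for j
    unfolding u_def by (intro fls_ge_add fls_ge_mono[OF t]) auto
  have "sum t B = (\<Sum>j<nat N. u j)"
  proof -
    have "sum t B = (\<Sum>m=- int (nat N)..int (nat N). if m = 0 then 0 else t m)"
      unfolding B_def by (intro sum.mono_neutral_cong_left) auto
    also have "\<dots> = (\<Sum>j<nat N. u j)"
      unfolding sum_symmetric_interval u_def by (auto intro!: sum.cong)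
    finally show ?thesis .
  qed
  moreover have "fls_ge N ((\<Sum>j<M. u j) - suminf u)" if "N \<le> int M" for M
  proof -
    have "suminf u = (\<Sum>j<M. u j) + (\<Sum>j. u (j + M))" for M
    proof (induction M)
      case (Suc M)
      have "(\<Sum>j. u (j + M)) = u (0 + M) + (\<Sum>j. u (Suc j + M))"
        by (intro suminf_split_head_fls fls_ge_mono[OF u]) simp
      thus ?case using Suc by simp
    qed simp
    moreover have "fls_ge N (\<Sum>j. u (j + M))"
      using that by (intro suminf_fls_ge fls_ge_mono[OF u]) auto
    ultimately show ?thesis using fls_ge_uminus by (metis add_diff_cancel_left' minus_diff_eq)
  qed
  ultimately have "fls_ge N (sum t B - suminf u)" by simp
  moreover have "\<forall>i\<in>UNIV - {0} - B. fls_ge N (t i)"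
    by (auto simp: B_def intro!: fls_ge_mono[OF t])
  ultimately show "\<exists>B. finite B \<and> B \<subseteq> UNIV - {0} \<and> (\<forall>i\<in>UNIV - {0} - B. fls_ge N (t i)) \<and>
      fls_ge N (sum t B - (\<Sum>j. t (int j + 1) + t (- int j - 1)))"
    by (intro exI[of _ B]) (auto simp: B_def u_def[abs_def])
qed

section \<open>Shifted factorials with integer index\<close>

lemma X_powi_add: "qq powi i * qq powi j = (qq powi (i + j) :: 'a::field fls)"
proof -
  have "(qq :: 'a fls) \<noteq> 0" by simp
  thus ?thesis by (metis power_int_add)
qed

lemma X_powi_mult_power: "qq powi i * qq ^ n = (qq powi (i + int n) :: 'a::field fls)"
  using X_powi_add[of i "int n", where 'a = 'a] by (simp only: power_int_of_nat)

context
  fixes c :: "'a::field" and i :: int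
  assumes c: "c \<noteq> 1"
begin

text \<open>The constant coefficient is 1 for \<open>j\<close> other than 0, and
  \<open>1 - c\<close> for \<open>j = 0\<close>.\<close>

lemma one_minus_const_X_nz: "1 - fls_const c * qq powi j \<noteq> 0"
proof
  assume "1 - fls_const c * qq powi j = 0"
  hence "(1 - fls_const c * qq powi j) $$ 0 = 0" by simp
  thus False using c by (auto split: if_splits)
qed

lemma qpoch_inf_const_split:
  defines "a \<equiv> fls_const c * qq powi i"
  shows "qpoch_inf a \<noteq> 0" and "qpoch_inf a = fpoch a n * qpoch_inf (a * qq ^ n)"
proof -
  have mult: "a * qq ^ j = fls_const c * qq powi (i + int j)" for j
    unfolding a_def mult.assoc X_powi_mult_power ..
  have nz: "1 - a * qq ^ j \<noteq> 0" for j unfolding mult by (rule one_minus_const_X_nz)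
  \<comment> \<open>The exponent \<open>i\<close> may be negative; after \<open>M\<close> factors
    the base has positive order and the unit criterion applies.\<close>
  define M where "M = n + nat (1 - i)"
  have ge: "fls_ge 1 (a * qq ^ M)"
  proof -
    obtain m where m: "i + int M = int m" "1 \<le> int m"
      using that[of "nat (i + int M)"] by (auto simp: M_def)
    show ?thesis unfolding mult m(1) power_int_of_nat
      by (rule fls_ge_mult'[OF fls_ge_const fls_ge_X_power[OF order_refl]]) (use m(2) in simp)
  qed
  have 1: "qpoch_inf a = fpoch a M * qpoch_inf (a * qq ^ M)" by (rule qpoch_inf_split[OF ge nz])
  have "qpoch_inf (a * qq ^ M) \<noteq> 0" by (intro fls_one_unit_nz fpoch_has_prod ge)
  moreover have "fpoch a M \<noteq> 0" using nz by (simp add: fpoch_def)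
  ultimately show "qpoch_inf a \<noteq> 0" using 1 by simp
  define k where "k = nat (1 - i)"
  have Mk: "a * qq ^ M = a * qq ^ n * qq ^ k" by (simp add: M_def k_def power_add mult.assoc)
  have "qpoch_inf (a * qq ^ n) = fpoch (a * qq ^ n) k * qpoch_inf (a * qq ^ n * qq ^ k)"
  proof (rule qpoch_inf_split)
    show "fls_ge 1 (a * qq ^ n * qq ^ k)" using ge unfolding Mk .
    show "1 - a * qq ^ n * qq ^ j \<noteq> 0" for j
      using nz[of "n + j"] by (simp add: power_add mult.assoc)
  qed
  thus "qpoch_inf a = fpoch a n * qpoch_inf (a * qq ^ n)"
    unfolding 1 Mk by (simp add: M_def k_def fpoch_add)
qed

end

lemma qpoch_nonneg:
  assumes "c \<noteq> 1"
  shows "qpoch (fls_const c * qq powi i) (int n) = fpoch (fls_const c * qq powi i) n"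
proof -
  define a where "a = fls_const c * qq powi i"
  have 1: "qpoch_inf a = fpoch a n * qpoch_inf (a * qq ^ n)" "qpoch_inf a \<noteq> 0"
    unfolding a_def by (rule qpoch_inf_const_split[OF assms])+
  have "qpoch a (int n) = qpoch_inf a / qpoch_inf (a * qq ^ n)" unfolding qpoch_def power_int_of_nat ..
  moreover have "qpoch_inf (a * qq ^ n) \<noteq> 0" using 1 by auto
  ultimately show ?thesis unfolding a_def[symmetric] using 1 by simp
qed

text \<open>The product in the denominator of \<open>qpoch\<close> starts \<open>n\<close> factors
  earlier than the one in the numerator.\<close>

lemma qpoch_neg:
  assumes "c \<noteq> 1"
  shows "qpoch (fls_const c * qq powi i) (- int n) = 1 / fpoch (fls_const c * qq powi (i - int n)) n"
proof -
  define a b where "a = fls_const c * qq powi i" and "b = fls_const c * qq powi (i - int n)"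
  have 1: "qpoch_inf b = fpoch b n * qpoch_inf (b * qq ^ n)" "qpoch_inf b \<noteq> 0"
    unfolding b_def by (rule qpoch_inf_const_split[OF assms])+
  have ba: "b * qq ^ n = a" "a * qq powi (- int n) = b"
    unfolding a_def b_def mult.assoc X_powi_mult_power X_powi_add by simp_all
  show ?thesis unfolding a_def[symmetric] b_def[symmetric] qpoch_def ba
    using 1 unfolding ba by auto
qed

lemma prod_X_power: "(\<Prod>j<n. qq ^ g j) = (qq ^ (\<Sum>j<n. g j) :: 'a::field fls)"
  by (simp add: power_sum)

text \<open>In reverse order the factors are \<open>1 + 1 / (d q^(j+1))\<close>; multiplying each by
  \<open>d q^(j+1)\<close> gives those on the right. At negative index the numerators of the
  bilateral series thus produce the denominators of \<open>kappa\<close>.\<close>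

lemma fpoch_inverse_const:
  fixes d :: "'a::field"
  assumes d: "d \<noteq> 0"
  shows "fls_const d ^ n * qq ^ (\<Sum>{..n}) * fpoch (fls_const (- 1 / d) * qq powi (0 - int n)) n
           = fpoch (- fls_const d * qq) n"
proof -
  define D where "D = fls_const d"
  have D: "D \<noteq> 0" "fls_const (- 1 / d) = - 1 / D"
    using d by (simp_all add: D_def divide_inverse fls_inverse_const)
  have S: "(\<Sum>{..n}) = (\<Sum>j<n. Suc j)"
    by (induction n) auto
  have "fpoch (fls_const (- 1 / d) * qq powi (0 - int n)) n
    = (\<Prod>j<n. 1 - fls_const (- 1 / d) * qq powi (0 - int n) * qq ^ (n - Suc j))"
    unfolding fpoch_def by (rule prod.nat_diff_reindex[symmetric])
  also have "\<dots> = (\<Prod>j<n. 1 + inverse (D * qq ^ Suc j))"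
  proof (intro prod.cong refl)
    fix j assume "j \<in> {..<n}"
    hence eq: "0 - int n + int (n - Suc j) = - int (Suc j)" by auto
    have "qq powi (0 - int n) * qq ^ (n - Suc j) = (inverse (qq ^ Suc j) :: 'a fls)"
      unfolding X_powi_mult_power eq by (simp only: power_int_minus power_int_of_nat)
    thus "1 - fls_const (- 1 / d) * qq powi (0 - int n) * qq ^ (n - Suc j) = 1 + inverse (D * qq ^ Suc j)"
      unfolding D(2) mult.assoc by (simp add: divide_inverse)
  qed
  finally have "D ^ n * qq ^ (\<Sum>{..n}) * fpoch (fls_const (- 1 / d) * qq powi (0 - int n)) n
    = (\<Prod>j<n. D * qq ^ Suc j * (1 + inverse (D * qq ^ Suc j)))"
    unfolding S prod_X_power[symmetric] prod.distrib by simp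
  also have "\<dots> = (\<Prod>j<n. 1 - (- D * qq) * qq ^ j)"
  proof (intro prod.cong refl)
    fix j
    have aux: "a * (1 + inverse a) = 1 + a" if "a \<noteq> 0" for a :: "'a fls"
      using that by (simp add: distrib_left)
    have "D * qq ^ Suc j \<noteq> 0" using D by simp
    from aux[OF this] show "D * qq ^ Suc j * (1 + inverse (D * qq ^ Suc j)) = 1 - (- D * qq) * qq ^ j"
      by (simp only: power_Suc) (simp add: mult.assoc)
  qed
  finally show ?thesis by (simp add: fpoch_def D_def)
qed

text \<open>The same reversal for the denominators of the bilateral series, which produce the
  numerators of \<open>kappa\<close> at negative index.\<close>

lemma fpoch_neg_const:
  fixes d :: "'a::field"
  shows "qq ^ (\<Sum>{..<n}) * fpoch (fls_const (- d) * qq powi (1 - int n)) n = rpoch (fls_const d) n"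
proof -
  define D where "D = fls_const d"
  have "fpoch (fls_const (- d) * qq powi (1 - int n)) n
    = (\<Prod>j<n. 1 - fls_const (- d) * qq powi (1 - int n) * qq ^ (n - Suc j))"
    unfolding fpoch_def by (rule prod.nat_diff_reindex[symmetric])
  also have "\<dots> = (\<Prod>j<n. 1 + D * inverse (qq ^ j))"
  proof (intro prod.cong refl)
    fix j assume "j \<in> {..<n}"
    hence eq: "1 - int n + int (n - Suc j) = - int j" by auto
    have "qq powi (1 - int n) * qq ^ (n - Suc j) = (inverse (qq ^ j) :: 'a fls)"
      unfolding X_powi_mult_power eq by (simp only: power_int_minus power_int_of_nat)
    thus "1 - fls_const (- d) * qq powi (1 - int n) * qq ^ (n - Suc j) = 1 + D * inverse (qq ^ j)"
      unfolding mult.assoc by (simp add: D_def)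
  qed
  finally have "qq ^ (\<Sum>{..<n}) * fpoch (fls_const (- d) * qq powi (1 - int n)) n
     = (\<Prod>j<n. qq ^ j * (1 + D * inverse (qq ^ j)))"
    unfolding prod_X_power[symmetric] prod.distrib by simp
  also have "\<dots> = (\<Prod>j<n. D + qq ^ j)"
    by (intro prod.cong refl) (simp add: distrib_left)
  finally show ?thesis by (simp add: rpoch_def D_def)
qed

lemma int_binomial_two: "int_binomial (int n + 1) 2 = int (\<Sum>{..n})" "int_binomial (1 - int n) 2 = int (\<Sum>{..<n})"
proof -
  have 2: "int_binomial a 2 = a * (a - 1) div 2" for a
    by (simp add: int_binomial_def numeral_2_eq_2)
  have "2 * int (\<Sum>{..n}) = (int n + 1) * int n" by (induction n) (auto simp: algebra_simps)
  hence h: "(int n + 1) * (int n + 1 - 1) = 2 * int (\<Sum>{..n})" by simp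
  show "int_binomial (int n + 1) 2 = int (\<Sum>{..n})" unfolding 2 h by simp
  have "2 * int (\<Sum>{..<n}) = (1 - int n) * (- int n)" by (induction n) (auto simp: algebra_simps)
  hence h: "(1 - int n) * (1 - int n - 1) = 2 * int (\<Sum>{..<n})" by simp
  show "int_binomial (1 - int n) 2 = int (\<Sum>{..<n})" unfolding 2 h by simp
qed

context
  fixes d e :: "'a::field"
  assumes de: "d \<noteq> 0" "e \<noteq> 0" "d \<noteq> - 1" "e \<noteq> - 1"
    and inf: "infinite (UNIV :: 'a set)"
begin

definition bilateral_term :: "nat \<Rightarrow> int \<Rightarrow> 'a fls" where
  "bilateral_term v n =
     ((- 1) powi (n - 1) * qq powi (int_binomial (n + 1) 2 + int v * n) *
        (fls_const d * fls_const e) powi n *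
        (qpoch (- 1 / fls_const d) n * qpoch (- 1 / fls_const e) n)) /
     ((1 - qq powi n) ^ (2 * v) * (qpoch (- fls_const d * qq) n * qpoch (- fls_const e * qq) n))"

lemma qpoch_bases:
  assumes "c \<noteq> 0"
  shows "- 1 / fls_const c = fls_const (- 1 / c) * qq powi 0"
    and "- fls_const c * qq = fls_const (- c) * qq powi 1"
  using assms by (simp_all add: divide_inverse fls_inverse_const fls_const_uminus del: fls_X_power_int)

text \<open>The constants of the four bases in \<open>bilateral_term\<close>; differing from 1 keeps
  zero factors out of \<open>qpoch\<close> at every index.\<close>

lemma inverse_ne: "- 1 / d \<noteq> 1" "- 1 / e \<noteq> 1" "- d \<noteq> 1" "- e \<noteq> 1"
  using de by (auto simp: field_simps minus_equation_iff)

text \<open>The power \<open>(d e)^n\<close> turns the numerators into \<open>rpoch\<close>. One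
  factor \<open>q^n\<close> of \<open>q^(v n)\<close> belongs to \<open>kappa\<close>, which leaves
  the exponent \<open>v - 1\<close>.\<close>

lemma bilateral_term_pos:
  assumes n: "n > 0" and v: "v > 0"
  shows "bilateral_term v (int n) =
           - (theta_coeff d e n * (qq ^ n) ^ (v - 1) / (1 - qq ^ n) ^ (2 * v))"
proof -
  define D E x where "D = fls_const d" and "E = fls_const e" and "x = (qq ^ n :: 'a fls)"
  have D: "D \<noteq> 0" "E \<noteq> 0" using de by (simp_all add: D_def E_def)
  have q: "qpoch (- 1 / D) (int n) = fpoch (- 1 / D) n" "qpoch (- 1 / E) (int n) = fpoch (- 1 / E) n"
    "qpoch (- D * qq) (int n) = fpoch (- D * qq) n" "qpoch (- E * qq) (int n) = fpoch (- E * qq) n"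
    unfolding D_def E_def qpoch_bases[OF de(1)] qpoch_bases[OF de(2)]
    by (intro qpoch_nonneg inverse_ne)+
  have sg: "(- 1 :: 'a fls) powi (int n - 1) = - ((- 1) ^ n)"
  proof -
    obtain m where m: "n = Suc m" using n by (cases n) auto
    have "int n - 1 = int m" by (simp add: m)
    thus ?thesis by (simp only: power_int_of_nat m) simp
  qed
  have ex: "qq powi (int_binomial (int n + 1) 2 + int v * int n) = (qq ^ (\<Sum>{..n}) * (x * x ^ (v - 1)) :: 'a fls)"
  proof -
    have "int_binomial (int n + 1) 2 + int v * int n = int (\<Sum>{..n} + n * v)"
      unfolding int_binomial_two by (simp add: mult.commute)
    hence "qq powi (int_binomial (int n + 1) 2 + int v * int n) = (qq ^ (\<Sum>{..n}) * x ^ v :: 'a fls)"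
      by (simp only: power_int_of_nat power_add power_mult x_def)
    thus ?thesis using v by (simp add: power_eq_if[of x v])
  qed
  show ?thesis
    unfolding bilateral_term_def D_def[symmetric] E_def[symmetric] q sg ex power_int_of_nat
      theta_coeff_def[OF de(1,2)] kappa_def rpoch_conv_fpoch[OF D(1)] rpoch_conv_fpoch[OF D(2)]
      x_def[symmetric]
    by (simp add: power_mult_distrib mult_ac)
qed

text \<open>Replacing \<open>n\<close> by \<open>- n\<close> makes numerators and denominators trade
  places; compared with the term at \<open>n\<close>, one further factor \<open>q^n\<close>
  results.\<close>

lemma bilateral_term_neg:
  assumes n: "n > 0" and v: "v > 0"
  shows "bilateral_term v (- int n) =
           - (theta_coeff d e n * (qq ^ n) ^ v / (1 - qq ^ n) ^ (2 * v))"
proof -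
  define D E x where "D = fls_const d" and "E = fls_const e" and "x = (qq ^ n :: 'a fls)"
  define s s' where "s = (qq ^ (\<Sum>{..n}) :: 'a fls)" and "s' = (qq ^ (\<Sum>{..<n}) :: 'a fls)"
  define fd fe rd re where "fd = fpoch (- D * qq) n" and "fe = fpoch (- E * qq) n"
    and "rd = rpoch D n" and "re = rpoch E n"
  have D: "D \<noteq> 0" "E \<noteq> 0" using de by (simp_all add: D_def E_def)
  have nz: "x \<noteq> 0" "s \<noteq> 0" "s' \<noteq> 0" by (simp_all add: x_def s_def s'_def)
  have f0: "fd \<noteq> 0" "fe \<noteq> 0" unfolding fd_def fe_def D_def E_def
    by (intro fls_one_unit_nz fls_one_unit_fpoch fls_ge_times_X fls_ge_uminus fls_ge_const)+
  have ss: "s = s' * x"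
    by (simp add: s_def s'_def x_def lessThan_Suc_atMost[symmetric] power_add)
  have "fpoch (fls_const (- 1 / d) * qq powi (0 - int n)) n = fd / (D ^ n * s)"
    "fpoch (fls_const (- 1 / e) * qq powi (0 - int n)) n = fe / (E ^ n * s)"
  proof -
    have aux: "f = g / (a * b)" if "a * b * f = g" "a \<noteq> 0" "b \<noteq> 0" for a b f g :: "'a fls"
      using that by auto
    have "D ^ n \<noteq> 0" "E ^ n \<noteq> 0" using D by simp_all
    thus "fpoch (fls_const (- 1 / d) * qq powi (0 - int n)) n = fd / (D ^ n * s)"
      "fpoch (fls_const (- 1 / e) * qq powi (0 - int n)) n = fe / (E ^ n * s)"
      using fpoch_inverse_const[OF de(1), of n] fpoch_inverse_const[OF de(2), of n] nz(2)
      unfolding fd_def fe_def s_def[symmetric] D_def[symmetric] E_def[symmetric]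
      by (blast intro: aux)+
  qed
  moreover have "fpoch (fls_const (- d) * qq powi (1 - int n)) n = rd / s'"
    "fpoch (fls_const (- e) * qq powi (1 - int n)) n = re / s'"
    using fpoch_neg_const[of n d] fpoch_neg_const[of n e] nz
    unfolding rd_def re_def s'_def[symmetric] D_def[symmetric] E_def[symmetric]
    by (simp_all add: nonzero_eq_divide_eq mult.commute)
  ultimately have q: "qpoch (- 1 / D) (- int n) = 1 / (fd / (D ^ n * s))"
    "qpoch (- 1 / E) (- int n) = 1 / (fe / (E ^ n * s))"
    "qpoch (- D * qq) (- int n) = 1 / (rd / s')" "qpoch (- E * qq) (- int n) = 1 / (re / s')"
    unfolding D_def E_def qpoch_bases[OF de(1)] qpoch_bases[OF de(2)]
    by (simp_all only: qpoch_neg[OF inverse_ne(1)] qpoch_neg[OF inverse_ne(2)]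
        qpoch_neg[OF inverse_ne(3)] qpoch_neg[OF inverse_ne(4)])
  have sg: "(- 1 :: 'a fls) powi (- int n - 1) = - ((- 1) ^ n)"
  proof -
    have "- int n - 1 = - int (Suc n)" by simp
    thus ?thesis by (simp only: power_int_minus power_int_of_nat) (simp flip: power_inverse)
  qed
  have ex: "qq powi (int_binomial (- int n + 1) 2 + int v * (- int n)) = s' / x ^ v"
  proof -
    have eq: "int_binomial (- int n + 1) 2 + int v * (- int n) = int (\<Sum>{..<n}) - int (n * v)"
      using int_binomial_two(2)[of n] by (simp add: mult.commute)
    show ?thesis unfolding eq s'_def x_def
      by (subst power_int_diff) (simp_all only: power_int_of_nat power_mult, simp)
  qed
  \<comment> \<open>The even exponent removes the sign in
    \<open>1 - 1/x = - (1 - x) / x\<close>.\<close>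
  have x1: "(1 - qq powi (- int n)) ^ (2 * v) = (1 - x) ^ (2 * v) / (x ^ v * x ^ v)"
  proof -
    have "1 - qq powi (- int n) = - ((1 - x) / x)"
      using nz unfolding power_int_minus power_int_of_nat x_def[symmetric] by (simp add: field_simps)
    hence "(1 - qq powi (- int n)) ^ (2 * v) = ((1 - x) / x) ^ (2 * v)" by simp
    thus ?thesis by (simp add: power_divide mult_2 power_add)
  qed
  have dn: "(D * E) powi (- int n) = 1 / (D ^ n * E ^ n)"
    by (simp only: power_int_minus power_int_of_nat) (simp add: power_mult_distrib divide_inverse)
  have th: "theta_coeff d e n = (- 1) ^ n * s * (rd * re * x / (fd * fe))"
    by (simp add: theta_coeff_def[OF de(1,2)] kappa_def rd_def re_def fd_def fe_def s_def x_def D_def E_def)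
  define w where "w = (1 - x) ^ (2 * v)"
  have "w \<noteq> 0" unfolding w_def x_def using one_minus_X_power_nz[OF n, where 'a = 'a] by simp
  define X where "X = x ^ v"
  have "X \<noteq> 0" using nz by (simp add: X_def)
  define dd ee where "dd = D ^ n" and "ee = E ^ n"
  have "dd \<noteq> 0" "ee \<noteq> 0" using D by (simp_all add: dd_def ee_def)
  show ?thesis
    unfolding bilateral_term_def D_def[symmetric] E_def[symmetric] q sg ex x1 dn th x_def[symmetric]
      w_def[symmetric] X_def[symmetric] dd_def[symmetric] ee_def[symmetric] ss
    using nz f0 \<open>w \<noteq> 0\<close> \<open>X \<noteq> 0\<close> \<open>dd \<noteq> 0\<close> \<open>ee \<noteq> 0\<close> by (simp add: mult_ac)
qed

lemma N_even_eq:
  assumes v: "v > 0"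
  shows "N_even v (fls_const d) (fls_const e) =
     pair_product (fls_const d) (fls_const e) * (\<Sum>r. even_moment_term d e v (Suc r))"
proof -
  have pn: "fls_ge (int n) (bilateral_term v (int n))" "fls_ge (int n) (bilateral_term v (- int n))"
    if "n > 0" for n
    unfolding bilateral_term_pos[OF that v] bilateral_term_neg[OF that v] power_mult[symmetric]
    using that by (intro fls_ge_uminus fls_ge_divide fls_ge_mult'[of "int n" _ 0] fls_ge_theta[OF de(1,2)]
      fls_ge_X_power fls_one_unit_power fls_one_unit_minus; simp)+
  have ge: "fls_ge \<bar>m\<bar> (bilateral_term v m)" if "m \<noteq> 0" for m
  proof (cases "m > 0")
    case True
    thus ?thesis using pn(1)[of "nat m"] by simp
  next
    case False
    thus ?thesis using pn(2)[of "nat (- m)"] that by simp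
  qed
  have "bilateral_term v (int j + 1) + bilateral_term v (- int j - 1) = even_moment_term d e v (Suc j)" for j
  proof -
    define th X Y w where "th = theta_coeff d e (Suc j)" and "X = (qq ^ Suc j :: 'a fls) ^ (v - 1)"
      and "Y = (qq ^ Suc j :: 'a fls)" and "w = (1 - qq ^ Suc j :: 'a fls) ^ (2 * v)"
    have Xv: "(qq ^ Suc j) ^ v = Y * X" unfolding X_def Y_def
      using v by (metis power_minus_mult mult.commute)
    have "int j + 1 = int (Suc j)" "- int j - 1 = - int (Suc j)" by simp_all
    hence "bilateral_term v (int j + 1) + bilateral_term v (- int j - 1) = - (th * X / w) + - (th * (Y * X) / w)"
      by (simp only: bilateral_term_pos[OF zero_less_Suc v] bilateral_term_neg[OF zero_less_Suc v]
          Xv th_def X_def w_def)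
    also have "\<dots> = - (th * X * (1 + Y) / w)"
      by (simp add: distrib_left add_divide_distrib mult_ac)
    finally show ?thesis
      by (simp only: even_moment_term_def[OF de(1,2) inf] th_def X_def Y_def w_def)
  qed
  hence "(\<Sum>\<^sub>\<infinity>n\<in>UNIV - {0}. bilateral_term v n) = (\<Sum>r. even_moment_term d e v (Suc r))"
    using infsumI[OF has_sum_int_nonzero_fls[of "bilateral_term v", OF ge]] by simp
  thus ?thesis unfolding N_even_def pair_product_def bilateral_term_def[abs_def] by (rule arg_cong)
qed

end

lemma infinite_ratfun: "infinite (UNIV :: ratfun set)"
proof -
  have "inj (\<lambda>n::nat. to_fract (of_nat n :: int poly poly))"
    by (rule injI) simp
  thus ?thesis using finite_subset[OF subset_UNIV] range_inj_infinite by blast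
qed

theorem theorem2p1:
  fixes k :: nat
  assumes "k \<ge> 1"
  shows "((\<lambda>(r, s, n). of_int (eta k r s n) * ind_d ^ r * ind_e ^ s * qq ^ n) has_sum
           (if odd k then 0 else N_even (k div 2) ind_d ind_e)) UNIV"
proof -
  define d e :: ratfun where "d = to_fract [:[:0, 1:]:]" and "e = to_fract [:0, 1:]"
  have ind: "ind_d = fls_const d" "ind_e = fls_const e" by (simp_all add: ind_d_def ind_e_def d_def e_def)
  \<comment> \<open>With -1 written as an embedded polynomial, the conditions on \<open>d\<close>
    and \<open>e\<close> become inequalities between polynomials.\<close>
  have m1: "(- 1 :: ratfun) = to_fract (- 1)" by simp
  have de: "d \<noteq> 0" "e \<noteq> 0" "d \<noteq> - 1" "e \<noteq> - 1"
    unfolding d_def e_def m1 to_fract_eq_iff to_fract_eq_0_iff by (simp_all add: one_pCons)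
  show ?thesis
  proof (cases "odd k")
    case True
    thus ?thesis unfolding ind
      by (simp only: if_True) (rule eta_has_sum[OF de(1,2) infinite_ratfun],
        simp_all add: moment_coeff_odd[OF de(1,2) infinite_ratfun])
  next
    case False
    then obtain v where k: "k = 2 * v" by auto
    have v: "v > 0" using assms k by simp
    define S where "S = N_even v (fls_const d) (fls_const e)"
    have S: "S = pair_product (fls_const d) (fls_const e) * (\<Sum>r. even_moment_term d e v (Suc r))"
      unfolding S_def by (rule N_even_eq[OF de infinite_ratfun v])
    have "fls_ge 0 S" unfolding S
      by (intro fls_ge_mult'[of 0 _ 0] fls_ge_pair_product[OF de(1,2)] suminf_fls_ge
          fls_ge_mono[OF fls_ge_even_moment_term[OF de(1,2) infinite_ratfun]]) auto
    moreover have "S $$ int n = moment_coeff d e k n" for n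
      unfolding k S by (rule moment_coeff_even[OF de(1,2) infinite_ratfun v, symmetric])
    ultimately have "((\<lambda>(r, s, n). of_int (eta k r s n) * fls_const d ^ r * fls_const e ^ s * qq ^ n) has_sum S) UNIV"
      by (intro eta_has_sum[OF de(1,2) infinite_ratfun])
    thus ?thesis unfolding ind using False by (simp add: k S_def)
  qed
qed

end
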